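(* Let $P=(P(i,j))_{(i,j)\in\mathbb{N}^2}$ be an irreducible and aperiodic Markov kernel on $\mathbb{N}$ with a unique invariant probability measure $\pi=(\pi(i))_{i\in\mathbb{N}}$, and suppose that there exist $i_0\in\mathbb{N}$ and $N\in\mathbb{N}$, $N\ge 1$, such that for all $i\ge i_0$ and all $j\in\mathbb{N}$, $|i-j|>N$ implies $P(i,j)=0$. Assume moreover that: (i) for every $m=-N,\ldots,N$, $P(i,i+m)\to a_m\in[0,1]$ as $i\to+\infty$; (ii) $\pi(i+1)/\pi(i)\to\tau\in[0,1)$ as $i\to+\infty$; (iii) $\sum_{k=-N}^{N}k\,a_k<0$. Let $V:=(\pi(n)^{-1/2})_{n\in\mathbb{N}}$. Then $$\alpha_0:=\sum_{m=-N}^{N}\limsup_{i\to+\infty}\sqrt{P(i,i+m)\,P^*(i+m,i)}\ <\ 1,\qquad\text{where } \alpha_0=\begin{cases}\sum_{m=-N}^{N}a_m\,\tau^{-m/2} & \text{if }\tau\in(0,1),\\ a_0 & \text{if }\tau=0.\end{cases}$$ Moreover $P$ has both the spectral gap property on $\ell^2(\pi)$ and the spectral gap property on $\mathcal{B}_V$, one has $$\max\big(r_{ess}(P_{|\mathcal{B}_V}),\,r_{ess}(P_{|\ell^2(\pi)})\big)\le\alpha_0,$$ and the following assertions hold: (a) if $\varrho_V\le\alpha_0$, then $\varrho_2\le\alpha_0$; (b) if $\varrho_V>\alpha_0$, then $\varrho_2=\varrho_V$.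
   Context: $\mathbb{N}=\{0,1,2,\ldots\}$. $\ell^2(\pi)$ is the Hilbert space of complex sequences $f=(f(i))_{i\in\mathbb{N}}$ with $\|f\|_2:=\big(\sum_{i\ge0}|f(i)|^2\pi(i)\big)^{1/2}<\infty$. $P$ acts by $(Pf)(i)=\sum_jP(i,j)f(j)$; its adjoint on $\ell^2(\pi)$ is given by $P^*(i,j):=\pi(j)P(j,i)/\pi(i)$. $\mathcal{B}_V$ is the Banach space of complex sequences $g=(g(n))_{n\in\mathbb{N}}$ with $\|g\|_V:=\sup_{n}V(n)^{-1}|g(n)|<\infty$. $P_{|\ell^2(\pi)}$ and $P_{|\mathcal{B}_V}$ denote the operators induced by $P$ on these spaces. $\Pi f:=\pi(f)1_{\mathbb{N}}$, where $\pi(f):=\sum_{i\ge0}f(i)\pi(i)$ and $1_{\mathbb{N}}$ is the constant sequence $1$. Spectral gap property on $\ell^2(\pi)$: there exist $\rho\in(0,1)$ and $C\in(0,+\infty)$ such that $\|P^nf-\Pi f\|_2\le C\rho^n\|f\|_2$ for all $n\ge1$, $f\in\ell^2(\pi)$; $\varrho_2$ is the infimum of the $\rho\in(0,1)$ for which this holds with some $C\in(0,+\infty)$. Spectral gap property on $\mathcal{B}_V$ ($V$-geometric ergodicity): there exist $\rho\in(0,1)$ and $C\in(0,+\infty)$ such that $\|P^nf-\Pi f\|_V\le C\rho^n\|f\|_V$ for all $n\ge1$, $f\in\mathcal{B}_V$; $\varrho_V$ is the infimum of the $\rho\in(0,1)$ for which this holds with some $C\in(0,+\infty)$. For a bounded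 linear operator $T$ on a complex Banach space, $r_{ess}(T)$ denotes its essential spectral radius, i.e. the infimum of the $r\ge0$ such that every spectral value $\lambda$ of $T$ with $|\lambda|>r$ is an isolated point of the spectrum and an eigenvalue of finite algebraic multiplicity. *)

theory Defs
  imports "HOL-Complex_Analysis.Complex_Analysis"
begin

section \<open>Markov kernels on the natural numbers\<close>

definition markov_kernel :: "(nat \<Rightarrow> nat \<Rightarrow> real) \<Rightarrow> bool" where
  "markov_kernel P \<longleftrightarrow> (\<forall>i j. 0 \<le> P i j) \<and> (\<forall>i. P i sums 1)"

primrec n_step :: "(nat \<Rightarrow> nat \<Rightarrow> real) \<Rightarrow> nat \<Rightarrow> nat \<Rightarrow> nat \<Rightarrow> real" where
  "n_step P 0 i j = of_bool (i = j)"
| "n_step P (Suc n) i j = (\<Sum>k. P i k * n_step P n k j)"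

definition irreducible_kernel :: "(nat \<Rightarrow> nat \<Rightarrow> real) \<Rightarrow> bool" where
  "irreducible_kernel P \<longleftrightarrow> (\<forall>i j. \<exists>n. 0 < n_step P n i j)"

definition aperiodic_kernel :: "(nat \<Rightarrow> nat \<Rightarrow> real) \<Rightarrow> bool" where
  "aperiodic_kernel P \<longleftrightarrow> (\<forall>i. Gcd {n. 1 \<le> n \<and> 0 < n_step P n i i} = 1)"

definition invariant_prob :: "(nat \<Rightarrow> nat \<Rightarrow> real) \<Rightarrow> (nat \<Rightarrow> real) \<Rightarrow> bool" where
  "invariant_prob P \<mu> \<longleftrightarrow> (\<forall>i. 0 \<le> \<mu> i) \<and> \<mu> sums 1 \<and>
     (\<forall>j. (\<lambda>i. \<mu> i * P i j) sums \<mu> j)"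

definition adjoint_kernel :: "(nat \<Rightarrow> real) \<Rightarrow> (nat \<Rightarrow> nat \<Rightarrow> real) \<Rightarrow> nat \<Rightarrow> nat \<Rightarrow> real" where
  "adjoint_kernel \<pi> P i j = \<pi> j * P j i / \<pi> i"

definition kernel_op :: "(nat \<Rightarrow> nat \<Rightarrow> real) \<Rightarrow> (nat \<Rightarrow> complex) \<Rightarrow> nat \<Rightarrow> complex" where
  "kernel_op P f = (\<lambda>i. \<Sum>j. of_real (P i j) * f j)"

definition mean_op :: "(nat \<Rightarrow> real) \<Rightarrow> (nat \<Rightarrow> complex) \<Rightarrow> nat \<Rightarrow> complex" where
  "mean_op \<pi> f = (\<lambda>i. \<Sum>j. f j * of_real (\<pi> j))"

text \<open>Real-valued functions have no \<^term>\<open>limsup\<close> in the library, hence the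
  value in \<^typ>\<open>ereal\<close>. The truncation in \<^term>\<open>nat (int i + m)\<close> only affects
  indices \<open>i < N\<close>, which the limit superior does not see.\<close>

definition alpha0 :: "(nat \<Rightarrow> nat \<Rightarrow> real) \<Rightarrow> (nat \<Rightarrow> real) \<Rightarrow> nat \<Rightarrow> ereal" where
  "alpha0 P \<pi> N = (\<Sum>m = - int N..int N. limsup (\<lambda>i.
     ereal (sqrt (P i (nat (int i + m)) * adjoint_kernel \<pi> P (nat (int i + m)) i))))"


section \<open>The two sequence spaces\<close>

text \<open>Each space is given by its set of elements together with a norm that is
  meaningful on that set only.\<close>

definition l2_space :: "(nat \<Rightarrow> real) \<Rightarrow> (nat \<Rightarrow> complex) set" where
  "l2_space \<pi> = {f. summable (\<lambda>i. (cmod (f i))\<^sup>2 * \<pi> i)}"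

definition l2_norm :: "(nat \<Rightarrow> real) \<Rightarrow> (nat \<Rightarrow> complex) \<Rightarrow> real" where
  "l2_norm \<pi> f = sqrt (\<Sum>i. (cmod (f i))\<^sup>2 * \<pi> i)"

definition weighted_space :: "(nat \<Rightarrow> real) \<Rightarrow> (nat \<Rightarrow> complex) set" where
  "weighted_space V = {g. bdd_above (range (\<lambda>n. inverse (V n) * cmod (g n)))}"

definition weighted_norm :: "(nat \<Rightarrow> real) \<Rightarrow> (nat \<Rightarrow> complex) \<Rightarrow> real" where
  "weighted_norm V g = (SUP n. inverse (V n) * cmod (g n))"


section \<open>Bounded operators on a space of complex sequences\<close>

text \<open>In this section \<open>X\<close> is a linear space of complex sequences and \<open>nrm\<close> a norm
  on it.\<close>

definition bounded_op ::
    "(nat \<Rightarrow> complex) set \<Rightarrow> ((nat \<Rightarrow> complex) \<Rightarrow> real) \<Rightarrow>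
     ((nat \<Rightarrow> complex) \<Rightarrow> nat \<Rightarrow> complex) \<Rightarrow> bool" where
  "bounded_op X nrm T \<longleftrightarrow>
     (\<forall>f\<in>X. T f \<in> X) \<and>
     (\<forall>f\<in>X. \<forall>g\<in>X. T (\<lambda>i. f i + g i) = (\<lambda>i. T f i + T g i)) \<and>
     (\<forall>c. \<forall>f\<in>X. T (\<lambda>i. c * f i) = (\<lambda>i. c * T f i)) \<and>
     (\<exists>C. \<forall>f\<in>X. nrm (T f) \<le> C * nrm f)"

definition op_spectrum ::
    "(nat \<Rightarrow> complex) set \<Rightarrow> ((nat \<Rightarrow> complex) \<Rightarrow> real) \<Rightarrow>
     ((nat \<Rightarrow> complex) \<Rightarrow> nat \<Rightarrow> complex) \<Rightarrow> complex set" where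
  "op_spectrum X nrm T = {z. \<not> (\<exists>S. bounded_op X nrm S \<and>
     (\<forall>f\<in>X. S (\<lambda>i. z * f i - T f i) = f \<and> (\<lambda>i. z * S f i - T (S f) i) = f))}"

definition op_resolvent ::
    "(nat \<Rightarrow> complex) set \<Rightarrow> ((nat \<Rightarrow> complex) \<Rightarrow> nat \<Rightarrow> complex) \<Rightarrow>
     complex \<Rightarrow> (nat \<Rightarrow> complex) \<Rightarrow> nat \<Rightarrow> complex" where
  "op_resolvent X T z f = (THE g. g \<in> X \<and> (\<lambda>i. z * g i - T g i) = f)"

definition op_eigenvalue ::
    "(nat \<Rightarrow> complex) set \<Rightarrow> ((nat \<Rightarrow> complex) \<Rightarrow> nat \<Rightarrow> complex) \<Rightarrow> complex \<Rightarrow> bool" where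
  "op_eigenvalue X T z \<longleftrightarrow> (\<exists>f\<in>X. f \<noteq> (\<lambda>_. 0) \<and> T f = (\<lambda>i. z * f i))"

text \<open>The Riesz spectral projection at an isolated point \<open>z\<close> of the spectrum is the
  integral of the resolvent over a small circle around \<open>z\<close>, divided by \<open>2 \<pi> \<i>\<close>. It is
  written coordinatewise, which agrees with the operator-valued integral because point
  evaluations are continuous on the spaces considered here.\<close>

definition riesz_projection ::
    "(nat \<Rightarrow> complex) set \<Rightarrow> ((nat \<Rightarrow> complex) \<Rightarrow> nat \<Rightarrow> complex) \<Rightarrow>
     complex \<Rightarrow> real \<Rightarrow> (nat \<Rightarrow> complex) \<Rightarrow> nat \<Rightarrow> complex" where
  "riesz_projection X T z r f = (\<lambda>i.
     contour_integral (circlepath z r) (\<lambda>w. op_resolvent X T w f i) / (2 * of_real pi * \<i>))"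

text \<open>The algebraic multiplicity of an isolated point of the spectrum is the rank of its
  Riesz projection. (In infinite dimension the space of generalised eigenvectors alone can
  be strictly smaller than the range of that projection.) The radius is immaterial as long
  as the closed disc meets the spectrum in \<open>z\<close> only.\<close>

definition finite_dim :: "(nat \<Rightarrow> complex) set \<Rightarrow> bool" where
  "finite_dim W \<longleftrightarrow> (\<exists>B. finite B \<and> (\<forall>g\<in>W. \<exists>c. g = (\<lambda>i. \<Sum>b\<in>B. c b * b i)))"

definition finite_alg_mult ::
    "(nat \<Rightarrow> complex) set \<Rightarrow> ((nat \<Rightarrow> complex) \<Rightarrow> real) \<Rightarrow>
     ((nat \<Rightarrow> complex) \<Rightarrow> nat \<Rightarrow> complex) \<Rightarrow> complex \<Rightarrow> bool" where
  "finite_alg_mult X nrm T z \<longleftrightarrow> (\<exists>r>0. cball z r \<inter> op_spectrum X nrm T = {z} \<and>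
     finite_dim (riesz_projection X T z r ` X))"

definition ess_spectral_radius ::
    "(nat \<Rightarrow> complex) set \<Rightarrow> ((nat \<Rightarrow> complex) \<Rightarrow> real) \<Rightarrow>
     ((nat \<Rightarrow> complex) \<Rightarrow> nat \<Rightarrow> complex) \<Rightarrow> ereal" where
  "ess_spectral_radius X nrm T = Inf {ereal r | r. 0 \<le> r \<and>
     (\<forall>z\<in>op_spectrum X nrm T. r < cmod z \<longrightarrow>
        z isolated_in op_spectrum X nrm T \<and> op_eigenvalue X T z \<and> finite_alg_mult X nrm T z)}"


section \<open>Spectral gap\<close>

definition gap_rates ::
    "(nat \<Rightarrow> complex) set \<Rightarrow> ((nat \<Rightarrow> complex) \<Rightarrow> real) \<Rightarrow>
     (nat \<Rightarrow> nat \<Rightarrow> real) \<Rightarrow> (nat \<Rightarrow> real) \<Rightarrow> real set" where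
  "gap_rates X nrm P \<pi> = {\<rho>. 0 < \<rho> \<and> \<rho> < 1 \<and> (\<exists>C>0. \<forall>n\<ge>1. \<forall>f\<in>X.
     (\<lambda>i. (kernel_op P ^^ n) f i - mean_op \<pi> f i) \<in> X \<and>
     nrm (\<lambda>i. (kernel_op P ^^ n) f i - mean_op \<pi> f i) \<le> C * \<rho> ^ n * nrm f)}"

definition spectral_gap ::
    "(nat \<Rightarrow> complex) set \<Rightarrow> ((nat \<Rightarrow> complex) \<Rightarrow> real) \<Rightarrow>
     (nat \<Rightarrow> nat \<Rightarrow> real) \<Rightarrow> (nat \<Rightarrow> real) \<Rightarrow> bool" where
  "spectral_gap X nrm P \<pi> \<longleftrightarrow> gap_rates X nrm P \<pi> \<noteq> {}"

definition gap_rate ::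
    "(nat \<Rightarrow> complex) set \<Rightarrow> ((nat \<Rightarrow> complex) \<Rightarrow> real) \<Rightarrow>
     (nat \<Rightarrow> nat \<Rightarrow> real) \<Rightarrow> (nat \<Rightarrow> real) \<Rightarrow> real" where
  "gap_rate X nrm P \<pi> = Inf (gap_rates X nrm P \<pi>)"

end

theory Submission
  imports Defs "Jordan_Normal_Form.Determinant"
begin

text \<open>
  The kernel is split as \<open>P = A + K\<close>, where \<open>A\<close> consists of the rows \<open>i \<ge> M\<close>, so that \<open>K\<close> has
  finite rank. Conjugation with the square root of \<open>\<pi>\<close> turns the two spaces into the unweighted
  spaces of square summable and of bounded sequences. It turns the entry \<open>P(i, i + m)\<close> into
  \<open>P(i, i + m) sqrt (\<pi>(i) / \<pi>(i + m))\<close>, the square root of \<open>P(i, i + m) P*(i + m, i)\<close>. For large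
  \<open>M\<close> the conjugated \<open>A\<close> is a sum of \<open>2 N + 1\<close> weighted shifts. On either space the norm of a
  weighted shift is at most the supremum of its weights, so for each \<open>r > alpha0\<close> the norm of \<open>A\<close> is
  at most \<open>r\<close> once \<open>M\<close> is large (\<open>tail_pointwise\<close>, \<open>chain_space_l2\<close>,
  \<open>chain_space_weighted\<close>). That \<open>alpha0 < 1\<close> is the inequality of arithmetic and geometric means:
  for \<open>\<tau> > 0\<close> the rows of \<open>P\<close> give \<open>\<Sum> a(m) = 1\<close>, invariance gives that the sum of the
  \<open>a(m) / \<tau>\<^sup>m\<close> is at most 1, and the negative drift makes the inequality strict (\<open>\<alpha>_less_1\<close>).

  For \<open>|z| > r\<close> the operator \<open>z - A\<close> is inverted by its Neumann series, and solving
  \<open>z g - P g = f\<close> reduces to a finite linear system for the coefficients of \<open>K g\<close>, holomorphic in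
  \<open>z\<close>. The zeros of its determinant are the spectral values outside the disc, and they are
  eigenvalues (\<open>spectrum_iff\<close>, \<open>eigenvalue_iff\<close>). They are isolated, and at a zero of order \<open>n\<close>
  the residue of the resolvent takes values in the span of finitely many vectors
  (\<open>riesz_finite_rank\<close>). This bounds the essential spectral radius.

  The same reduction controls powers: if there is no eigenvalue of modulus above \<open>\<rho>0\<close>, the powers
  grow at most like \<open>\<rho>\<^sup>n\<close> for every \<open>\<rho> > \<rho>0\<close> (\<open>power_growth\<close>). It is applied to \<open>P - \<Pi>\<close>,
  where \<open>\<Pi>\<close> is the projection to the mean. This is again a finite-rank perturbation of \<open>A\<close>, and
  its powers are \<open>P\<^sup>n - \<Pi>\<close>. The outcome is that for \<open>\<rho>\<close> between \<open>alpha0\<close> and 1 the gap rate is at most \<open>\<rho>\<close> if and only if every eigenfunction of \<open>P\<close> with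
  eigenvalue of modulus above \<open>\<rho>\<close> is constant (\<open>chain_space.gap_rate_le_iff\<close>). This condition
  does not depend on the space: such an eigenfunction is the resolvent of \<open>A\<close> applied to a
  finitely supported sequence, hence square summable (\<open>eigenfunction_transfer\<close>). So the two
  gap rates are compared with the same numbers above \<open>alpha0\<close>, and both final assertions follow.

  That there is a gap at all means that eigenfunctions for \<open>|z| \<ge> 1\<close> are constant. By the
  transfer it is enough to treat square summable ones. Equality in the variance inequality forces
  \<open>f(j) = z f(i)\<close> whenever \<open>P(i, j) > 0\<close>, and aperiodicity and irreducibility do the rest
  (\<open>peripheral_eigenfunction_const\<close>).
\<close>

section \<open>Linear systems and their characteristic determinant\<close>

text \<open>
  The number of unknowns varies, and the coefficients are functions of a complex parameter.
  The matrix entries are therefore given by a function of two indices; only the indices below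
  \<open>d\<close> matter.
\<close>
definition lin_det :: "nat \<Rightarrow> (nat \<Rightarrow> nat \<Rightarrow> complex) \<Rightarrow> complex" where
  "lin_det d M = Determinant.det (Matrix.mat d d (\<lambda>(k, l). M k l))"

definition lin_adj :: "nat \<Rightarrow> (nat \<Rightarrow> nat \<Rightarrow> complex) \<Rightarrow> nat \<Rightarrow> nat \<Rightarrow> complex" where
  "lin_adj d M k l = adj_mat (Matrix.mat d d (\<lambda>(k, l). M k l)) $$ (k, l)"

lemma lin_adj_mult:
  assumes "k < d" "l < d"
  shows "(\<Sum>j<d. lin_adj d M k j * M j l) = (if k = l then lin_det d M else 0)"
    and "(\<Sum>j<d. M k j * lin_adj d M j l) = (if k = l then lin_det d M else 0)"
proof -
  define A where "A = Matrix.mat d d (\<lambda>(k, l). M k l)"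
  have A: "A \<in> carrier_mat d d" by (simp add: A_def)
  have "(adj_mat A * A) $$ (k, l) = (Determinant.det A \<cdot>\<^sub>m 1\<^sub>m d) $$ (k, l)"
    "(A * adj_mat A) $$ (k, l) = (Determinant.det A \<cdot>\<^sub>m 1\<^sub>m d) $$ (k, l)"
    using adj_mat[OF A] by simp_all
  moreover have "(adj_mat A * A) $$ (k, l) = (\<Sum>j<d. lin_adj d M k j * M j l)"
    "(A * adj_mat A) $$ (k, l) = (\<Sum>j<d. M k j * lin_adj d M j l)"
    using assms A adj_mat(1)[OF A]
    by (auto simp: scalar_prod_def lin_adj_def A_def[symmetric] intro!: sum.cong)
       (auto simp: A_def)
  ultimately show "(\<Sum>j<d. lin_adj d M k j * M j l) = (if k = l then lin_det d M else 0)"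
    and "(\<Sum>j<d. M k j * lin_adj d M j l) = (if k = l then lin_det d M else 0)"
    using assms by (auto simp: lin_det_def A_def[symmetric])
qed

lemma lin_system_cramer:
  assumes "\<And>k. k < d \<Longrightarrow> (\<Sum>l<d. M k l * x l) = c k" and "k < d"
  shows "lin_det d M * x k = (\<Sum>j<d. lin_adj d M k j * c j)"
proof -
  have "(\<Sum>j<d. lin_adj d M k j * c j) = (\<Sum>j<d. \<Sum>l<d. lin_adj d M k j * M j l * x l)"
    using assms(1) by (intro sum.cong) (auto simp: sum_distrib_left mult.assoc simp flip: assms(1))
  also have "\<dots> = (\<Sum>l<d. (\<Sum>j<d. lin_adj d M k j * M j l) * x l)"
    by (subst sum.swap) (simp add: sum_distrib_right)
  also have "\<dots> = (\<Sum>l<d. (if k = l then lin_det d M else 0) * x l)"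
    using assms(2) by (intro sum.cong) (auto simp: lin_adj_mult)
  also have "\<dots> = lin_det d M * x k"
    using assms(2) by (simp add: if_distrib[of "\<lambda>t. t * _"] sum.delta cong: if_cong)
  finally show ?thesis by simp
qed

lemma lin_system_solution:
  assumes "lin_det d M \<noteq> 0" and "k < d"
  shows "(\<Sum>l<d. M k l * ((\<Sum>j<d. lin_adj d M l j * c j) / lin_det d M)) = c k"
proof -
  have "(\<Sum>l<d. M k l * (\<Sum>j<d. lin_adj d M l j * c j)) = (\<Sum>j<d. (\<Sum>l<d. M k l * lin_adj d M l j) * c j)"
    by (simp add: sum_distrib_left sum_distrib_right mult.assoc) (rule sum.swap)
  also have "\<dots> = (\<Sum>j<d. (if k = j then lin_det d M else 0) * c j)"
    using assms(2) by (intro sum.cong) (auto simp: lin_adj_mult)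
  also have "\<dots> = lin_det d M * c k"
    using assms(2) by (simp add: if_distrib[of "\<lambda>t. t * _"] sum.delta cong: if_cong)
  finally show ?thesis using assms(1)
    by (simp add: field_simps flip: sum_divide_distrib)
qed

text \<open>
  Vanishing of the determinant is used only in this form: it decides whether the finite system
  has a nontrivial solution, hence whether an eigenvector exists.
\<close>
lemma lin_det_eq_0_iff:
  "lin_det d M = 0 \<longleftrightarrow> (\<exists>x. (\<exists>k<d. x k \<noteq> 0) \<and> (\<forall>k<d. (\<Sum>l<d. M k l * x l) = 0))"
proof -
  define A where "A = Matrix.mat d d (\<lambda>(k, l). M k l)"
  have A: "A \<in> carrier_mat d d" by (simp add: A_def)
  have mult: "(A *\<^sub>v v = 0\<^sub>v d) \<longleftrightarrow> (\<forall>k<d. (\<Sum>l<d. M k l * vec_index v l) = 0)"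
    if "v \<in> carrier_vec d" for v
    using that by (auto simp: vec_eq_iff A_def scalar_prod_def atLeast0LessThan)
  have "lin_det d M = 0 \<longleftrightarrow> (\<exists>v. v \<in> carrier_vec d \<and> v \<noteq> 0\<^sub>v d \<and> A *\<^sub>v v = 0\<^sub>v d)"
    unfolding lin_det_def A_def[symmetric] by (rule det_0_iff_vec_prod_zero[OF A])
  also have "\<dots> \<longleftrightarrow> (\<exists>x. (\<exists>k<d. x k \<noteq> 0) \<and> (\<forall>k<d. (\<Sum>l<d. M k l * x l) = 0))"
  proof safe
    fix v assume v: "v \<in> carrier_vec d" "v \<noteq> 0\<^sub>v d" "A *\<^sub>v v = 0\<^sub>v d"
    show "\<exists>x. (\<exists>k<d. x k \<noteq> 0) \<and> (\<forall>k<d. (\<Sum>l<d. M k l * x l) = 0)"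
      using v mult[OF v(1)] by (intro exI[of _ "vec_index v"]) (auto simp: vec_eq_iff)
  next
    fix x :: "nat \<Rightarrow> complex" and k assume x: "\<forall>k<d. (\<Sum>l<d. M k l * x l) = 0" and k: "k < d" "x k \<noteq> 0"
    show "\<exists>v. v \<in> carrier_vec d \<and> v \<noteq> 0\<^sub>v d \<and> A *\<^sub>v v = 0\<^sub>v d"
    proof (intro exI[of _ "Matrix.vec d x"] conjI)
      show "A *\<^sub>v Matrix.vec d x = 0\<^sub>v d" using x by (subst mult) auto
      show "Matrix.vec d x \<noteq> 0\<^sub>v d" using k by (auto simp: vec_eq_iff)
    qed simp
  qed
  finally show ?thesis .
qed

lemma det_holomorphic_on:
  assumes "\<And>u. A u \<in> carrier_mat d d"
    and "\<And>k l. k < d \<Longrightarrow> l < d \<Longrightarrow> (\<lambda>u. A u $$ (k, l)) holomorphic_on S"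
  shows "(\<lambda>u. Determinant.det (A u)) holomorphic_on S"
proof -
  have "(\<lambda>u. \<Sum>p \<in> {p. p permutes {0..<d}}. signof p * (\<Prod>i = 0..<d. A u $$ (i, p i))) holomorphic_on S"
    by (intro holomorphic_intros assms(2)) (auto simp: permutes_in_image)
  then show ?thesis using det_def'[OF assms(1)] by simp
qed

lemma lin_det_holomorphic_on:
  assumes "\<And>k l. k < d \<Longrightarrow> l < d \<Longrightarrow> (\<lambda>u. M u k l) holomorphic_on S"
  shows "(\<lambda>u. lin_det d (M u)) holomorphic_on S"
  unfolding lin_det_def using assms by (intro det_holomorphic_on[of _ d]) auto

text \<open>
  Cramer's rule writes the solution of a system as adjugate times right-hand side, divided by
  the determinant. Since the first two factors are holomorphic, the zeros of the determinant
  are the only possible singularities.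
\<close>
lemma lin_adj_holomorphic_on:
  assumes "\<And>k l. k < d \<Longrightarrow> l < d \<Longrightarrow> (\<lambda>u. M u k l) holomorphic_on S" and "k < d" "l < d"
  shows "(\<lambda>u. lin_adj d (M u) k l) holomorphic_on S"
proof -
  define A where "A u = Matrix.mat d d (\<lambda>(k, l). M u k l)" for u
  have "(\<lambda>u. (-1)^(l + k) * Determinant.det (mat_delete (A u) l k)) holomorphic_on S"
  proof (intro holomorphic_intros det_holomorphic_on[of _ "d - 1"])
    show "mat_delete (A u) l k \<in> carrier_mat (d - 1) (d - 1)" for u
      by (simp add: A_def mat_delete_def)
    fix i j assume "i < d - 1" "j < d - 1"
    then show "(\<lambda>u. mat_delete (A u) l k $$ (i, j)) holomorphic_on S"
      using assms by (simp add: A_def mat_delete_def)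
  qed
  then show ?thesis
    using assms(2,3) by (simp add: lin_adj_def adj_mat_def cofactor_def A_def[symmetric])
      (simp add: A_def)
qed

lemma lin_det_identity: "lin_det d (\<lambda>k l. of_bool (k = l)) = 1"
proof -
  have "Matrix.mat d d (\<lambda>(k, l). of_bool (k = l)) = (1\<^sub>m d :: complex mat)"
    by (intro eq_matI) auto
  then show ?thesis by (simp add: lin_det_def)
qed

section \<open>Banach spaces of sequences and Neumann series\<close>

text \<open>
  Taylor coefficients near the origin are controlled on the largest disc to which the function
  extends: enlarging the disc of holomorphy is what improves a growth rate.
\<close>
lemma power_series_coeff_bound:
  fixes x :: "nat \<Rightarrow> complex"
  assumes F: "F holomorphic_on ball 0 R" and s: "0 < s" "s < R" and "0 < q"
    and sums: "\<And>u. cmod u < q \<Longrightarrow> (\<lambda>n. x n * u ^ n) sums F u"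
    and B: "\<And>u. cmod u = s \<Longrightarrow> cmod (F u) \<le> B"
  shows "cmod (x n) \<le> B / s ^ n"
proof -
  have "conv_radius x \<ge> ereal q"
  proof (rule conv_radius_geI_ex)
    fix r' assume "0 < r'" "ereal r' < ereal q"
    then show "\<exists>z. norm z = r' \<and> summable (\<lambda>n. x n * z ^ n)"
      using sums[of "of_real r'"] by (intro exI[of _ "of_real r'"]) (auto simp: sums_iff)
  qed
  moreover have "(0::ereal) < ereal q" using \<open>0 < q\<close> by simp
  ultimately have conv: "0 < conv_radius x" by (rule less_le_trans[rotated])
  have "F has_fps_expansion Abs_fps x"
    unfolding has_fps_expansion_def
  proof
    show "0 < fps_conv_radius (Abs_fps x)" using conv by (simp add: fps_conv_radius_def)
    have "\<forall>\<^sub>F u in nhds 0. u \<in> ball 0 q"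
      using \<open>0 < q\<close> by (intro eventually_nhds_in_open) auto
    then show "\<forall>\<^sub>F u in nhds 0. eval_fps (Abs_fps x) u = F u"
      by eventually_elim (use sums in \<open>auto simp: eval_fps_def sums_iff\<close>)
  qed
  then have "x n = (deriv ^^ n) F 0 / fact n"
    using fps_nth_fps_expansion by fastforce
  moreover have "cmod ((deriv ^^ n) F 0) \<le> fact n * B / s ^ n"
  proof (rule Cauchy_inequality)
    show "F holomorphic_on ball 0 s" "continuous_on (cball 0 s) F"
      using s by (auto intro!: holomorphic_on_subset[OF F] holomorphic_on_imp_continuous_on)
  qed (use s B in auto)
  then have "cmod ((deriv ^^ n) F 0) / fact n \<le> fact n * B / s ^ n / fact n"
    by (rule divide_right_mono) simp
  ultimately show ?thesis by (simp add: norm_divide)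
qed

definition bounded_functional ::
    "(nat \<Rightarrow> complex) set \<Rightarrow> ((nat \<Rightarrow> complex) \<Rightarrow> real) \<Rightarrow> ((nat \<Rightarrow> complex) \<Rightarrow> complex) \<Rightarrow> bool" where
  "bounded_functional X nrm \<phi> \<longleftrightarrow>
     (\<forall>f\<in>X. \<forall>g\<in>X. \<phi> (\<lambda>i. f i + g i) = \<phi> f + \<phi> g) \<and>
     (\<forall>c. \<forall>f\<in>X. \<phi> (\<lambda>i. c * f i) = c * \<phi> f) \<and>
     (\<exists>C. \<forall>f\<in>X. cmod (\<phi> f) \<le> C * nrm f)"

text \<open>
  A Banach space of sequences on which evaluations at points are continuous. Completeness is
  stated for absolutely convergent series, and identifies the sum with the pointwise sum; this
  is the form in which Neumann series need it.
\<close>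
locale seq_banach =
  fixes X :: "(nat \<Rightarrow> complex) set" and nrm :: "(nat \<Rightarrow> complex) \<Rightarrow> real"
  assumes zero_mem: "(\<lambda>_. 0) \<in> X"
    and add_mem: "f \<in> X \<Longrightarrow> g \<in> X \<Longrightarrow> (\<lambda>i. f i + g i) \<in> X"
    and scale_mem: "f \<in> X \<Longrightarrow> (\<lambda>i. c * f i) \<in> X"
    and nrm_nonneg: "f \<in> X \<Longrightarrow> 0 \<le> nrm f"
    and nrm_add: "f \<in> X \<Longrightarrow> g \<in> X \<Longrightarrow> nrm (\<lambda>i. f i + g i) \<le> nrm f + nrm g"
    and nrm_scale: "f \<in> X \<Longrightarrow> nrm (\<lambda>i. c * f i) = cmod c * nrm f"
    and coord_bounded: "\<exists>C. \<forall>f\<in>X. cmod (f i) \<le> C * nrm f"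
    and series_mem: "(\<And>n. F n \<in> X) \<Longrightarrow> summable (\<lambda>n. nrm (F n)) \<Longrightarrow> (\<lambda>i. \<Sum>n. F n i) \<in> X"
    and nrm_series: "(\<And>n. F n \<in> X) \<Longrightarrow> summable (\<lambda>n. nrm (F n)) \<Longrightarrow>
       nrm (\<lambda>i. \<Sum>n. F n i) \<le> (\<Sum>n. nrm (F n))"
begin

lemma diff_mem: "f \<in> X \<Longrightarrow> g \<in> X \<Longrightarrow> (\<lambda>i. f i - g i) \<in> X"
  using add_mem[of f "\<lambda>i. (-1) * g i"] scale_mem[of g "-1"] by simp

lemma nrm_zero: "nrm (\<lambda>_. 0) = 0"
  using nrm_scale[OF zero_mem, of 0] by simp

lemma nrm_eq_0D: assumes "f \<in> X" "nrm f \<le> 0" shows "f = (\<lambda>_. 0)"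
proof
  fix i
  obtain C where "cmod (f i) \<le> C * nrm f" using coord_bounded[of i] assms by blast
  then show "f i = 0" using assms nrm_nonneg[of f] by simp
qed

lemma lincomb_mem:
  assumes "finite I" "\<And>l. l \<in> I \<Longrightarrow> e l \<in> X"
  shows "(\<lambda>i. \<Sum>l\<in>I. x l * e l i) \<in> X"
    and "nrm (\<lambda>i. \<Sum>l\<in>I. x l * e l i) \<le> (\<Sum>l\<in>I. cmod (x l) * nrm (e l))"
  using assms
proof (induction I)
  case (insert a I)
  { case 1 then show ?case using insert add_mem scale_mem by simp }
  { case 2
    have m: "(\<lambda>i. x a * e a i) \<in> X" "(\<lambda>i. \<Sum>l\<in>I. x l * e l i) \<in> X"
      using insert 2 scale_mem by auto
    show ?case using insert 2 nrm_add[OF m] by (simp add: nrm_scale) }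
qed (auto simp: zero_mem nrm_zero)

lemma bounded_functionalD:
  assumes "bounded_functional X nrm \<phi>"
  shows "f \<in> X \<Longrightarrow> g \<in> X \<Longrightarrow> \<phi> (\<lambda>i. f i + g i) = \<phi> f + \<phi> g"
    and "f \<in> X \<Longrightarrow> \<phi> (\<lambda>i. c * f i) = c * \<phi> f"
    and "f \<in> X \<Longrightarrow> g \<in> X \<Longrightarrow> \<phi> (\<lambda>i. f i - g i) = \<phi> f - \<phi> g"
    and "\<exists>C\<ge>0. \<forall>f\<in>X. cmod (\<phi> f) \<le> C * nrm f"
proof -
  show add: "\<phi> (\<lambda>i. f i + g i) = \<phi> f + \<phi> g" if "f \<in> X" "g \<in> X" for f g
    using assms that unfolding bounded_functional_def by blast
  show scale: "\<phi> (\<lambda>i. c * f i) = c * \<phi> f" if "f \<in> X" for f c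
    using assms that unfolding bounded_functional_def by blast
  show "\<phi> (\<lambda>i. f i - g i) = \<phi> f - \<phi> g" if "f \<in> X" "g \<in> X" for f g
    using add[OF that(1) scale_mem[OF that(2), of "-1"]] scale[OF that(2), of "-1"] by simp
  obtain C where C: "\<forall>f\<in>X. cmod (\<phi> f) \<le> C * nrm f"
    using assms unfolding bounded_functional_def by blast
  have "cmod (\<phi> f) \<le> max C 0 * nrm f" if "f \<in> X" for f
    using C that mult_right_mono[of C "max C 0" "nrm f"] nrm_nonneg[of f] by force
  then show "\<exists>C\<ge>0. \<forall>f\<in>X. cmod (\<phi> f) \<le> C * nrm f"
    by (intro exI[of _ "max C 0"]) auto
qed

lemma functional_lincomb:
  assumes "bounded_functional X nrm \<phi>" "finite I" "\<And>l. l \<in> I \<Longrightarrow> e l \<in> X"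
  shows "\<phi> (\<lambda>i. \<Sum>l\<in>I. x l * e l i) = (\<Sum>l\<in>I. x l * \<phi> (e l))"
  using assms(2,3)
proof (induction I)
  case empty
  then show ?case using bounded_functionalD(2)[OF assms(1) zero_mem, of 0] by simp
next
  case (insert a I)
  have m: "(\<lambda>i. x a * e a i) \<in> X" "(\<lambda>i. \<Sum>l\<in>I. x l * e l i) \<in> X"
    using insert scale_mem by (auto intro: lincomb_mem)
  then show ?case
    using insert bounded_functionalD(1)[OF assms(1) m] bounded_functionalD(2)[OF assms(1)] by simp
qed

lemma coord_functional: "bounded_functional X nrm (\<lambda>f. f i)"
  using coord_bounded[of i] by (auto simp: bounded_functional_def)

text \<open>
  The remainder of the series is again an absolutely convergent series, so its norm tends to
  zero and continuity of \<open>\<phi>\<close> applies.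
\<close>
lemma functional_series:
  assumes \<phi>: "bounded_functional X nrm \<phi>"
    and F: "\<And>n. F n \<in> X" and sm: "summable (\<lambda>n. nrm (F n))"
  shows "(\<lambda>n. \<phi> (F n)) sums \<phi> (\<lambda>i. \<Sum>n. F n i)"
proof -
  obtain C where C: "C \<ge> 0" "\<And>f. f \<in> X \<Longrightarrow> cmod (\<phi> f) \<le> C * nrm f"
    using bounded_functionalD(4)[OF \<phi>] by blast
  have smi: "summable (\<lambda>n. F n i)" for i
  proof -
    obtain c where c: "c \<ge> 0" "\<And>f. f \<in> X \<Longrightarrow> cmod (f i) \<le> c * nrm f"
      using bounded_functionalD(4)[OF coord_functional[of i]] by blast
    have "summable (\<lambda>n. c * nrm (F n))" using sm by (rule summable_mult)
    then show ?thesis using c(2)[OF F] by (rule summable_comparison_test'[where N = 0])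
  qed
  define S where "S = (\<lambda>i. \<Sum>n. F n i)"
  have S: "S \<in> X" using series_mem[OF F sm] by (simp add: S_def)
  have part: "cmod (\<phi> S - (\<Sum>n<m. \<phi> (F n))) \<le> C * (\<Sum>n. nrm (F (n + m)))" for m
  proof -
    define R where "R = (\<lambda>i. \<Sum>n. F (n + m) i)"
    have sm': "summable (\<lambda>n. nrm (F (n + m)))" using sm by (rule summable_ignore_initial_segment)
    have R: "R \<in> X" "nrm R \<le> (\<Sum>n. nrm (F (n + m)))"
      unfolding R_def using series_mem[of "\<lambda>n. F (n + m)"] nrm_series[of "\<lambda>n. F (n + m)"] F sm' by auto
    have P: "(\<lambda>i. \<Sum>n<m. 1 * F n i) \<in> X" by (rule lincomb_mem) (use F in auto)
    have "S i = (\<Sum>n<m. 1 * F n i) + R i" for i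
      unfolding S_def R_def using suminf_split_initial_segment[OF smi[of i], of m] by simp
    then have "S = (\<lambda>i. (\<Sum>n<m. 1 * F n i) + R i)" by blast
    then have "\<phi> S = \<phi> (\<lambda>i. \<Sum>n<m. 1 * F n i) + \<phi> R"
      using bounded_functionalD(1)[OF \<phi> P R(1)] by simp
    also have "\<phi> (\<lambda>i. \<Sum>n<m. 1 * F n i) = (\<Sum>n<m. \<phi> (F n))"
      by (subst functional_lincomb[OF \<phi>]) (use F in auto)
    finally have "cmod (\<phi> S - (\<Sum>n<m. \<phi> (F n))) = cmod (\<phi> R)" by simp
    also have "\<dots> \<le> C * nrm R" using C R by simp
    also have "\<dots> \<le> C * (\<Sum>n. nrm (F (n + m)))" using C(1) R(2) by (rule mult_left_mono[rotated])
    finally show ?thesis .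
  qed
  have "(\<lambda>m. \<Sum>n. nrm (F (n + m))) \<longlonglongrightarrow> 0"
    using suminf_exist_split2[OF sm] .
  then have "(\<lambda>m. C * (\<Sum>n. nrm (F (n + m)))) \<longlonglongrightarrow> 0"
    by (rule tendsto_mult_right_zero)
  then have "(\<lambda>m. \<phi> S - (\<Sum>n<m. \<phi> (F n))) \<longlonglongrightarrow> 0"
    by (rule Lim_null_comparison[rotated]) (use part in auto)
  then have "(\<lambda>m. \<phi> S - (\<phi> S - (\<Sum>n<m. \<phi> (F n)))) \<longlonglongrightarrow> \<phi> S - 0"
    by (intro tendsto_intros)
  then show ?thesis by (simp add: sums_def S_def)
qed

end

text \<open>
  The generating function of the numbers \<open>\<phi> (A\<^sup>n f)\<close>. For \<open>u = 1 / z\<close> the product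
  \<open>u * moment_series A \<phi> f u\<close> is the value of \<open>\<phi>\<close> at the resolvent of \<open>A\<close> at \<open>z\<close> applied to \<open>f\<close>
  (\<open>functional_neumann\<close>). The variable \<open>u\<close> is preferred because the point at infinity of the
  \<open>z\<close>-plane becomes an interior point of the disc of holomorphy.
\<close>
definition moment_series ::
    "((nat \<Rightarrow> complex) \<Rightarrow> nat \<Rightarrow> complex) \<Rightarrow> ((nat \<Rightarrow> complex) \<Rightarrow> complex) \<Rightarrow>
     (nat \<Rightarrow> complex) \<Rightarrow> complex \<Rightarrow> complex" where
  "moment_series A \<phi> f u = (\<Sum>n. \<phi> ((A ^^ n) f) * u ^ n)"

definition neumann ::
    "((nat \<Rightarrow> complex) \<Rightarrow> nat \<Rightarrow> complex) \<Rightarrow> complex \<Rightarrow> (nat \<Rightarrow> complex) \<Rightarrow> nat \<Rightarrow> complex" where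
  "neumann A z f = (\<lambda>i. \<Sum>n. inverse z ^ Suc n * (A ^^ n) f i)"

text \<open>
  The number \<open>r\<close> is an upper bound of the operator norm, kept separate from the norm itself so
  that it can be chosen strictly between two given radii.
\<close>
locale norm_bounded_op = seq_banach +
  fixes A :: "(nat \<Rightarrow> complex) \<Rightarrow> nat \<Rightarrow> complex" and r :: real
  assumes op: "bounded_op X nrm A" and r_pos: "0 < r"
    and op_bound: "f \<in> X \<Longrightarrow> nrm (A f) \<le> r * nrm f"
begin

lemma op_mem: "f \<in> X \<Longrightarrow> A f \<in> X"
  and op_add: "f \<in> X \<Longrightarrow> g \<in> X \<Longrightarrow> A (\<lambda>i. f i + g i) = (\<lambda>i. A f i + A g i)"
  and op_scale: "f \<in> X \<Longrightarrow> A (\<lambda>i. c * f i) = (\<lambda>i. c * A f i)"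
  using op by (auto simp: bounded_op_def)

lemma op_diff: "f \<in> X \<Longrightarrow> g \<in> X \<Longrightarrow> A (\<lambda>i. f i - g i) = (\<lambda>i. A f i - A g i)"
  using op_add[of f "\<lambda>i. (-1) * g i"] scale_mem[of g "-1"] op_scale[of g "-1"] by simp

lemma op_coord_functional: "bounded_functional X nrm (\<lambda>f. A f i)"
proof -
  obtain C where C: "C \<ge> 0" "\<forall>f\<in>X. cmod (f i) \<le> C * nrm f"
    using bounded_functionalD(4)[OF coord_functional[of i]] by blast
  have "cmod (A f i) \<le> C * r * nrm f" if "f \<in> X" for f
    using C(2)[rule_format, OF op_mem[OF that]] mult_left_mono[OF op_bound[OF that] C(1)]
    by (simp add: mult_ac)
  then show ?thesis by (auto simp: bounded_functional_def op_add op_scale)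
qed

lemma pow_mem: "f \<in> X \<Longrightarrow> (A ^^ n) f \<in> X"
  by (induction n) (auto simp: op_mem)

lemma pow_bound: "f \<in> X \<Longrightarrow> nrm ((A ^^ n) f) \<le> r ^ n * nrm f"
proof (induction n)
  case (Suc n)
  have "nrm ((A ^^ Suc n) f) \<le> r * nrm ((A ^^ n) f)" using op_bound[OF pow_mem[OF Suc.prems]] by simp
  also have "\<dots> \<le> r * (r ^ n * nrm f)" using Suc r_pos by (intro mult_left_mono) auto
  finally show ?case by (simp add: mult.assoc)
qed simp

lemma moment_bound:
  assumes "bounded_functional X nrm \<phi>"
  shows "\<exists>C\<ge>0. \<forall>f\<in>X. \<forall>n. cmod (\<phi> ((A ^^ n) f)) \<le> C * r ^ n * nrm f"
proof -
  obtain C where C: "C \<ge> 0" "\<And>f. f \<in> X \<Longrightarrow> cmod (\<phi> f) \<le> C * nrm f"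
    using bounded_functionalD(4)[OF assms] by blast
  have "cmod (\<phi> ((A ^^ n) f)) \<le> C * r ^ n * nrm f" if f: "f \<in> X" for f n
  proof -
    have "cmod (\<phi> ((A ^^ n) f)) \<le> C * nrm ((A ^^ n) f)" using C(2) pow_mem[OF f] .
    also have "\<dots> \<le> C * (r ^ n * nrm f)" using C(1) pow_bound[OF f] by (intro mult_left_mono)
    finally show ?thesis by (simp add: mult.assoc)
  qed
  with C(1) show ?thesis by blast
qed

lemma moment_series:
  assumes \<phi>: "bounded_functional X nrm \<phi>" and f: "f \<in> X"
  shows moment_series_sums: "cmod u < 1 / r \<Longrightarrow> (\<lambda>n. \<phi> ((A ^^ n) f) * u ^ n) sums moment_series A \<phi> f u"
    and moment_series_holomorphic: "moment_series A \<phi> f holomorphic_on ball 0 (1 / r)"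
proof -
  obtain C where C: "C \<ge> 0" "\<And>n. cmod (\<phi> ((A ^^ n) f)) \<le> C * r ^ n * nrm f"
    using moment_bound[OF \<phi>] f by blast
  show sums: "(\<lambda>n. \<phi> ((A ^^ n) f) * u ^ n) sums moment_series A \<phi> f u" if "cmod u < 1 / r" for u
    unfolding moment_series_def
  proof (rule summable_sums, rule summable_comparison_test'[where N = 0])
    show "norm (\<phi> ((A ^^ n) f) * u ^ n) \<le> C * nrm f * (r * cmod u) ^ n" for n
      using mult_right_mono[OF C(2)[of n], of "cmod u ^ n"]
      by (simp add: norm_mult norm_power power_mult_distrib mult_ac)
    have "r * cmod u < 1" using that r_pos by (simp add: field_simps)
    then show "summable (\<lambda>n. C * nrm f * (r * cmod u) ^ n)"
      using r_pos by (intro summable_mult summable_geometric) simp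
  qed
  show "moment_series A \<phi> f holomorphic_on ball 0 (1 / r)"
    by (rule power_series_holomorphic[where a = "\<lambda>n. \<phi> ((A ^^ n) f)"]) (use sums in auto)
qed

lemma moment_series_bound:
  assumes \<phi>: "bounded_functional X nrm \<phi>" and "0 \<le> s" "s < 1 / r"
  shows "\<exists>C\<ge>0. \<forall>f\<in>X. \<forall>u. cmod u = s \<longrightarrow> cmod (moment_series A \<phi> f u) \<le> C * nrm f"
proof -
  obtain C where C: "C \<ge> 0" "\<And>f n. f \<in> X \<Longrightarrow> cmod (\<phi> ((A ^^ n) f)) \<le> C * r ^ n * nrm f"
    using moment_bound[OF \<phi>] by blast
  have rs: "0 \<le> r * s" "r * s < 1" using assms r_pos by (auto simp: field_simps)
  have "cmod (moment_series A \<phi> f u) \<le> C / (1 - r * s) * nrm f" if f: "f \<in> X" and u: "cmod u = s" for f u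
  proof -
    have le: "norm (\<phi> ((A ^^ n) f) * u ^ n) \<le> C * nrm f * (r * s) ^ n" for n
      using mult_right_mono[OF C(2)[OF f, of n], of "s ^ n"] assms(2) u
      by (simp add: norm_mult norm_power power_mult_distrib mult_ac)
    have sm: "summable (\<lambda>n. C * nrm f * (r * s) ^ n)"
      using rs by (intro summable_mult summable_geometric) simp
    have "cmod (moment_series A \<phi> f u) \<le> (\<Sum>n. C * nrm f * (r * s) ^ n)"
      unfolding moment_series_def by (rule norm_suminf_le[OF le sm])
    also have "\<dots> = C * nrm f * (1 / (1 - r * s))"
      using rs by (subst suminf_mult) (auto intro: summable_geometric simp: suminf_geometric)
    finally show ?thesis by (simp add: mult_ac)
  qed
  moreover have "C / (1 - r * s) \<ge> 0" using C rs by simp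
  ultimately show ?thesis by blast
qed

context
  fixes z :: complex
  assumes z: "r < cmod z"
begin

lemma neumann_terms:
  assumes f: "f \<in> X"
  shows "(\<lambda>i. inverse z ^ Suc n * (A ^^ n) f i) \<in> X"
    and "summable (\<lambda>n. nrm (\<lambda>i. inverse z ^ Suc n * (A ^^ n) f i))"
    and "(\<Sum>n. nrm (\<lambda>i. inverse z ^ Suc n * (A ^^ n) f i)) \<le> nrm f / (cmod z - r)"
proof -
  show mem: "(\<lambda>i. inverse z ^ Suc n * (A ^^ n) f i) \<in> X" for n
    using f by (intro scale_mem pow_mem)
  have z0: "cmod z > 0" using z r_pos by linarith
  have q: "0 \<le> r / cmod z" "r / cmod z < 1" using z r_pos z0 by auto
  have le: "nrm (\<lambda>i. inverse z ^ Suc n * (A ^^ n) f i) \<le> nrm f / cmod z * (r / cmod z) ^ n" for n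
  proof -
    have "nrm (\<lambda>i. inverse z ^ Suc n * (A ^^ n) f i) = inverse (cmod z) ^ Suc n * nrm ((A ^^ n) f)"
      using f by (simp only: nrm_scale[OF pow_mem] norm_power norm_inverse)
    also have "\<dots> \<le> inverse (cmod z) ^ Suc n * (r ^ n * nrm f)"
      using pow_bound[OF f] by (intro mult_left_mono) auto
    finally show ?thesis by (simp add: divide_inverse power_mult_distrib mult_ac)
  qed
  have smg: "summable (\<lambda>n. nrm f / cmod z * (r / cmod z) ^ n)"
    using q by (intro summable_mult summable_geometric) simp
  show sm: "summable (\<lambda>n. nrm (\<lambda>i. inverse z ^ Suc n * (A ^^ n) f i))"
    by (rule summable_comparison_test'[OF smg, where N = 0]) (use le nrm_nonneg[OF mem] in auto)
  have "(\<Sum>n. nrm (\<lambda>i. inverse z ^ Suc n * (A ^^ n) f i)) \<le> (\<Sum>n. nrm f / cmod z * (r / cmod z) ^ n)"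
    by (rule suminf_le[OF le sm smg])
  also have "\<dots> = nrm f / cmod z * (1 / (1 - r / cmod z))"
    using q by (subst suminf_mult) (auto intro: summable_geometric simp: suminf_geometric)
  also have "\<dots> = nrm f / (cmod z - r)"
    using z0 z by (simp add: field_simps)
  finally show "(\<Sum>n. nrm (\<lambda>i. inverse z ^ Suc n * (A ^^ n) f i)) \<le> nrm f / (cmod z - r)" .
qed

lemma neumann_mem: "f \<in> X \<Longrightarrow> neumann A z f \<in> X"
  unfolding neumann_def using neumann_terms by (intro series_mem)

lemma neumann_bound: "f \<in> X \<Longrightarrow> nrm (neumann A z f) \<le> nrm f / (cmod z - r)"
  unfolding neumann_def using nrm_series[of "\<lambda>n i. inverse z ^ Suc n * (A ^^ n) f i"] neumann_terms[of f]
  by force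

lemma functional_neumann:
  assumes \<phi>: "bounded_functional X nrm \<phi>" and f: "f \<in> X"
  shows "(\<lambda>n. inverse z ^ Suc n * \<phi> ((A ^^ n) f)) sums \<phi> (neumann A z f)"
    and "\<phi> (neumann A z f) = inverse z * moment_series A \<phi> f (inverse z)"
proof -
  show s: "(\<lambda>n. inverse z ^ Suc n * \<phi> ((A ^^ n) f)) sums \<phi> (neumann A z f)"
    using functional_series[OF \<phi> neumann_terms(1,2)[OF f]]
    unfolding neumann_def bounded_functionalD(2)[OF \<phi> pow_mem[OF f]] .
  have "cmod (inverse z) < 1 / r"
    using less_imp_inverse_less[OF z r_pos] by (simp only: norm_inverse flip: inverse_eq_divide)
  then have "(\<lambda>n. inverse z * (\<phi> ((A ^^ n) f) * inverse z ^ n)) sums (inverse z * moment_series A \<phi> f (inverse z))"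
    by (intro sums_mult moment_series_sums[OF \<phi> f])
  then have "(\<lambda>n. inverse z ^ Suc n * \<phi> ((A ^^ n) f)) sums (inverse z * moment_series A \<phi> f (inverse z))"
    by (simp add: mult_ac)
  with s show "\<phi> (neumann A z f) = inverse z * moment_series A \<phi> f (inverse z)"
    by (rule sums_unique2)
qed

lemma neumann_solves:
  assumes f: "f \<in> X"
  shows "z * neumann A z f i - A (neumann A z f) i = f i"
proof -
  have z0: "z \<noteq> 0" using z r_pos by auto
  from functional_neumann(1)[OF op_coord_functional f]
  have 1: "(\<lambda>n. inverse z ^ Suc n * (A ^^ Suc n) f i) sums A (neumann A z f) i" by simp
  have 2: "(\<lambda>n. inverse z ^ Suc n * (A ^^ n) f i) sums neumann A z f i"
    using functional_neumann(1)[OF coord_functional[of i] f] .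
  have "(\<lambda>n. z * (inverse z ^ Suc n * (A ^^ n) f i)) sums (z * neumann A z f i)"
    by (rule sums_mult[OF 2])
  then have "(\<lambda>n. inverse z ^ n * (A ^^ n) f i) sums (z * neumann A z f i)"
    using z0 by (simp add: mult.assoc[symmetric])
  then have "(\<lambda>n. inverse z ^ Suc n * (A ^^ Suc n) f i) sums (z * neumann A z f i - f i)"
    by (subst sums_Suc_iff) simp
  with 1 have "A (neumann A z f) i = z * neumann A z f i - f i" by (rule sums_unique2)
  then show ?thesis by simp
qed

text \<open>
  A vector in the kernel of \<open>z - A\<close> satisfies \<open>|z| |h| \<le> r |h|\<close> and so vanishes.
\<close>
lemma neumann_unique:
  assumes g: "g \<in> X" and eq: "\<And>i. z * g i - A g i = f i" and f: "f \<in> X"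
  shows "g = neumann A z f"
proof -
  define h where "h = (\<lambda>i. g i - neumann A z f i)"
  have h: "h \<in> X" unfolding h_def using g neumann_mem[OF f] by (rule diff_mem)
  have "A h = (\<lambda>i. A g i - A (neumann A z f) i)"
    unfolding h_def using op_diff[OF g neumann_mem[OF f]] .
  also have "\<dots> = (\<lambda>i. z * h i)"
  proof
    fix i show "A g i - A (neumann A z f) i = z * h i"
      using eq[of i] neumann_solves[OF f, of i] by (simp add: h_def algebra_simps)
  qed
  finally have "cmod z * nrm h \<le> r * nrm h" using op_bound[OF h] nrm_scale[OF h, of z] by simp
  then have "nrm h \<le> 0" using z by (metis mult_le_cancel_right not_le)
  then have "h = (\<lambda>_. 0)" using nrm_eq_0D[OF h] by simp
  then show ?thesis by (auto simp: h_def fun_eq_iff)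
qed

end

end

section \<open>Finite-rank perturbations of a small operator\<close>

text \<open>
  Spanning families are indexed here, whereas \<^const>\<open>finite_dim\<close> asks for a set; the
  coefficients of coinciding members have to be added up.
\<close>
lemma finite_dimI:
  assumes "finite I" and "\<And>g. g \<in> W \<Longrightarrow> \<exists>c. \<forall>i. g i = (\<Sum>k\<in>I. c k * h k i)"
  shows "finite_dim W"
  unfolding finite_dim_def
proof (intro exI[of _ "h ` I"] conjI ballI)
  show "finite (h ` I)" using assms(1) by simp
  fix g assume "g \<in> W"
  then obtain c where c: "\<And>i. g i = (\<Sum>k\<in>I. c k * h k i)" using assms(2) by blast
  have "g i = (\<Sum>b\<in>h ` I. (\<Sum>k\<in>{k\<in>I. h k = b}. c k) * b i)" for i
    unfolding c sum.image_gen[OF assms(1), of "\<lambda>k. c k * h k i" h]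
    by (intro sum.cong) (auto simp: sum_distrib_right)
  then show "\<exists>c. g = (\<lambda>i. \<Sum>b\<in>h ` I. c b * b i)"
    by (intro exI[of _ "\<lambda>b. \<Sum>k\<in>{k\<in>I. h k = b}. c k"]) (rule ext)
qed

text \<open>
  Leibniz' rule for the higher derivative in Cauchy's formula separates the two factors: the
  integral is a combination of derivatives of \<open>K\<close> at \<open>z\<close> with coefficients that depend on \<open>H\<close>
  only.
\<close>
lemma contour_integral_pole:
  assumes "H holomorphic_on S" "K holomorphic_on S" "open S" "cball z \<epsilon> \<subseteq> S" "0 < \<epsilon>"
  shows "((\<lambda>w. H w / (w - z) ^ Suc k * K w) has_contour_integral
    (2 * of_real pi * \<i>) * (\<Sum>j=0..k. of_nat (k choose j) * (deriv ^^ j) H z * (deriv ^^ (k - j)) K z / fact k))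
    (circlepath z \<epsilon>)"
proof -
  have hol: "(\<lambda>w. H w * K w) holomorphic_on S" using assms by (intro holomorphic_intros)
  have "((\<lambda>w. (H w * K w) / (w - z) ^ Suc k) has_contour_integral
      ((2 * pi * \<i>) / (fact k) * (deriv ^^ k) (\<lambda>w. H w * K w) z)) (circlepath z \<epsilon>)"
  proof (rule Cauchy_has_contour_integral_higher_derivative_circlepath)
    show "continuous_on (cball z \<epsilon>) (\<lambda>w. H w * K w)" "(\<lambda>w. H w * K w) holomorphic_on ball z \<epsilon>"
      using holomorphic_on_subset[OF hol assms(4)]
      by (auto intro: holomorphic_on_imp_continuous_on holomorphic_on_subset)
  qed (use assms in auto)
  also have "(deriv ^^ k) (\<lambda>w. H w * K w) z = (\<Sum>j=0..k. of_nat (k choose j) * (deriv ^^ j) H z * (deriv ^^ (k - j)) K z)"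
    using assms by (intro higher_deriv_mult[of _ S]) auto
  finally show ?thesis
    by (simp add: sum_divide_distrib[symmetric] mult_ac)
qed

text \<open>
  \<open>T = A + K\<close>, where \<open>K f\<close> is the combination of the vectors \<open>e l\<close> with coefficients \<open>\<phi> l f\<close>.
  Outside the disc of radius \<open>r\<close> the operator \<open>z - A\<close> is invertible, so that everything about
  \<open>z - T\<close> can be read off from a \<open>d \<times> d\<close> matrix.
\<close>
locale finite_rank_perturbation = norm_bounded_op +
  fixes T :: "(nat \<Rightarrow> complex) \<Rightarrow> nat \<Rightarrow> complex" and d :: nat
    and \<phi> :: "nat \<Rightarrow> (nat \<Rightarrow> complex) \<Rightarrow> complex" and e :: "nat \<Rightarrow> nat \<Rightarrow> complex"
  assumes T_eq: "f \<in> X \<Longrightarrow> T f = (\<lambda>i. A f i + (\<Sum>l<d. \<phi> l f * e l i))"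
    and \<phi>: "l < d \<Longrightarrow> bounded_functional X nrm (\<phi> l)"
    and e_mem: "l < d \<Longrightarrow> e l \<in> X"
begin

lemma rank_part_mem: "(\<lambda>i. \<Sum>l<d. x l * e l i) \<in> X"
  by (rule lincomb_mem) (auto simp: e_mem)

lemma T_mem: "f \<in> X \<Longrightarrow> T f \<in> X"
  by (simp add: T_eq add_mem op_mem rank_part_mem)

lemma T_norm_bounded: "\<exists>R>r. norm_bounded_op X nrm T R"
proof -
  have "\<forall>l. \<exists>C\<ge>0. l < d \<longrightarrow> (\<forall>f\<in>X. cmod (\<phi> l f) \<le> C * nrm f)"
    using bounded_functionalD(4)[OF \<phi>] by (metis order_refl)
  then obtain C where C: "\<And>l. C l \<ge> 0" "\<And>l f. l < d \<Longrightarrow> f \<in> X \<Longrightarrow> cmod (\<phi> l f) \<le> C l * nrm f"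
    by metis
  define R where "R = r + (\<Sum>l<d. C l * nrm (e l)) + 1"
  have "(\<Sum>l<d. C l * nrm (e l)) \<ge> 0" using C(1) nrm_nonneg[OF e_mem] by (intro sum_nonneg) auto
  then have R: "R > r" by (simp add: R_def)
  have bound: "nrm (T f) \<le> R * nrm f" if f: "f \<in> X" for f
  proof -
    have "nrm (T f) \<le> nrm (A f) + nrm (\<lambda>i. \<Sum>l<d. \<phi> l f * e l i)"
      unfolding T_eq[OF f] by (rule nrm_add[OF op_mem[OF f] rank_part_mem])
    also have "\<dots> \<le> r * nrm f + (\<Sum>l<d. cmod (\<phi> l f) * nrm (e l))"
      by (intro add_mono op_bound[OF f] lincomb_mem) (auto simp: e_mem)
    also have "\<dots> \<le> r * nrm f + (\<Sum>l<d. C l * nrm f * nrm (e l))"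
      using C(2)[OF _ f] by (intro add_mono order_refl sum_mono mult_right_mono nrm_nonneg e_mem) auto
    also have "\<dots> \<le> R * nrm f"
      using nrm_nonneg[OF f] by (simp add: R_def algebra_simps sum_distrib_right sum_distrib_left)
    finally show ?thesis .
  qed
  have "bounded_op X nrm T"
    unfolding bounded_op_def
  proof (intro conjI ballI allI)
    show "T f \<in> X" if "f \<in> X" for f using T_mem[OF that] .
    show "\<exists>C. \<forall>f\<in>X. nrm (T f) \<le> C * nrm f" using bound by blast
    show "T (\<lambda>i. f i + g i) = (\<lambda>i. T f i + T g i)" if "f \<in> X" "g \<in> X" for f g
      using that bounded_functionalD(1)[OF \<phi> that]
      by (simp add: T_eq add_mem op_add algebra_simps sum.distrib)
    show "T (\<lambda>i. c * f i) = (\<lambda>i. c * T f i)" if "f \<in> X" for f c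
      using that bounded_functionalD(2)[OF \<phi> that]
      by (simp add: T_eq scale_mem op_scale algebra_simps sum_distrib_left)
  qed
  then have "norm_bounded_op X nrm T R"
    using bound R r_pos by unfold_locales auto
  with R show ?thesis by blast
qed

lemma T_bounded: "bounded_op X nrm T"
  using T_norm_bounded norm_bounded_op.op by blast

text \<open>
  At \<open>u = 1 / z\<close> this is the identity minus the matrix of the numbers \<open>\<phi> k (R (e l))\<close>, where \<open>R\<close>
  is the inverse of \<open>z - A\<close> (see \<open>char_matrix_inverse\<close>).
\<close>
definition char_matrix :: "complex \<Rightarrow> nat \<Rightarrow> nat \<Rightarrow> complex" where
  "char_matrix u k l = of_bool (k = l) - u * moment_series A (\<phi> k) (e l) u"

definition char_det :: "complex \<Rightarrow> complex" where
  "char_det u = lin_det d (char_matrix u)"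

lemma char_matrix_holomorphic:
  "k < d \<Longrightarrow> l < d \<Longrightarrow> (\<lambda>u. char_matrix u k l) holomorphic_on ball 0 (1 / r)"
  unfolding char_matrix_def using \<phi> e_mem
  by (intro holomorphic_intros moment_series_holomorphic)

lemma char_det_holomorphic: "char_det holomorphic_on ball 0 (1 / r)"
proof -
  have "(\<lambda>u. lin_det d (char_matrix u)) holomorphic_on ball 0 (1 / r)"
    by (rule lin_det_holomorphic_on) (rule char_matrix_holomorphic)
  then show ?thesis by (simp add: char_det_def[abs_def])
qed

lemma char_matrix_0: "char_matrix 0 = (\<lambda>k l. of_bool (k = l))"
  by (simp add: char_matrix_def fun_eq_iff)

lemma char_det_0: "char_det 0 = 1"
  by (simp add: char_det_def char_matrix_0 lin_det_identity)

lemma inverse_in_ball: "r < cmod z \<Longrightarrow> inverse z \<in> ball 0 (1 / r)"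
  using less_imp_inverse_less[of r "cmod z"] r_pos by (simp add: norm_inverse inverse_eq_divide norm_divide)

lemma inverse_holomorphic_outside: "inverse holomorphic_on {w. r < cmod w}"
  using r_pos by (intro holomorphic_intros) auto

lemma holomorphic_outside:
  assumes "h holomorphic_on ball 0 (1 / r)"
  shows "(\<lambda>w. h (inverse w)) holomorphic_on {w. r < cmod w}"
proof -
  have "(h \<circ> inverse) holomorphic_on {w. r < cmod w}"
    by (rule holomorphic_on_compose_gen[OF inverse_holomorphic_outside assms]) (use inverse_in_ball in auto)
  then show ?thesis by (simp add: o_def)
qed

lemma functional_neumann_holomorphic:
  assumes "bounded_functional X nrm \<psi>" "f \<in> X"
  shows "(\<lambda>w. \<psi> (neumann A w f)) holomorphic_on {w. r < cmod w}"
proof -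
  have "(\<lambda>w. inverse w * moment_series A \<psi> f (inverse w)) holomorphic_on {w. r < cmod w}"
    by (rule holomorphic_on_mult[OF inverse_holomorphic_outside
          holomorphic_outside[OF moment_series_holomorphic[OF assms]]])
  then show ?thesis
    by (rule holomorphic_transform) (use functional_neumann(2)[OF _ assms] in auto)
qed

context
  fixes z :: complex
  assumes z: "r < cmod z"
begin

lemma char_matrix_inverse:
  "k < d \<Longrightarrow> l < d \<Longrightarrow> char_matrix (inverse z) k l = of_bool (k = l) - \<phi> k (neumann A z (e l))"
  by (simp add: char_matrix_def functional_neumann(2)[OF z \<phi> e_mem])

lemma neumann_lincomb:
  assumes f: "f \<in> X"
  shows "neumann A z (\<lambda>i. f i + (\<Sum>l<d. x l * e l i)) =
    (\<lambda>i. neumann A z f i + (\<Sum>l<d. x l * neumann A z (e l) i))"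
proof -
  have m: "neumann A z f \<in> X" "(\<lambda>i. \<Sum>l<d. x l * neumann A z (e l) i) \<in> X"
    using f by (auto intro!: neumann_mem[OF z] lincomb_mem simp: e_mem)
  have A_lin: "A (\<lambda>i. \<Sum>l<d. x l * neumann A z (e l) i) i = (\<Sum>l<d. x l * A (neumann A z (e l)) i)" for i
    by (rule functional_lincomb[OF op_coord_functional]) (auto intro!: neumann_mem[OF z] simp: e_mem)
  show ?thesis
  proof (rule neumann_unique[OF z, symmetric])
    show "(\<lambda>i. neumann A z f i + (\<Sum>l<d. x l * neumann A z (e l) i)) \<in> X" using m by (rule add_mem)
    show "(\<lambda>i. f i + (\<Sum>l<d. x l * e l i)) \<in> X" using f rank_part_mem by (rule add_mem)
    fix i
    have "z * (neumann A z f i + (\<Sum>l<d. x l * neumann A z (e l) i)) -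
        A (\<lambda>i. neumann A z f i + (\<Sum>l<d. x l * neumann A z (e l) i)) i =
      (z * neumann A z f i - A (neumann A z f) i) +
      (\<Sum>l<d. x l * (z * neumann A z (e l) i - A (neumann A z (e l)) i))"
      by (simp add: op_add[OF m] A_lin algebra_simps sum_subtractf sum_distrib_left)
    also have "\<dots> = f i + (\<Sum>l<d. x l * e l i)"
      by (simp add: neumann_solves[OF z] f e_mem)
    finally show "z * (neumann A z f i + (\<Sum>l<d. x l * neumann A z (e l) i)) -
        A (\<lambda>i. neumann A z f i + (\<Sum>l<d. x l * neumann A z (e l) i)) i = f i + (\<Sum>l<d. x l * e l i)" .
  qed
qed

text \<open>
  Both directions of the reduction rest on this identity: a vector of the stated form solves the
  equation exactly if its coefficients \<open>x\<close> reproduce the values of the functionals on it.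
\<close>
lemma functional_reduced:
  assumes f: "f \<in> X" and k: "k < d"
  shows "\<phi> k (\<lambda>i. neumann A z f i + (\<Sum>l<d. x l * neumann A z (e l) i)) =
    \<phi> k (neumann A z f) + x k - (\<Sum>l<d. char_matrix (inverse z) k l * x l)"
proof -
  have m: "neumann A z f \<in> X" "(\<lambda>i. \<Sum>l<d. x l * neumann A z (e l) i) \<in> X"
    using f by (auto intro!: neumann_mem[OF z] lincomb_mem simp: e_mem)
  have "\<phi> k (\<lambda>i. neumann A z f i + (\<Sum>l<d. x l * neumann A z (e l) i)) =
    \<phi> k (neumann A z f) + (\<Sum>l<d. x l * \<phi> k (neumann A z (e l)))"
    unfolding bounded_functionalD(1)[OF \<phi>[OF k] m]
    by (subst functional_lincomb[OF \<phi>[OF k]]) (auto intro: neumann_mem[OF z] e_mem)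
  also have "(\<Sum>l<d. x l * \<phi> k (neumann A z (e l))) = (\<Sum>l<d. of_bool (k = l) * x l - char_matrix (inverse z) k l * x l)"
    by (intro sum.cong) (auto simp: char_matrix_inverse k algebra_simps)
  also have "\<dots> = x k - (\<Sum>l<d. char_matrix (inverse z) k l * x l)"
    using k by (simp add: sum_subtractf of_bool_def if_distrib[of "\<lambda>t. t * _"] cong: if_cong)
  finally show ?thesis by simp
qed

text \<open>
  The equation \<open>z g - T g = f\<close> says that \<open>z g - A g = f + K g\<close>. Hence \<open>g\<close> is obtained by applying
  the inverse of \<open>z - A\<close> to \<open>f + K g\<close>, and only the \<open>d\<close> numbers \<open>\<phi> l g\<close> remain unknown;
  evaluating the functionals on \<open>g\<close> gives a linear system for them.
\<close>
lemma solution_form: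
  assumes f: "f \<in> X" and g: "g \<in> X" and eq: "\<And>i. z * g i - T g i = f i"
  shows "g = (\<lambda>i. neumann A z f i + (\<Sum>l<d. \<phi> l g * neumann A z (e l) i))"
    and "k < d \<Longrightarrow> (\<Sum>l<d. char_matrix (inverse z) k l * \<phi> l g) = \<phi> k (neumann A z f)"
proof -
  have "g = neumann A z (\<lambda>i. f i + (\<Sum>l<d. \<phi> l g * e l i))"
  proof (rule neumann_unique[OF z g])
    show "z * g i - A g i = f i + (\<Sum>l<d. \<phi> l g * e l i)" for i
      using eq[of i] by (simp add: T_eq[OF g] algebra_simps)
  qed (use f rank_part_mem in \<open>rule add_mem\<close>)
  then show 1: "g = (\<lambda>i. neumann A z f i + (\<Sum>l<d. \<phi> l g * neumann A z (e l) i))"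
    unfolding neumann_lincomb[OF f] .
  show "(\<Sum>l<d. char_matrix (inverse z) k l * \<phi> l g) = \<phi> k (neumann A z f)" if k: "k < d"
    using functional_reduced[OF f k, of "\<lambda>l. \<phi> l g"] unfolding 1[symmetric] by simp
qed

lemma solution_intro:
  assumes f: "f \<in> X" and x: "\<And>k. k < d \<Longrightarrow> (\<Sum>l<d. char_matrix (inverse z) k l * x l) = \<phi> k (neumann A z f)"
    and g: "g = (\<lambda>i. neumann A z f i + (\<Sum>l<d. x l * neumann A z (e l) i))"
  shows "g \<in> X" and "k < d \<Longrightarrow> \<phi> k g = x k" and "z * g i - T g i = f i"
proof -
  show gX: "g \<in> X" unfolding g
    using f by (auto intro!: add_mem neumann_mem[OF z] lincomb_mem simp: e_mem)
  show xk: "\<phi> k g = x k" if "k < d" for k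
    unfolding g functional_reduced[OF f that] x[OF that] by simp
  have g2: "g = neumann A z (\<lambda>i. f i + (\<Sum>l<d. x l * e l i))"
    unfolding g neumann_lincomb[OF f] ..
  have "z * g i - A g i = f i + (\<Sum>l<d. x l * e l i)"
    unfolding g2 by (rule neumann_solves[OF z]) (use f rank_part_mem in \<open>rule add_mem\<close>)
  moreover have "(\<Sum>l<d. \<phi> l g * e l i) = (\<Sum>l<d. x l * e l i)"
    by (intro sum.cong) (auto simp: xk)
  ultimately show "z * g i - T g i = f i" by (simp add: T_eq[OF gX] diff_diff_eq[symmetric])
qed

lemma eigenvalue_iff: "op_eigenvalue X T z \<longleftrightarrow> char_det (inverse z) = 0"
proof
  have N0: "neumann A z (\<lambda>_. 0) = (\<lambda>_. 0)"
    by (rule neumann_unique[OF z zero_mem _ zero_mem, symmetric])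
       (use op_scale[OF zero_mem, of 0] in \<open>simp add: fun_eq_iff\<close>)
  have \<phi>0: "\<phi> k (\<lambda>_. 0) = 0" if "k < d" for k
    using bounded_functionalD(2)[OF \<phi>[OF that] zero_mem, of 0] by simp
  {
    assume "op_eigenvalue X T z"
    then obtain f where f: "f \<in> X" "f \<noteq> (\<lambda>_. 0)" "T f = (\<lambda>i. z * f i)"
      unfolding op_eigenvalue_def by blast
    then have eq: "z * f i - T f i = 0" for i by simp
    note sol = solution_form[OF zero_mem f(1) eq]
    have "\<exists>k<d. \<phi> k f \<noteq> 0"
    proof (rule ccontr)
      assume "\<not> (\<exists>k<d. \<phi> k f \<noteq> 0)"
      then have "f = (\<lambda>_. 0)" by (subst sol(1)) (simp add: N0)
      with f(2) show False ..
    qed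
    with sol(2) show "char_det (inverse z) = 0"
      unfolding char_det_def lin_det_eq_0_iff by (intro exI[of _ "\<lambda>k. \<phi> k f"]) (auto simp: N0 \<phi>0)
  next
    assume "char_det (inverse z) = 0"
    then obtain x k where k: "k < d" "x k \<noteq> 0"
      and x: "\<And>k. k < d \<Longrightarrow> (\<Sum>l<d. char_matrix (inverse z) k l * x l) = 0"
      unfolding char_det_def lin_det_eq_0_iff by blast
    define g where "g = (\<lambda>i. neumann A z (\<lambda>_. 0) i + (\<Sum>l<d. x l * neumann A z (e l) i))"
    have x': "(\<Sum>l<d. char_matrix (inverse z) k l * x l) = \<phi> k (neumann A z (\<lambda>_. 0))" if "k < d" for k
      using that x by (simp add: N0 \<phi>0)
    note sol = solution_intro[OF zero_mem x' g_def]
    have "g \<noteq> (\<lambda>_. 0)" using sol(2)[OF _ k(1)] k \<phi>0[OF k(1)] by auto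
    moreover have "T g = (\<lambda>i. z * g i)" using sol(3) by (simp add: fun_eq_iff)
    ultimately show "op_eigenvalue X T z"
      unfolding op_eigenvalue_def using sol(1) by blast
  }
qed

text \<open>
  The coefficients that Cramer's rule gives, and the resolvent of \<open>T\<close> built from them.
\<close>
definition res_coeff :: "(nat \<Rightarrow> complex) \<Rightarrow> nat \<Rightarrow> complex" where
  "res_coeff f l = (\<Sum>j<d. lin_adj d (char_matrix (inverse z)) l j * \<phi> j (neumann A z f)) / char_det (inverse z)"

definition res :: "(nat \<Rightarrow> complex) \<Rightarrow> nat \<Rightarrow> complex" where
  "res f = (\<lambda>i. neumann A z f i + (\<Sum>l<d. res_coeff f l * neumann A z (e l) i))"

lemma
  assumes nz: "char_det (inverse z) \<noteq> 0" and f: "f \<in> X"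
  shows resolvent_mem: "res f \<in> X"
    and resolvent_solves: "z * res f i - T (res f) i = f i"
    and resolvent_unique: "g \<in> X \<Longrightarrow> (\<And>i. z * g i - T g i = f i) \<Longrightarrow> g = res f"
proof -
  have x: "(\<Sum>l<d. char_matrix (inverse z) k l * res_coeff f l) = \<phi> k (neumann A z f)" if "k < d" for k
    unfolding res_coeff_def char_det_def
    by (rule lin_system_solution[OF _ that]) (use nz in \<open>simp add: char_det_def\<close>)
  show "res f \<in> X" "z * res f i - T (res f) i = f i"
    using solution_intro[OF f x res_def] by auto
  assume g: "g \<in> X" "\<And>i. z * g i - T g i = f i"
  note sol = solution_form[OF f g]
  have "\<phi> l g = res_coeff f l" if "l < d" for l
    using lin_system_cramer[OF sol(2) that] nz by (simp add: res_coeff_def char_det_def field_simps)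
  then show "g = res f" by (subst sol(1)) (simp add: res_def)
qed

lemma op_resolvent_eq:
  assumes nz: "char_det (inverse z) \<noteq> 0" and f: "f \<in> X"
  shows "op_resolvent X T z f = res f"
  unfolding op_resolvent_def
proof (rule the_equality)
  show "res f \<in> X \<and> (\<lambda>i. z * res f i - T (res f) i) = f"
    using resolvent_mem[OF nz f] resolvent_solves[OF nz f] by auto
  show "g = res f" if "g \<in> X \<and> (\<lambda>i. z * g i - T g i) = f" for g
    using that by (intro resolvent_unique[OF nz f]) auto
qed

lemma resolvent_bounded:
  assumes nz: "char_det (inverse z) \<noteq> 0"
  shows "bounded_op X nrm res"
  unfolding bounded_op_def
proof (intro conjI ballI allI)
  have T_op: "T f \<in> X" "f \<in> X \<Longrightarrow> g \<in> X \<Longrightarrow> T (\<lambda>i. f i + g i) = (\<lambda>i. T f i + T g i)"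
    "T (\<lambda>i. c * f i) = (\<lambda>i. c * T f i)" if "f \<in> X" for f g c
    using T_bounded that by (auto simp: bounded_op_def)
  show "res f \<in> X" if "f \<in> X" for f using resolvent_mem[OF nz that] .
  show "res (\<lambda>i. f i + g i) = (\<lambda>i. res f i + res g i)" if fg: "f \<in> X" "g \<in> X" for f g
  proof (rule resolvent_unique[OF nz, symmetric])
    show "z * (res f i + res g i) - T (\<lambda>i. res f i + res g i) i = f i + g i" for i
      using resolvent_solves[OF nz fg(1), of i] resolvent_solves[OF nz fg(2), of i]
      by (simp add: T_op resolvent_mem[OF nz] fg algebra_simps)
  qed (auto intro!: add_mem resolvent_mem[OF nz] fg)
  show "res (\<lambda>i. c * f i) = (\<lambda>i. c * res f i)" if f: "f \<in> X" for f c
  proof (rule resolvent_unique[OF nz, symmetric])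
    show "z * (c * res f i) - T (\<lambda>i. c * res f i) i = c * f i" for i
      using arg_cong[OF resolvent_solves[OF nz f, of i], of "\<lambda>t. c * t"]
      by (simp add: T_op resolvent_mem[OF nz] f right_diff_distrib mult.left_commute)
  qed (auto intro!: scale_mem resolvent_mem[OF nz] f)
  have "\<forall>l. \<exists>C\<ge>0. l < d \<longrightarrow> (\<forall>f\<in>X. cmod (\<phi> l f) \<le> C * nrm f)"
    using bounded_functionalD(4)[OF \<phi>] by (metis order_refl)
  then obtain C where C: "\<And>l. C l \<ge> 0" "\<And>l f. l < d \<Longrightarrow> f \<in> X \<Longrightarrow> cmod (\<phi> l f) \<le> C l * nrm f"
    by metis
  define \<delta> where "\<delta> = inverse (cmod z - r)"
  have \<delta>: "\<delta> > 0" using z by (simp add: \<delta>_def)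
  define D where "D l = (\<Sum>j<d. cmod (lin_adj d (char_matrix (inverse z)) l j) * (C j * \<delta>)) / cmod (char_det (inverse z))" for l
  have bound: "nrm (res f) \<le> (\<delta> + (\<Sum>l<d. D l * nrm (neumann A z (e l)))) * nrm f" if f: "f \<in> X" for f
  proof -
    have N: "nrm (neumann A z f) \<le> \<delta> * nrm f"
      using neumann_bound[OF z f] by (simp add: \<delta>_def divide_inverse mult.commute)
    have coeff: "cmod (res_coeff f l) \<le> D l * nrm f" for l
    proof -
      have "cmod (\<Sum>j<d. lin_adj d (char_matrix (inverse z)) l j * \<phi> j (neumann A z f))
        \<le> (\<Sum>j<d. cmod (lin_adj d (char_matrix (inverse z)) l j) * (C j * \<delta> * nrm f))"
      proof (intro sum_norm_le)
        fix j assume j: "j \<in> {..<d}"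
        have "cmod (\<phi> j (neumann A z f)) \<le> C j * nrm (neumann A z f)"
          using C(2) j neumann_mem[OF z f] by auto
        also have "\<dots> \<le> C j * (\<delta> * nrm f)" by (rule mult_left_mono[OF N C(1)])
        finally show "cmod (lin_adj d (char_matrix (inverse z)) l j * \<phi> j (neumann A z f))
            \<le> cmod (lin_adj d (char_matrix (inverse z)) l j) * (C j * \<delta> * nrm f)"
          by (auto simp: norm_mult mult.assoc intro: mult_left_mono)
      qed
      also have "\<dots> = (\<Sum>j<d. cmod (lin_adj d (char_matrix (inverse z)) l j) * (C j * \<delta>)) * nrm f"
        by (simp add: sum_distrib_right mult.assoc)
      finally show ?thesis
        unfolding res_coeff_def D_def norm_divide times_divide_eq_left by (rule divide_right_mono) simp
    qed
    have "nrm (res f) \<le> nrm (neumann A z f) + nrm (\<lambda>i. \<Sum>l<d. res_coeff f l * neumann A z (e l) i)"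
      unfolding res_def using f by (intro nrm_add lincomb_mem neumann_mem[OF z]) (auto simp: e_mem)
    also have "\<dots> \<le> \<delta> * nrm f + (\<Sum>l<d. cmod (res_coeff f l) * nrm (neumann A z (e l)))"
      by (intro add_mono N lincomb_mem neumann_mem[OF z]) (auto simp: e_mem)
    also have "\<dots> \<le> \<delta> * nrm f + (\<Sum>l<d. D l * nrm f * nrm (neumann A z (e l)))"
      by (intro add_mono order_refl sum_mono mult_right_mono coeff nrm_nonneg neumann_mem[OF z]) (auto simp: e_mem)
    also have "\<dots> = (\<delta> + (\<Sum>l<d. D l * nrm (neumann A z (e l)))) * nrm f"
      by (simp add: algebra_simps sum_distrib_left)
    finally show ?thesis .
  qed
  then show "\<exists>C. \<forall>f\<in>X. nrm (res f) \<le> C * nrm f" by blast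
qed

lemma spectrum_iff: "z \<in> op_spectrum X nrm T \<longleftrightarrow> char_det (inverse z) = 0"
proof
  assume "z \<in> op_spectrum X nrm T"
  show "char_det (inverse z) = 0"
  proof (rule ccontr)
    assume nz: "char_det (inverse z) \<noteq> 0"
    have "res (\<lambda>i. z * f i - T f i) = f \<and> (\<lambda>i. z * res f i - T (res f) i) = f" if f: "f \<in> X" for f
    proof
      show "res (\<lambda>i. z * f i - T f i) = f"
        by (rule resolvent_unique[OF nz, symmetric]) (use f in \<open>auto intro: diff_mem scale_mem T_mem\<close>)
      show "(\<lambda>i. z * res f i - T (res f) i) = f" using resolvent_solves[OF nz f] by auto
    qed
    then have "z \<notin> op_spectrum X nrm T"
      using resolvent_bounded[OF nz] unfolding op_spectrum_def by blast
    with \<open>z \<in> op_spectrum X nrm T\<close> show False by simp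
  qed
next
  assume "char_det (inverse z) = 0"
  then obtain f where f: "f \<in> X" "f \<noteq> (\<lambda>_. 0)" "T f = (\<lambda>i. z * f i)"
    using eigenvalue_iff unfolding op_eigenvalue_def by blast
  show "z \<in> op_spectrum X nrm T"
    unfolding op_spectrum_def
  proof safe
    fix S assume S: "bounded_op X nrm S"
      "\<forall>f\<in>X. S (\<lambda>i. z * f i - T f i) = f \<and> (\<lambda>i. z * S f i - T (S f) i) = f"
    have "S (\<lambda>i. 0 * f i) = (\<lambda>i. 0 * S f i)" using S(1) f(1) unfolding bounded_op_def by blast
    moreover have "S (\<lambda>i. z * f i - T f i) = f" using S(2) f(1) by blast
    ultimately show False using f by simp
  qed
qed

end

lemma outside_open_connected: "open {w. r < cmod w}" "connected {w. r < cmod w}"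
proof -
  have eq: "{w. r < cmod w} = - cball 0 r" by auto
  show "open {w. r < cmod w}" unfolding eq by (rule open_Compl) simp
  show "connected {w. r < cmod w}" unfolding eq
    by (intro connected_complement_bounded_convex) auto
qed

text \<open>
  The determinant is not identically zero on the connected exterior domain, since a large \<open>z\<close> is
  never an eigenvalue of the bounded operator \<open>T\<close>. So it has zeros of finite order only.
\<close>
lemma char_det_factor:
  assumes z: "r < cmod z" and 0: "char_det (inverse z) = 0"
  obtains G s n where "0 < n" "0 < s" "ball z s \<subseteq> {w. r < cmod w}" "G holomorphic_on ball z s"
    "\<And>w. w \<in> ball z s \<Longrightarrow> char_det (inverse w) = (w - z) ^ n * G w"
    "\<And>w. w \<in> ball z s \<Longrightarrow> G w \<noteq> 0"
proof (rule holomorphic_factor_zero_nonconstant[OF holomorphic_outside[OF char_det_holomorphic] outside_open_connected])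
  show "\<not> (\<lambda>w. char_det (inverse w)) constant_on {w. r < cmod w}"
  proof
    assume "(\<lambda>w. char_det (inverse w)) constant_on {w. r < cmod w}"
    then have const: "char_det (inverse w) = 0" if "r < cmod w" for w
      using that 0 z unfolding constant_on_def by auto
    obtain R where R: "R > r" "norm_bounded_op X nrm T R" using T_norm_bounded by blast
    interpret T: norm_bounded_op X nrm T R by fact
    define w where "w = complex_of_real (R + 1)"
    have w: "R < cmod w" "r < cmod w" using R T.r_pos by (auto simp: w_def)
    obtain f where f: "f \<in> X" "f \<noteq> (\<lambda>_. 0)" "T f = (\<lambda>i. w * f i)"
      using const[OF w(2)] eigenvalue_iff[OF w(2)] unfolding op_eigenvalue_def by blast
    then have "f = neumann T w (\<lambda>_. 0)"
      by (intro T.neumann_unique[OF w(1)] zero_mem) auto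
    moreover have "(\<lambda>_. 0) = neumann T w (\<lambda>_. 0)"
      using T.op_scale[OF zero_mem, of 0]
      by (intro T.neumann_unique[OF w(1)] zero_mem) (auto simp: fun_eq_iff)
    ultimately show False using f(2) by simp
  qed
qed (use z 0 in auto)

text \<open>
  In the formula for the resolvent of \<open>T\<close> the first term, the resolvent of \<open>A\<close>, is holomorphic
  and integrates to zero. The other terms are products of a scalar function, which depends on
  \<open>f\<close> and has a pole of order at most \<open>n\<close>, and of one of \<open>d\<close> fixed vector-valued holomorphic
  functions. Their residues involve only the derivatives of order below \<open>n\<close> of these \<open>d\<close>
  functions.
\<close>
lemma riesz_finite_rank:
  assumes G: "0 < n" "ball z s \<subseteq> {w. r < cmod w}" "G holomorphic_on ball z s"
    "\<And>w. w \<in> ball z s \<Longrightarrow> char_det (inverse w) = (w - z) ^ n * G w"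
    "\<And>w. w \<in> ball z s \<Longrightarrow> G w \<noteq> 0" and \<epsilon>: "0 < \<epsilon>" "\<epsilon> < s"
  shows "finite_dim (riesz_projection X T z \<epsilon> ` X)"
proof -
  obtain k where k: "n = Suc k" using G(1) by (cases n) auto
  define h where "h = (\<lambda>(l, j) i. (deriv ^^ (k - j)) (\<lambda>w. neumann A w (e l) i) z)"
  have cb: "cball z \<epsilon> \<subseteq> ball z s" using \<epsilon> by auto
  have sub: "p holomorphic_on ball z s" if "p holomorphic_on {w. r < cmod w}" for p
    by (rule holomorphic_on_subset[OF that G(2)])
  show ?thesis
  proof (rule finite_dimI[of "{..<d} \<times> {0..k}" _ h])
    show "finite ({..<d} \<times> {0..k})" by simp
    fix g assume "g \<in> riesz_projection X T z \<epsilon> ` X"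
    then obtain f where f: "f \<in> X" and g: "g = riesz_projection X T z \<epsilon> f" by blast
    define Y where "Y l w = (\<Sum>j<d. lin_adj d (char_matrix (inverse w)) l j * \<phi> j (neumann A w f)) / G w" for l w
    have Y: "Y l holomorphic_on ball z s" if l: "l < d" for l
      unfolding Y_def
    proof (intro holomorphic_intros G(3) sub functional_neumann_holomorphic \<phi> f)
      fix j assume "j \<in> {..<d}"
      then show "(\<lambda>w. lin_adj d (char_matrix (inverse w)) l j) holomorphic_on {w. r < cmod w}"
        using l by (intro holomorphic_outside lin_adj_holomorphic_on char_matrix_holomorphic) auto
    qed (use G(5) in auto)
    have N: "(\<lambda>w. neumann A w p i) holomorphic_on ball z s" if "p \<in> X" for p i
      by (rule sub[OF functional_neumann_holomorphic[OF coord_functional that]])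
    define c where "c = (\<lambda>(l, j). of_nat (k choose j) * (deriv ^^ j) (Y l) z / fact k)"
    have "g i = (\<Sum>p\<in>{..<d} \<times> {0..k}. c p * h p i)" for i
    proof -
      have "((\<lambda>w. neumann A w f i + (\<Sum>l<d. Y l w / (w - z) ^ Suc k * neumann A w (e l) i)) has_contour_integral
        0 + (\<Sum>l<d. (2 * of_real pi * \<i>) * (\<Sum>j=0..k. of_nat (k choose j) * (deriv ^^ j) (Y l) z *
           (deriv ^^ (k - j)) (\<lambda>w. neumann A w (e l) i) z / fact k))) (circlepath z \<epsilon>)"
      proof (intro has_contour_integral_add has_contour_integral_sum)
        show "((\<lambda>w. neumann A w f i) has_contour_integral 0) (circlepath z \<epsilon>)"
          by (rule Cauchy_theorem_disc_simple[OF N[OF f]]) (use \<epsilon> in auto)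
        show "((\<lambda>w. Y l w / (w - z) ^ Suc k * neumann A w (e l) i) has_contour_integral
          (2 * of_real pi * \<i>) * (\<Sum>j=0..k. of_nat (k choose j) * (deriv ^^ j) (Y l) z *
           (deriv ^^ (k - j)) (\<lambda>w. neumann A w (e l) i) z / fact k)) (circlepath z \<epsilon>)" if "l \<in> {..<d}" for l
          using that \<epsilon> cb by (intro contour_integral_pole[of _ "ball z s"] Y N e_mem) auto
      qed auto
      also have "0 + (\<Sum>l<d. (2 * of_real pi * \<i>) * (\<Sum>j=0..k. of_nat (k choose j) * (deriv ^^ j) (Y l) z *
           (deriv ^^ (k - j)) (\<lambda>w. neumann A w (e l) i) z / fact k)) =
           (2 * of_real pi * \<i>) * (\<Sum>p\<in>{..<d} \<times> {0..k}. c p * h p i)"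
        by (simp add: c_def h_def sum.cartesian_product' sum_distrib_left)
      finally have "((\<lambda>w. op_resolvent X T w f i) has_contour_integral
          (2 * of_real pi * \<i>) * (\<Sum>p\<in>{..<d} \<times> {0..k}. c p * h p i)) (circlepath z \<epsilon>)"
      proof (rule has_contour_integral_eq)
        fix w assume "w \<in> path_image (circlepath z \<epsilon>)"
        then have w: "w \<in> ball z s" "w \<noteq> z" using \<epsilon> by auto
        then have rw: "r < cmod w" using G(2) by auto
        have nz: "char_det (inverse w) \<noteq> 0" using G(4,5)[OF w(1)] w(2) by simp
        have "Y l w / (w - z) ^ Suc k = res_coeff w f l" for l
          using G(4)[OF w(1)] by (simp add: Y_def res_coeff_def[OF rw] k mult.commute)
        then show "neumann A w f i + (\<Sum>l<d. Y l w / (w - z) ^ Suc k * neumann A w (e l) i) = op_resolvent X T w f i"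
          by (simp add: op_resolvent_eq[OF rw nz f] res_def[OF rw])
      qed
      then show ?thesis
        by (simp add: g riesz_projection_def contour_integral_unique)
    qed
    then show "\<exists>c. \<forall>i. g i = (\<Sum>p\<in>{..<d} \<times> {0..k}. c p * h p i)" by blast
  qed
qed

theorem discrete_spectrum_outside:
  assumes z: "r < cmod z" and spec: "z \<in> op_spectrum X nrm T"
  shows "z isolated_in op_spectrum X nrm T" "op_eigenvalue X T z" "finite_alg_mult X nrm T z"
proof -
  have 0: "char_det (inverse z) = 0" using spec spectrum_iff[OF z] by simp
  then show "op_eigenvalue X T z" using eigenvalue_iff[OF z] by simp
  obtain G s n where G: "0 < n" "0 < s" "ball z s \<subseteq> {w. r < cmod w}" "G holomorphic_on ball z s"
    "\<And>w. w \<in> ball z s \<Longrightarrow> char_det (inverse w) = (w - z) ^ n * G w"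
    "\<And>w. w \<in> ball z s \<Longrightarrow> G w \<noteq> 0"
    using char_det_factor[OF z 0] by metis
  have only: "w = z" if "w \<in> ball z s" "w \<in> op_spectrum X nrm T" for w
  proof -
    have "char_det (inverse w) = 0" using that spectrum_iff[of w] G(3) by auto
    then show ?thesis using G(5,6)[OF that(1)] by simp
  qed
  have "ball z s \<inter> op_spectrum X nrm T = {z}" using only spec G(2) by auto
  then show "z isolated_in op_spectrum X nrm T"
    unfolding isolated_in_def using spec by (intro conjI exI[of _ "ball z s"]) auto
  have "cball z (s / 2) \<subseteq> ball z s" using G(2) by auto
  then have "cball z (s / 2) \<inter> op_spectrum X nrm T = {z}"
    using only spec G(2) by auto
  moreover have "finite_dim (riesz_projection X T z (s / 2) ` X)"
    using G by (intro riesz_finite_rank[of n z s G]) auto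
  ultimately show "finite_alg_mult X nrm T z"
    unfolding finite_alg_mult_def using G(2) by (intro exI[of _ "s / 2"]) auto
qed

text \<open>
  The zeros of the determinant in a closed annulus form a compact set. If none of them lies on
  the unit circle, the largest modulus is less than one.
\<close>
lemma eigenvalue_gap:
  assumes "r < 1" and no: "\<And>z. 1 \<le> cmod z \<Longrightarrow> \<not> op_eigenvalue X T z"
  obtains \<rho> where "r < \<rho>" "\<rho> < 1" "\<And>z. \<rho> < cmod z \<Longrightarrow> \<not> op_eigenvalue X T z"
proof -
  define r' where "r' = (r + 1) / 2"
  have r': "r < r'" "r' < 1" using assms(1) by (auto simp: r'_def)
  define S where "S = {w. r' \<le> cmod w \<and> cmod w \<le> 1}"
  define Z where "Z = {w \<in> S. char_det (inverse w) = 0}"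
  have S: "closed S" "S \<subseteq> {w. r < cmod w}" "bounded S"
    using r' by (auto simp: S_def Collect_conj_eq bounded_iff intro!: closed_Int closed_Collect_le continuous_intros)
  have "continuous_on S (\<lambda>w. char_det (inverse w))"
    using holomorphic_on_imp_continuous_on[OF holomorphic_outside[OF char_det_holomorphic]] S(2)
    by (rule continuous_on_subset)
  then have "closed Z"
    unfolding Z_def by (intro continuous_closed_preimage_constant S(1))
  moreover have "bounded Z" using S(3) by (rule bounded_subset) (auto simp: Z_def)
  ultimately have Z: "compact Z" by (simp add: compact_eq_bounded_closed)
  have ev: "z \<in> Z" if "r' < cmod z" "op_eigenvalue X T z" for z
    using that no[of z] r' eigenvalue_iff[of z] by (cases "1 \<le> cmod z") (auto simp: Z_def S_def)
  show ?thesis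
  proof (cases "Z = {}")
    case True
    then show ?thesis using that[of r'] r' ev by blast
  next
    case False
    obtain m where m: "m \<in> Z" "\<And>z. z \<in> Z \<Longrightarrow> cmod z \<le> cmod m"
      using continuous_attains_sup[OF Z False, of cmod] by (auto intro: continuous_intros)
    have "cmod m \<noteq> 1"
      using no[of m] eigenvalue_iff[of m] m(1) S(2) by (auto simp: Z_def)
    then have "cmod m < 1" using m(1) by (auto simp: Z_def S_def)
    show ?thesis
    proof (rule that[of "max r' (cmod m)"])
      fix z assume "max r' (cmod m) < cmod z"
      then show "\<not> op_eigenvalue X T z" using ev[of z] m(2)[of z] by auto
    qed (use r' \<open>cmod m < 1\<close> in auto)
  qed
qed

text \<open>
  The numbers \<open>\<phi> l (T\<^sup>n f)\<close> are the Taylor coefficients of a function that, for small \<open>u\<close>, is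
  given by the Neumann series of \<open>T\<close>. By Cramer's rule this function is a quotient with
  denominator \<^term>\<open>char_det\<close>, hence extends holomorphically to the disc of radius
  \<open>1 / \<rho>0\<close>, and Cauchy's estimate on the circle of radius \<open>1 / \<rho>\<close> bounds the coefficients
  by a multiple of \<open>\<rho>\<^sup>n\<close>. The norms of the vectors \<open>T\<^sup>n f\<close> then follow from the recursion
  \<open>T\<^sup>n\<^sup>+\<^sup>1 f = A (T\<^sup>n f) + K (T\<^sup>n f)\<close>, because \<open>A\<close> contracts by the smaller factor \<open>r\<close>.
\<close>
theorem power_growth:
  assumes "r \<le> \<rho>0" "\<rho>0 < \<rho>" and no: "\<And>z. \<rho>0 < cmod z \<Longrightarrow> \<not> op_eigenvalue X T z"
  shows "\<exists>C>0. \<forall>f\<in>X. \<forall>n. nrm ((T ^^ n) f) \<le> C * \<rho> ^ n * nrm f"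
proof -
  have \<rho>: "0 < \<rho>0" "0 < \<rho>" "r < \<rho>" using assms(1,2) r_pos by auto
  have ball_sub: "ball 0 (1 / \<rho>0) \<subseteq> ball (0::complex) (1 / r)"
    using \<rho>(1) assms(1) r_pos by (intro subset_ball) (simp add: frac_le)
  have nz: "char_det u \<noteq> 0" if "u \<in> ball 0 (1 / \<rho>0)" for u
  proof (cases "u = 0")
    case False
    then have "\<rho>0 < cmod (inverse u)" using that \<rho>(1) by (simp add: norm_inverse field_simps norm_divide)
    then show ?thesis using no[of "inverse u"] eigenvalue_iff[of "inverse u"] assms(1) by simp
  qed (simp add: char_det_0)
  \<comment> \<open>the candidate for the holomorphic extension of the generating function of \<open>\<phi> l (T\<^sup>n f)\<close>\<close>
  define F where "F f l u = (\<Sum>j<d. lin_adj d (char_matrix u) l j * moment_series A (\<phi> j) f u) / char_det u" for f l u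
  have adj_hol: "(\<lambda>u. lin_adj d (char_matrix u) l j) holomorphic_on ball 0 (1 / \<rho>0)" if "l < d" "j < d" for l j
    using that by (intro lin_adj_holomorphic_on holomorphic_on_subset[OF char_matrix_holomorphic ball_sub]) auto
  have det_hol: "char_det holomorphic_on ball 0 (1 / \<rho>0)"
    by (rule holomorphic_on_subset[OF char_det_holomorphic ball_sub])
  have F_hol: "F f l holomorphic_on ball 0 (1 / \<rho>0)" if "l < d" "f \<in> X" for f l
    unfolding F_def using that nz
    by (intro holomorphic_intros adj_hol det_hol holomorphic_on_subset[OF moment_series_holomorphic ball_sub] \<phi>) auto
  obtain R where R: "R > r" "norm_bounded_op X nrm T R" using T_norm_bounded by blast
  interpret T: norm_bounded_op X nrm T R by fact
  have F_sums: "(\<lambda>n. \<phi> l ((T ^^ n) f) * u ^ n) sums F f l u"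
    if u: "cmod u < 1 / max R \<rho>" and l: "l < d" and f: "f \<in> X" for u l f
  proof -
    have "1 / max R \<rho> \<le> 1 / R" using T.r_pos by (intro frac_le) auto
    then have uR: "cmod u < 1 / R" using u by simp
    have uball: "u \<in> ball 0 (1 / \<rho>0)"
    proof -
      have "1 / max R \<rho> \<le> 1 / \<rho>0" using \<rho> assms(2) by (intro frac_le) auto
      then show ?thesis using u by simp
    qed
    have "F f l u = moment_series T (\<phi> l) f u"
    proof (cases "u = 0")
      case True
      \<comment> \<open>\<open>u = 0\<close> corresponds to \<open>z = \<infinity>\<close>, where no Neumann series is available; the matrix is
        the identity there\<close>
      have "lin_det d (char_matrix 0) * \<phi> l f = (\<Sum>j<d. lin_adj d (char_matrix 0) l j * \<phi> j f)"
      proof (rule lin_system_cramer[OF _ l])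
        fix k assume "k < d"
        then show "(\<Sum>l<d. char_matrix 0 k l * \<phi> l f) = \<phi> k f"
          by (simp add: char_matrix_0 of_bool_def if_distrib[of "\<lambda>t. t * _"] cong: if_cong)
      qed
      then have "\<phi> l f = (\<Sum>j<d. lin_adj d (char_matrix 0) l j * \<phi> j f)"
        using char_det_0 by (simp add: char_det_def)
      then show ?thesis
        using True by (simp add: F_def char_det_0 moment_series_def)
    next
      case False
      define z where "z = inverse u"
      have iz: "inverse z = u" by (simp add: z_def)
      have zR: "R < cmod z"
        using uR False T.r_pos by (simp add: z_def norm_inverse field_simps norm_divide)
      then have z: "r < cmod z" using R by simp
      define g where "g = neumann T z f"
      have g: "g \<in> X" unfolding g_def by (rule T.neumann_mem[OF zR f])
      have eq: "z * g i - T g i = f i" for i unfolding g_def by (rule T.neumann_solves[OF zR f])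
      have "char_det u * \<phi> l g = (\<Sum>j<d. lin_adj d (char_matrix u) l j * \<phi> j (neumann A z f))"
        using lin_system_cramer[OF solution_form(2)[OF z f g eq] l] by (simp add: iz char_det_def)
      also have "\<dots> = u * (\<Sum>j<d. lin_adj d (char_matrix u) l j * moment_series A (\<phi> j) f u)"
        unfolding sum_distrib_left
        by (intro sum.cong) (auto simp: functional_neumann(2)[OF z \<phi> f] iz)
      also have "\<phi> l g = u * moment_series T (\<phi> l) f u"
        unfolding g_def by (simp add: T.functional_neumann(2)[OF zR \<phi>[OF l] f] iz)
      finally show ?thesis using nz[OF uball] False by (simp add: F_def field_simps)
    qed
    then show ?thesis using T.moment_series_sums[OF \<phi>[OF l] f uR] by simp
  qed
  define s where "s = 1 / \<rho>"
  have s: "0 < s" "s < 1 / \<rho>0" "s < 1 / r"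
    using \<rho> assms(2) r_pos by (auto simp: s_def intro: frac_less2)
  have coeff: "\<exists>C\<ge>0. \<forall>f\<in>X. \<forall>n. cmod (\<phi> l ((T ^^ n) f)) \<le> C * nrm f * \<rho> ^ n" if l: "l < d" for l
  proof -
    have cs: "compact (sphere (0::complex) s)" "sphere (0::complex) s \<subseteq> ball 0 (1 / \<rho>0)"
      using s by auto
    have "\<exists>B\<ge>0. \<forall>u\<in>sphere 0 s. cmod (lin_adj d (char_matrix u) l j / char_det u) \<le> B" if "j < d" for j
    proof -
      have "(\<lambda>u. lin_adj d (char_matrix u) l j / char_det u) holomorphic_on ball 0 (1 / \<rho>0)"
        using l that nz by (intro holomorphic_intros adj_hol det_hol) auto
      then have "continuous_on (sphere 0 s) (\<lambda>u. lin_adj d (char_matrix u) l j / char_det u)"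
        using cs(2) holomorphic_on_imp_continuous_on holomorphic_on_subset by blast
      then have "bounded ((\<lambda>u. lin_adj d (char_matrix u) l j / char_det u) ` sphere 0 s)"
        using cs(1) compact_continuous_image compact_imp_bounded by blast
      then obtain B where "\<forall>u\<in>sphere 0 s. cmod (lin_adj d (char_matrix u) l j / char_det u) \<le> B"
        unfolding bounded_iff by auto
      then show ?thesis by (intro exI[of _ "max B 0"]) (auto intro: max.coboundedI1)
    qed
    then obtain B where B: "\<And>j. j < d \<Longrightarrow> B j \<ge> 0"
      "\<And>j u. j < d \<Longrightarrow> cmod u = s \<Longrightarrow> cmod (lin_adj d (char_matrix u) l j / char_det u) \<le> B j"
      by (metis mem_sphere_0)
    obtain M where M: "\<And>j. j < d \<Longrightarrow> M j \<ge> 0"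
      "\<And>j u f. j < d \<Longrightarrow> f \<in> X \<Longrightarrow> cmod u = s \<Longrightarrow> cmod (moment_series A (\<phi> j) f u) \<le> M j * nrm f"
      using moment_series_bound[OF \<phi> less_imp_le[OF s(1)] s(3)] by metis
    define C where "C = (\<Sum>j<d. B j * M j)"
    have "C \<ge> 0" unfolding C_def using B(1) M(1) by (intro sum_nonneg) auto
    moreover have "cmod (\<phi> l ((T ^^ n) f)) \<le> C * nrm f * \<rho> ^ n" if f: "f \<in> X" for f n
    proof -
      have "cmod (\<phi> l ((T ^^ n) f)) \<le> (C * nrm f) / s ^ n"
      proof (rule power_series_coeff_bound[OF F_hol[OF l f] s(1,2), where q = "1 / max R \<rho>"])
        show "0 < 1 / max R \<rho>" using \<rho> by (simp add: less_max_iff_disj)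
        show "(\<lambda>n. \<phi> l ((T ^^ n) f) * u ^ n) sums F f l u" if "cmod u < 1 / max R \<rho>" for u
          using F_sums[OF that l f] .
        fix u :: complex assume u: "cmod u = s"
        have "F f l u = (\<Sum>j<d. lin_adj d (char_matrix u) l j / char_det u * moment_series A (\<phi> j) f u)"
          by (simp add: F_def sum_divide_distrib)
        also have "cmod \<dots> \<le> (\<Sum>j<d. B j * (M j * nrm f))"
        proof (rule sum_norm_le, unfold norm_mult)
          fix j assume "j \<in> {..<d}"
          then show "cmod (lin_adj d (char_matrix u) l j / char_det u) * cmod (moment_series A (\<phi> j) f u)
              \<le> B j * (M j * nrm f)"
            using B[of j] M[of j] u f by (intro mult_mono) auto
        qed
        finally show "cmod (F f l u) \<le> C * nrm f" by (simp add: C_def sum_distrib_right mult.assoc)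
      qed
      then show ?thesis by (simp add: s_def power_one_over)
    qed
    ultimately show ?thesis by blast
  qed
  then have "\<forall>l. \<exists>C\<ge>0. l < d \<longrightarrow> (\<forall>f\<in>X. \<forall>n. cmod (\<phi> l ((T ^^ n) f)) \<le> C * nrm f * \<rho> ^ n)"
    by (metis order_refl)
  then obtain C where C: "\<And>l. C l \<ge> 0"
    "\<And>l f n. l < d \<Longrightarrow> f \<in> X \<Longrightarrow> cmod (\<phi> l ((T ^^ n) f)) \<le> C l * nrm f * \<rho> ^ n"
    by metis
  define K where "K = (\<Sum>l<d. C l * nrm (e l))"
  have K: "K \<ge> 0" unfolding K_def using C(1) e_mem nrm_nonneg by (intro sum_nonneg) auto
  \<comment> \<open>chosen such that the bound \<open>Q \<rho>\<^sup>n\<close> reproduces itself: \<open>r Q + K \<le> \<rho> Q\<close>\<close>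
  define Q where "Q = 1 + K / (\<rho> - r)"
  have Q1: "Q \<ge> 1" using K \<rho> by (simp add: Q_def)
  have "(Q - 1) * (\<rho> - r) = K" using \<rho> by (simp add: Q_def)
  then have "r * Q + K + (\<rho> - r) = Q * \<rho>" by (simp add: algebra_simps)
  with Q1 \<rho> have Q: "Q \<ge> 1" "r * Q + K \<le> Q * \<rho>" by auto
  have "nrm ((T ^^ n) f) \<le> Q * \<rho> ^ n * nrm f" if f: "f \<in> X" for f n
  proof (induction n)
    case 0
    then show ?case using mult_right_mono[OF Q(1) nrm_nonneg[OF f]] by simp
  next
    case (Suc n)
    define g where "g = (T ^^ n) f"
    have g: "g \<in> X" unfolding g_def by (rule T.pow_mem[OF f])
    have "nrm ((T ^^ Suc n) f) = nrm (\<lambda>i. A g i + (\<Sum>l<d. \<phi> l g * e l i))"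
      by (simp add: g_def[symmetric] T_eq[OF g])
    also have "\<dots> \<le> nrm (A g) + nrm (\<lambda>i. \<Sum>l<d. \<phi> l g * e l i)"
      by (rule nrm_add[OF op_mem[OF g] rank_part_mem])
    also have "\<dots> \<le> r * nrm g + (\<Sum>l<d. cmod (\<phi> l g) * nrm (e l))"
      by (intro add_mono op_bound[OF g] lincomb_mem) (auto simp: e_mem)
    also have "\<dots> \<le> r * (Q * \<rho> ^ n * nrm f) + (\<Sum>l<d. C l * nrm f * \<rho> ^ n * nrm (e l))"
      using C(2)[OF _ f] Suc r_pos unfolding g_def
      by (intro add_mono sum_mono mult_right_mono mult_left_mono nrm_nonneg e_mem) auto
    also have "\<dots> = (r * Q + K) * (\<rho> ^ n * nrm f)"
      by (simp add: K_def algebra_simps sum_distrib_left)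
    also have "\<dots> \<le> (Q * \<rho>) * (\<rho> ^ n * nrm f)"
      using Q(2) \<rho> nrm_nonneg[OF f] by (intro mult_right_mono) auto
    finally show ?case by (simp add: mult_ac)
  qed
  moreover have "Q > 0" using Q(1) by simp
  ultimately show ?thesis by blast
qed

end

section \<open>Eigenfunctions of an ergodic chain on and outside the unit circle\<close>

locale markov_chain =
  fixes P :: "nat \<Rightarrow> nat \<Rightarrow> real" and \<pi> :: "nat \<Rightarrow> real"
  assumes kernel: "markov_kernel P" and irreducible: "irreducible_kernel P"
    and aperiodic: "aperiodic_kernel P" and invariant: "invariant_prob P \<pi>"
begin

lemma P_nonneg: "0 \<le> P i j" and P_sums: "P i sums 1"
  using kernel by (auto simp: markov_kernel_def)

lemma \<pi>_nonneg: "0 \<le> \<pi> i" and \<pi>_sums: "\<pi> sums 1" and \<pi>_inv: "(\<lambda>i. \<pi> i * P i j) sums \<pi> j"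
  using invariant by (auto simp: invariant_prob_def)

lemma flow_le: "\<pi> i * P i j \<le> \<pi> j"
  using sum_le_suminf[of "\<lambda>i. \<pi> i * P i j" "{i}"] \<pi>_inv[of j] P_nonneg \<pi>_nonneg
  by (auto simp: sums_iff)

lemma n_step_bounds: "0 \<le> n_step P n i j" "n_step P n i j \<le> 1"
proof -
  have "0 \<le> n_step P n i j \<and> n_step P n i j \<le> 1"
  proof (induction n arbitrary: i)
    case (Suc n)
    have le: "P i k * n_step P n k j \<le> P i k" for k
      using Suc[of k] P_nonneg[of i k] by (simp add: mult_left_le)
    have nonneg: "0 \<le> P i k * n_step P n k j" for k
      using Suc[of k] by (intro mult_nonneg_nonneg P_nonneg) auto
    have sm: "summable (P i)" "(\<Sum>k. P i k) = 1" using P_sums[of i] by (auto simp: sums_iff)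
    have sm': "summable (\<lambda>k. P i k * n_step P n k j)"
      by (rule summable_comparison_test'[OF sm(1), of 0]) (use le nonneg in auto)
    show ?case
      using suminf_nonneg[OF sm' nonneg] suminf_le[OF le sm' sm(1)] sm(2) by simp
  qed auto
  then show "0 \<le> n_step P n i j" "n_step P n i j \<le> 1" by auto
qed

lemma n_step_SucD:
  assumes "0 < n_step P (Suc n) i j"
  obtains k where "0 < P i k" "0 < n_step P n k j"
proof -
  have "\<exists>k. P i k * n_step P n k j \<noteq> 0"
  proof (rule ccontr)
    assume "\<not> (\<exists>k. P i k * n_step P n k j \<noteq> 0)"
    then have "(\<lambda>k. P i k * n_step P n k j) = (\<lambda>_. 0)" by auto
    with assms show False by simp
  qed
  then obtain k where "P i k * n_step P n k j \<noteq> 0" by blast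
  then show ?thesis using that[of k] P_nonneg[of i k] n_step_bounds(1)[of n k j] by auto
qed

lemma n_step_pathD:
  assumes "\<And>i j. R i \<Longrightarrow> 0 < P i j \<Longrightarrow> R j" and "0 < n_step P n i j" and "R i"
  shows "R j"
  using assms(2,3)
proof (induction n arbitrary: i)
  case 0
  then show ?case by (simp split: if_splits)
next
  case (Suc n)
  then show ?case by (metis assms(1) n_step_SucD)
qed

lemma \<pi>_pos: "0 < \<pi> j"
proof -
  have "\<exists>i. \<pi> i \<noteq> 0"
  proof (rule ccontr)
    assume "\<not> (\<exists>i. \<pi> i \<noteq> 0)"
    then have "\<pi> = (\<lambda>_. 0)" by auto
    then show False using \<pi>_sums by (auto simp: sums_iff)
  qed
  then obtain i where i: "0 < \<pi> i" using \<pi>_nonneg by (metis order_le_less)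
  obtain n where "0 < n_step P n i j" using irreducible by (auto simp: irreducible_kernel_def)
  then show ?thesis
  proof (rule n_step_pathD[of "\<lambda>i. 0 < \<pi> i", rotated 1])
    show "0 < \<pi> i" by (rule i)
    fix i j assume "0 < \<pi> i" "0 < P i j"
    then have "0 < \<pi> i * P i j" by simp
    also have "\<dots> \<le> \<pi> j" by (rule flow_le)
    finally show "0 < \<pi> j" .
  qed
qed

lemma P_le_ratio: "P i j \<le> \<pi> j / \<pi> i"
  using flow_le[of i j] \<pi>_pos[of i] by (simp add: field_simps)

lemma kernel_summable:
  assumes "summable (\<lambda>j. cmod (f j) * \<pi> j)"
  shows "summable (\<lambda>j. cmod (of_real (P i j) * f j))"
proof (rule summable_comparison_test'[of "\<lambda>j. cmod (f j) * \<pi> j * (1 / \<pi> i)" 0])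
  show "summable (\<lambda>j. cmod (f j) * \<pi> j * (1 / \<pi> i))" using assms by (rule summable_mult2)
  show "norm (cmod (of_real (P i j) * f j)) \<le> cmod (f j) * \<pi> j * (1 / \<pi> i)" for j
    using mult_right_mono[OF P_le_ratio[of i j], of "cmod (f j)"] P_nonneg[of i j]
    by (simp add: norm_mult mult_ac)
qed

lemma kernel_op_sums:
  "summable (\<lambda>j. cmod (f j) * \<pi> j) \<Longrightarrow> (\<lambda>j. of_real (P i j) * f j) sums kernel_op P f i"
  unfolding kernel_op_def by (intro summable_sums summable_norm_cancel[OF kernel_summable])

lemma mean_op_sums:
  "summable (\<lambda>j. cmod (f j) * \<pi> j) \<Longrightarrow> (\<lambda>j. f j * of_real (\<pi> j)) sums mean_op \<pi> f i"
  unfolding mean_op_def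
  by (rule summable_sums, rule summable_norm_cancel) (simp add: norm_mult \<pi>_nonneg)

text \<open>
  The mean of \<open>P f\<close> is that of \<open>f\<close>: the double series converges absolutely, because its absolute
  values can be summed over \<open>i\<close> first, where invariance of \<open>\<pi>\<close> gives \<open>|f j| \<pi> j\<close>.
\<close>
lemma stationary_sums:
  assumes f: "summable (\<lambda>j. cmod (f j) * \<pi> j)"
  shows "(\<lambda>i. kernel_op P f i * of_real (\<pi> i)) sums mean_op \<pi> f i0"
proof -
  define h where "h = (\<lambda>(j, i). f j * of_real (\<pi> i * P i j))"
  have row: "((\<lambda>i. norm (h (j, i))) has_sum (cmod (f j) * \<pi> j)) UNIV" for j
    using sums_mult[OF \<pi>_inv[of j], of "cmod (f j)"] \<pi>_nonneg P_nonneg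
    by (intro sums_nonneg_imp_has_sum) (auto simp: h_def norm_mult)
  have "(\<lambda>x. norm (h x)) summable_on UNIV \<times> UNIV"
  proof (intro Infinite_Sum.abs_summable_on_Sigma_iff[THEN iffD2] conjI ballI)
    show "(\<lambda>i. norm (h (j, i))) summable_on UNIV" for j using row by (rule has_sum_imp_summable)
    have "(\<lambda>j. cmod (f j) * \<pi> j) summable_on UNIV"
      using f \<pi>_nonneg by (subst summable_on_UNIV_nonneg_real_iff) auto
    then show "(\<lambda>j. norm (\<Sum>\<^sub>\<infinity>i. norm (h (j, i)))) summable_on UNIV"
      using \<pi>_nonneg by (simp add: infsumI[OF row])
  qed
  then have "h summable_on UNIV \<times> UNIV" by (rule abs_summable_summable)
  then obtain S where S: "(h has_sum S) (UNIV \<times> UNIV)" by (auto simp: summable_on_def)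
  have "((\<lambda>j. f j * of_real (\<pi> j)) has_sum S) UNIV"
  proof (rule has_sum_SigmaD[OF S])
    fix j
    have "(\<lambda>i. norm (h (j, i))) summable_on UNIV" using row by (rule has_sum_imp_summable)
    then have "summable (\<lambda>i. norm (h (j, i)))" by (rule summable_on_imp_summable)
    moreover have "(\<lambda>i. h (j, i)) sums (f j * of_real (\<pi> j))"
      unfolding h_def prod.case by (intro sums_mult sums_of_real \<pi>_inv)
    ultimately show "((\<lambda>i. h (j, i)) has_sum f j * of_real (\<pi> j)) UNIV"
      by (rule norm_summable_imp_has_sum)
  qed
  then have "(\<lambda>j. f j * of_real (\<pi> j)) sums S" by (rule has_sum_imp_sums)
  with mean_op_sums[OF f] have S_eq: "S = mean_op \<pi> f i0" by (rule sums_unique2[symmetric])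
  have "((\<lambda>(i, j). h (j, i)) has_sum S) (UNIV \<times> UNIV)" using S has_sum_swap by blast
  then have "((\<lambda>i. kernel_op P f i * of_real (\<pi> i)) has_sum S) UNIV"
  proof (rule has_sum_SigmaD)
    fix i
    have "(\<lambda>j. of_real (P i j) * f j * of_real (\<pi> i)) sums (kernel_op P f i * of_real (\<pi> i))"
      by (intro sums_mult2 kernel_op_sums f)
    moreover have "summable (\<lambda>j. norm (of_real (P i j) * f j * of_real (\<pi> i)))"
      using summable_mult2[OF kernel_summable[OF f, of i], of "\<pi> i"] \<pi>_nonneg by (simp add: norm_mult)
    ultimately have "((\<lambda>j. of_real (P i j) * f j * of_real (\<pi> i)) has_sum kernel_op P f i * of_real (\<pi> i)) UNIV"
      by (intro norm_summable_imp_has_sum)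
    then show "((\<lambda>j. case (i, j) of (i, j) \<Rightarrow> h (j, i)) has_sum kernel_op P f i * of_real (\<pi> i)) UNIV"
      by (simp add: h_def mult_ac)
  qed
  then show ?thesis using S_eq has_sum_imp_sums by blast
qed

text \<open>
  Here \<open>|x| \<le> 1 + |x|\<^sup>2\<close>, and constants are integrable because \<open>\<pi>\<close> is a probability.
\<close>
lemma l2_summable:
  assumes "f \<in> l2_space \<pi>"
  shows "summable (\<lambda>j. cmod (f j) * \<pi> j)"
proof (rule summable_comparison_test'[of "\<lambda>j. \<pi> j + (cmod (f j))\<^sup>2 * \<pi> j" 0])
  show "summable (\<lambda>j. \<pi> j + (cmod (f j))\<^sup>2 * \<pi> j)"
    using assms \<pi>_sums by (intro summable_add) (auto simp: l2_space_def sums_iff)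
  fix j
  have "0 \<le> (cmod (f j) - 1)\<^sup>2" by simp
  then have "2 * cmod (f j) \<le> 1 + (cmod (f j))\<^sup>2" by (simp add: power2_diff)
  then have "cmod (f j) \<le> 1 + (cmod (f j))\<^sup>2" using norm_ge_zero[of "f j"] by linarith
  from mult_right_mono[OF this \<pi>_nonneg[of j]]
  show "norm (cmod (f j) * \<pi> j) \<le> \<pi> j + (cmod (f j))\<^sup>2 * \<pi> j"
    using \<pi>_nonneg[of j] by (simp add: algebra_simps)
qed

lemma kernel_op_const: "kernel_op P (\<lambda>_. c) = (\<lambda>_. c)"
proof
  fix i
  have "(\<lambda>j. of_real (P i j) * c) sums (of_real 1 * c)"
    by (intro sums_mult2 sums_of_real P_sums)
  then show "kernel_op P (\<lambda>_. c) i = c" by (simp add: kernel_op_def sums_iff)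
qed

lemma mean_op_const: "mean_op \<pi> (\<lambda>_. c) = (\<lambda>_. c)"
proof
  fix i
  have "(\<lambda>j. c * of_real (\<pi> j)) sums (c * of_real 1)"
    by (intro sums_mult sums_of_real \<pi>_sums)
  then show "mean_op \<pi> (\<lambda>_. c) i = c" by (simp add: mean_op_def sums_iff)
qed

text \<open>
  By invariance, \<open>P\<close> applied to \<open>|f|\<^sup>2\<close> has the same mean as \<open>|f|\<^sup>2\<close>, while
  \<open>|P f|\<^sup>2 = |z|\<^sup>2 |f|\<^sup>2\<close> has a mean at least as large. So the variances of \<open>f\<close> under the
  distributions \<open>P i\<close>, which are nonnegative, average to at most zero. They all vanish, and \<open>f\<close>
  equals its conditional mean \<open>z f i\<close> at every point that can be reached from \<open>i\<close> in one step.
\<close>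
lemma peripheral_eigenfunction_step:
  assumes f: "f \<in> l2_space \<pi>" and ev: "kernel_op P f = (\<lambda>i. z * f i)" and z: "1 \<le> cmod z"
    and "0 < P i j"
  shows "f j = z * f i"
proof -
  define g where "g j = complex_of_real ((cmod (f j))\<^sup>2)" for j
  have sm_f: "summable (\<lambda>j. cmod (f j) * \<pi> j)" by (rule l2_summable[OF f])
  have sm_g: "summable (\<lambda>j. cmod (g j) * \<pi> j)" using f by (simp add: g_def l2_space_def norm_power)
  define q where "q i = (\<Sum>j. P i j * (cmod (f j))\<^sup>2)" for i
  have q_sums: "(\<lambda>j. P i j * (cmod (f j))\<^sup>2) sums q i" for i
  proof -
    have "summable (\<lambda>j. P i j * (cmod (f j))\<^sup>2)"
      using kernel_summable[OF sm_g, of i] P_nonneg by (simp add: norm_mult g_def norm_power)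
    then show ?thesis unfolding q_def by (rule summable_sums)
  qed
  have Pg: "kernel_op P g i = of_real (q i)" for i
  proof -
    have "(\<lambda>j. complex_of_real (P i j * (cmod (f j))\<^sup>2)) sums of_real (q i)"
      by (rule sums_of_real[OF q_sums])
    then have "(\<lambda>j. of_real (P i j) * g j) sums of_real (q i)" by (simp add: g_def)
    with kernel_op_sums[OF sm_g] show ?thesis by (rule sums_unique2)
  qed
  define E where "E = (\<Sum>i. (cmod (f i))\<^sup>2 * \<pi> i)"
  have E_sums: "(\<lambda>i. (cmod (f i))\<^sup>2 * \<pi> i) sums E"
    using f unfolding E_def l2_space_def by (auto intro: summable_sums)
  have E_nonneg: "0 \<le> E" unfolding E_def using E_sums \<pi>_nonneg by (auto intro!: suminf_nonneg simp: sums_iff)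
  have qE: "(\<lambda>i. q i * \<pi> i) sums E"
  proof -
    have "(\<lambda>j. g j * of_real (\<pi> j)) sums of_real E"
      using sums_of_real[OF E_sums, where 'a = complex] by (simp add: g_def)
    then have "mean_op \<pi> g 0 = of_real E" using mean_op_sums[OF sm_g] sums_unique2 by blast
    then have "(\<lambda>i. complex_of_real (q i * \<pi> i)) sums of_real E"
      using stationary_sums[OF sm_g, of 0] by (simp add: Pg)
    then show ?thesis by (simp only: sums_of_real_iff)
  qed
  have var: "(\<lambda>j. P i j * (cmod (f j - z * f i))\<^sup>2) sums (q i - (cmod z)\<^sup>2 * (cmod (f i))\<^sup>2)" for i
  proof -
    define c where "c = z * f i"
    have "(\<lambda>j. Re (cnj c * (of_real (P i j) * f j))) sums Re (cnj c * kernel_op P f i)"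
      by (intro sums_Re sums_mult kernel_op_sums sm_f)
    also have "cnj c * kernel_op P f i = of_real ((cmod c)\<^sup>2)"
      using ev by (simp add: c_def[symmetric] fun_eq_iff complex_norm_square mult.commute del: of_real_power)
    finally have cross: "(\<lambda>j. P i j * Re (cnj c * f j)) sums (cmod c)\<^sup>2"
      by (simp add: mult.left_commute[of "cnj c"] del: of_real_power)
    have eq: "P i j * (cmod (f j - c))\<^sup>2 = P i j * (cmod (f j))\<^sup>2 - 2 * (P i j * Re (cnj c * f j)) + P i j * (cmod c)\<^sup>2" for j
      by (simp add: cmod_power2 power2_diff) (simp add: algebra_simps)
    have "(\<lambda>j. P i j * (cmod (f j - c))\<^sup>2) sums (q i - 2 * (cmod c)\<^sup>2 + 1 * (cmod c)\<^sup>2)"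
      unfolding eq by (intro sums_add sums_diff sums_mult sums_mult2 q_sums cross P_sums)
    then show ?thesis by (simp add: c_def norm_mult power_mult_distrib)
  qed
  define v where "v i = q i - (cmod z)\<^sup>2 * (cmod (f i))\<^sup>2" for i
  have v_nonneg: "0 \<le> v i" for i
    using sums_le[OF _ sums_zero var[of i]] P_nonneg by (simp add: v_def)
  have "(\<lambda>i. q i * \<pi> i - (cmod z)\<^sup>2 * ((cmod (f i))\<^sup>2 * \<pi> i)) sums (E - (cmod z)\<^sup>2 * E)"
    by (intro sums_diff sums_mult qE E_sums)
  then have v_sums: "(\<lambda>i. v i * \<pi> i) sums (E - (cmod z)\<^sup>2 * E)"
    by (simp add: v_def algebra_simps)
  have "1 * E \<le> (cmod z)\<^sup>2 * E" using z E_nonneg by (intro mult_right_mono) auto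
  then have "(\<Sum>i. v i * \<pi> i) \<le> 0" using v_sums by (simp add: sums_iff)
  moreover have "0 \<le> (\<Sum>i. v i * \<pi> i)"
    using v_nonneg \<pi>_nonneg by (intro suminf_nonneg sums_summable[OF v_sums]) simp
  ultimately have "(\<Sum>i. v i * \<pi> i) = 0" by simp
  then have "v i * \<pi> i = 0"
    using suminf_eq_zero_iff[of "\<lambda>i. v i * \<pi> i"] v_sums v_nonneg \<pi>_nonneg by (auto simp: sums_iff)
  then have "v i = 0" using \<pi>_pos[of i] by simp
  then have "(\<lambda>j. P i j * (cmod (f j - z * f i))\<^sup>2) sums 0" using var[of i] by (simp add: v_def)
  then have "P i j * (cmod (f j - z * f i))\<^sup>2 = 0"
    using suminf_eq_zero_iff[of "\<lambda>j. P i j * (cmod (f j - z * f i))\<^sup>2"] P_nonneg by (auto simp: sums_iff)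
  then show ?thesis using \<open>0 < P i j\<close> by simp
qed

text \<open>
  Along a path of length \<open>n\<close> the function is multiplied by \<open>z\<^sup>n\<close>. Hence \<open>z\<^sup>n = 1\<close> for every
  return time \<open>n\<close> to a point where \<open>f\<close> does not vanish; the order of \<open>z\<close> divides all of them, and
  aperiodicity makes it equal to one.
\<close>
lemma peripheral_eigenfunction_const:
  assumes f: "f \<in> l2_space \<pi>" and ev: "kernel_op P f = (\<lambda>i. z * f i)" and z: "1 \<le> cmod z"
  shows "\<exists>c. f = (\<lambda>_. c)"
proof (cases "\<forall>i. f i = 0")
  case True
  then show ?thesis by (intro exI[of _ 0]) auto
next
  case False
  then obtain i where i: "f i \<noteq> 0" by blast
  have path: "f j = z ^ n * f i" if "0 < n_step P n i j" for n i j
    using that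
  proof (induction n arbitrary: i)
    case 0
    then show ?case by (simp split: if_splits)
  next
    case (Suc n)
    obtain k where k: "0 < P i k" "0 < n_step P n k j" using n_step_SucD[OF Suc.prems] by blast
    then show ?case
      using Suc.IH[OF k(2)] peripheral_eigenfunction_step[OF f ev z k(1)] by simp
  qed
  define R where "R = {n. 1 \<le> n \<and> 0 < n_step P n i i}"
  have R: "z ^ n = 1" "0 < n" if "n \<in> R" for n using path[of n i i] that i by (auto simp: R_def)
  have Gcd: "Gcd R = 1" using aperiodic by (simp add: aperiodic_kernel_def R_def)
  then have "R \<noteq> {}" by auto
  then obtain n0 where n0: "0 < n0" "z ^ n0 = 1" using R by blast
  define d where "d = (LEAST n. 0 < n \<and> z ^ n = 1)"
  have d: "0 < d" "z ^ d = 1"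
    using LeastI[of "\<lambda>n. 0 < n \<and> z ^ n = 1" n0] n0 by (auto simp: d_def)
  have "d dvd n" if "n \<in> R" for n
  proof -
    have "z ^ n = z ^ (n mod d) * (z ^ d) ^ (n div d)"
      by (metis div_mult_mod_eq mult.commute power_add power_mult)
    then have "z ^ (n mod d) = 1" using R(1)[OF that] d(2) by simp
    moreover have "n mod d < d" using d(1) by simp
    ultimately have "n mod d = 0"
      using not_less_Least[of "n mod d" "\<lambda>n. 0 < n \<and> z ^ n = 1"] by (auto simp: d_def)
    then show ?thesis by auto
  qed
  then have "d dvd Gcd R" by (rule Gcd_greatest)
  then have "z = 1" using d Gcd by simp
  have "f j = f i" for j
  proof -
    obtain n where "0 < n_step P n i j" using irreducible by (auto simp: irreducible_kernel_def)
    then show ?thesis using path \<open>z = 1\<close> by simp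
  qed
  then show ?thesis by (intro exI[of _ "f i"]) auto
qed

end

section \<open>The spectral gap in terms of eigenfunctions\<close>

text \<open>
  The rows from \<open>M\<close> on. The rows that are left out form an operator of rank at most \<open>M\<close>.
\<close>
definition tail_op :: "(nat \<Rightarrow> nat \<Rightarrow> real) \<Rightarrow> nat \<Rightarrow> (nat \<Rightarrow> complex) \<Rightarrow> nat \<Rightarrow> complex" where
  "tail_op P M f = (\<lambda>i. if i < M then 0 else kernel_op P f i)"

text \<open>
  Since a nonzero constant is an eigenfunction for the eigenvalue 1 only, this excludes every other
  eigenvalue of modulus above \<open>\<rho>\<close>, and for \<open>\<rho> < 1\<close> it makes the eigenspace of 1 one-dimensional.
\<close>
definition constant_eigenfunctions ::
    "(nat \<Rightarrow> nat \<Rightarrow> real) \<Rightarrow> (nat \<Rightarrow> complex) set \<Rightarrow> real \<Rightarrow> bool" where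
  "constant_eigenfunctions P X \<rho> \<longleftrightarrow>
     (\<forall>f\<in>X. \<forall>z. \<rho> < cmod z \<longrightarrow> kernel_op P f = (\<lambda>i. z * f i) \<longrightarrow> (\<exists>c. f = (\<lambda>_. c)))"

text \<open>
  What the two spaces of the theorem have in common. The number \<open>\<alpha>\<close> bounds the norm that the
  tails of \<open>P\<close> have in the limit. The inequality \<open>coord_le\<close> says that the space embeds into the
  weighted supremum space; together with \<open>sqrt_summable\<close> it makes the values of \<open>P f\<close> and the
  mean of \<open>f\<close> continuous functionals.
\<close>
locale chain_space = markov_chain P \<pi> + seq_banach X nrm
  for P \<pi> X nrm +
  fixes \<alpha> :: real
  assumes sqrt_summable: "summable (\<lambda>i. sqrt (\<pi> i))"
    and coord_le: "f \<in> X \<Longrightarrow> sqrt (\<pi> i) * cmod (f i) \<le> nrm f"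
    and unit_mem: "(\<lambda>i. of_bool (i = l)) \<in> X" and const_mem: "(\<lambda>_. c) \<in> X"
    and \<alpha>: "0 \<le> \<alpha>" "\<alpha> < 1"
    and tail_contraction: "\<alpha> < r \<Longrightarrow>
      \<exists>M0. \<forall>M\<ge>M0. \<forall>f\<in>X. tail_op P M f \<in> X \<and> nrm (tail_op P M f) \<le> r * nrm f"
begin

lemma weight_le: "f \<in> X \<Longrightarrow> cmod (f j) * \<pi> j \<le> nrm f * sqrt (\<pi> j)"
proof -
  assume f: "f \<in> X"
  have "cmod (f j) * \<pi> j = (sqrt (\<pi> j) * cmod (f j)) * sqrt (\<pi> j)"
    using \<pi>_nonneg[of j] by (simp add: mult_ac)
  also have "\<dots> \<le> nrm f * sqrt (\<pi> j)"
    using coord_le[OF f] \<pi>_nonneg[of j] by (intro mult_right_mono) auto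
  finally show ?thesis .
qed

lemma weight_summable: "f \<in> X \<Longrightarrow> summable (\<lambda>j. cmod (f j) * \<pi> j)"
  by (rule summable_comparison_test'[OF summable_mult[OF sqrt_summable], of 0])
     (use weight_le \<pi>_nonneg in auto)

lemma weight_sum_le: "f \<in> X \<Longrightarrow> (\<Sum>j. cmod (f j) * \<pi> j) \<le> nrm f * (\<Sum>j. sqrt (\<pi> j))"
  using suminf_le[OF weight_le weight_summable summable_mult[OF sqrt_summable]]
  by (simp add: suminf_mult[OF sqrt_summable])

lemma kernel_op_eqI: "(\<lambda>j. of_real (P i j) * f j) sums s \<Longrightarrow> kernel_op P f i = s"
  unfolding kernel_op_def by (rule sums_unique[symmetric])

lemma mean_op_eqI: "(\<lambda>j. f j * of_real (\<pi> j)) sums s \<Longrightarrow> mean_op \<pi> f i = s"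
  unfolding mean_op_def by (rule sums_unique[symmetric])

lemma kernel_add:
  assumes "f \<in> X" "g \<in> X"
  shows "kernel_op P (\<lambda>i. f i + g i) i = kernel_op P f i + kernel_op P g i"
  by (intro kernel_op_eqI, unfold distrib_left) (intro sums_add kernel_op_sums weight_summable assms)

lemma kernel_scale:
  assumes "f \<in> X"
  shows "kernel_op P (\<lambda>i. c * f i) i = c * kernel_op P f i"
  by (intro kernel_op_eqI, unfold mult.left_commute[of _ c]) (intro sums_mult kernel_op_sums weight_summable assms)

lemma mean_add:
  assumes "f \<in> X" "g \<in> X"
  shows "mean_op \<pi> (\<lambda>i. f i + g i) i = mean_op \<pi> f i + mean_op \<pi> g i"
  by (intro mean_op_eqI, unfold distrib_right) (intro sums_add mean_op_sums weight_summable assms)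

lemma mean_scale:
  assumes "f \<in> X"
  shows "mean_op \<pi> (\<lambda>i. c * f i) i = c * mean_op \<pi> f i"
  by (intro mean_op_eqI, unfold mult.assoc) (intro sums_mult mean_op_sums weight_summable assms)

lemma kernel_functional: "bounded_functional X nrm (\<lambda>f. kernel_op P f l)"
  unfolding bounded_functional_def
proof (intro conjI ballI allI)
  have "cmod (kernel_op P f l) \<le> (\<Sum>j. sqrt (\<pi> j)) / \<pi> l * nrm f" if f: "f \<in> X" for f
  proof -
    have "cmod (kernel_op P f l) \<le> (\<Sum>j. cmod (f j) * \<pi> j * (1 / \<pi> l))"
      unfolding kernel_op_def
    proof (rule norm_suminf_le)
      show "cmod (of_real (P l j) * f j) \<le> cmod (f j) * \<pi> j * (1 / \<pi> l)" for j
        using mult_right_mono[OF P_le_ratio[of l j], of "cmod (f j)"] P_nonneg[of l j]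
        by (simp add: norm_mult mult_ac)
    qed (intro summable_mult2 weight_summable f)
    also have "\<dots> = (\<Sum>j. cmod (f j) * \<pi> j) * (1 / \<pi> l)"
      by (rule suminf_mult2[symmetric, OF weight_summable[OF f]])
    also have "\<dots> \<le> (nrm f * (\<Sum>j. sqrt (\<pi> j))) * (1 / \<pi> l)"
      using weight_sum_le[OF f] \<pi>_nonneg[of l] by (intro mult_right_mono) auto
    finally show ?thesis by (simp add: mult_ac)
  qed
  then show "\<exists>C. \<forall>f\<in>X. cmod (kernel_op P f l) \<le> C * nrm f" by blast
qed (simp_all add: kernel_add kernel_scale)

lemma mean_functional: "bounded_functional X nrm (\<lambda>f. - mean_op \<pi> f 0)"
  unfolding bounded_functional_def
proof (intro conjI ballI allI)
  have "cmod (- mean_op \<pi> f 0) \<le> (\<Sum>j. sqrt (\<pi> j)) * nrm f" if f: "f \<in> X" for f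
  proof -
    have "cmod (mean_op \<pi> f 0) \<le> (\<Sum>j. cmod (f j) * \<pi> j)"
      unfolding mean_op_def
      by (rule norm_suminf_le[OF _ weight_summable[OF f]]) (simp add: norm_mult \<pi>_nonneg)
    also have "\<dots> \<le> nrm f * (\<Sum>j. sqrt (\<pi> j))" by (rule weight_sum_le[OF f])
    finally show ?thesis by (simp add: mult_ac)
  qed
  then show "\<exists>C. \<forall>f\<in>X. cmod (- mean_op \<pi> f 0) \<le> C * nrm f" by blast
qed (simp_all add: mean_add mean_scale)

lemma mean_op_indep: "mean_op \<pi> f i = mean_op \<pi> f 0"
  by (simp add: mean_op_def)

text \<open>
  \<open>P\<close> minus the mean. Its powers are those of \<open>P\<close> minus the mean (\<open>centred_pow\<close>), so the rate of
  convergence to equilibrium is the growth rate of the powers of a single operator, for which the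
  eigenvalue 1 has disappeared.
\<close>
definition centred_op :: "(nat \<Rightarrow> complex) \<Rightarrow> nat \<Rightarrow> complex" where
  "centred_op f = (\<lambda>i. kernel_op P f i - mean_op \<pi> f i)"

lemma tail_norm_bounded_op:
  assumes "0 < r" and "\<forall>f\<in>X. tail_op P M f \<in> X \<and> nrm (tail_op P M f) \<le> r * nrm f"
  shows "norm_bounded_op X nrm (tail_op P M) r"
proof (unfold_locales)
  show "bounded_op X nrm (tail_op P M)"
    unfolding bounded_op_def using assms(2)
    by (auto simp: tail_op_def kernel_add kernel_scale fun_eq_iff)
qed (use assms in auto)

lemma kernel_perturbation:
  assumes "0 < r" and "\<forall>f\<in>X. tail_op P M f \<in> X \<and> nrm (tail_op P M f) \<le> r * nrm f"
  shows "finite_rank_perturbation X nrm (tail_op P M) r (kernel_op P) M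
    (\<lambda>l f. kernel_op P f l) (\<lambda>l i. of_bool (i = l))"
proof -
  interpret norm_bounded_op X nrm "tail_op P M" r by (rule tail_norm_bounded_op[OF assms])
  show ?thesis
  proof unfold_locales
    fix f assume "f \<in> X"
    show "kernel_op P f = (\<lambda>i. tail_op P M f i + (\<Sum>l<M. kernel_op P f l * of_bool (i = l)))"
    proof
      fix i
      have "(\<Sum>l<M. kernel_op P f l * of_bool (i = l)) = (\<Sum>l<M. if i = l then kernel_op P f l else 0)"
        by (intro sum.cong) auto
      then show "kernel_op P f i = tail_op P M f i + (\<Sum>l<M. kernel_op P f l * of_bool (i = l))"
        by (simp add: tail_op_def)
    qed
  qed (simp_all add: kernel_functional unit_mem)
qed

text \<open>
  The mean contributes one further rank: the functional \<open>- mean_op \<pi> f 0\<close> and the constant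
  vector 1, placed at index \<open>M\<close> behind the first \<open>M\<close> rows of \<open>P\<close>.
\<close>
lemma centred_perturbation:
  assumes "0 < r" and "\<forall>f\<in>X. tail_op P M f \<in> X \<and> nrm (tail_op P M f) \<le> r * nrm f"
  shows "finite_rank_perturbation X nrm (tail_op P M) r centred_op (Suc M)
    (\<lambda>l f. if l < M then kernel_op P f l else - mean_op \<pi> f 0) (\<lambda>l i. if l < M then of_bool (i = l) else 1)"
proof -
  interpret finite_rank_perturbation X nrm "tail_op P M" r "kernel_op P" M
    "\<lambda>l f. kernel_op P f l" "\<lambda>l i. of_bool (i = l)"
    by (rule kernel_perturbation[OF assms])
  show ?thesis
  proof unfold_locales
    fix f assume f: "f \<in> X"
    show "centred_op f = (\<lambda>i. tail_op P M f i + (\<Sum>l<Suc M. (if l < M then kernel_op P f l else - mean_op \<pi> f 0)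
        * (if l < M then of_bool (i = l) else 1)))"
    proof
      fix i
      have "(\<Sum>l<Suc M. (if l < M then kernel_op P f l else - mean_op \<pi> f 0) * (if l < M then of_bool (i = l) else 1))
        = (\<Sum>l<M. kernel_op P f l * of_bool (i = l)) + - mean_op \<pi> f 0"
        unfolding sum.lessThan_Suc by (intro arg_cong2[where f = "(+)"] sum.cong) auto
      moreover have "centred_op f i = kernel_op P f i + - mean_op \<pi> f 0"
        by (simp only: centred_op_def mean_op_indep[of f i] diff_conv_add_uminus)
      moreover note fun_cong[OF T_eq[OF f], of i]
      ultimately show "centred_op f i = tail_op P M f i + (\<Sum>l<Suc M. (if l < M then kernel_op P f l else - mean_op \<pi> f 0)
        * (if l < M then of_bool (i = l) else 1))"
        by (metis add.assoc)
    qed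
  next
    fix l
    show "bounded_functional X nrm (\<lambda>f. if l < M then kernel_op P f l else - mean_op \<pi> f 0)"
      by (cases "l < M") (simp_all add: kernel_functional mean_functional)
    show "(\<lambda>i. if l < M then of_bool (i = l) else 1) \<in> X"
      by (cases "l < M") (simp_all add: unit_mem const_mem)
  qed
qed

lemma kernel_bounded_op: "bounded_op X nrm (kernel_op P)"
proof -
  obtain M where M: "\<forall>f\<in>X. tail_op P M f \<in> X \<and> nrm (tail_op P M f) \<le> 1 * nrm f"
    using tail_contraction[OF \<alpha>(2)] by blast
  interpret finite_rank_perturbation X nrm "tail_op P M" 1 "kernel_op P" M
    "\<lambda>l f. kernel_op P f l" "\<lambda>l i. of_bool (i = l)"
    by (rule kernel_perturbation) (use M in auto)
  show ?thesis by (rule T_bounded)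
qed

lemma kernel_mem: "f \<in> X \<Longrightarrow> kernel_op P f \<in> X"
  using kernel_bounded_op by (auto simp: bounded_op_def)

lemma kernel_pow_mem: "f \<in> X \<Longrightarrow> (kernel_op P ^^ n) f \<in> X"
  by (induction n) (auto simp: kernel_mem)

lemma mean_mem: "mean_op \<pi> f \<in> X"
  using const_mem[of "mean_op \<pi> f 0"] by (simp add: mean_op_def)

lemma mean_kernel: "f \<in> X \<Longrightarrow> mean_op \<pi> (kernel_op P f) = mean_op \<pi> f"
  by (rule ext) (intro mean_op_eqI stationary_sums weight_summable)

lemma mean_kernel_pow: "f \<in> X \<Longrightarrow> mean_op \<pi> ((kernel_op P ^^ n) f) = mean_op \<pi> f"
  by (induction n) (simp_all add: mean_kernel kernel_pow_mem)

theorem ess_spectral_radius_le: "ess_spectral_radius X nrm (kernel_op P) \<le> ereal \<alpha>"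
proof (rule ereal_le_epsilon2)
  fix \<epsilon> :: real assume "0 < \<epsilon>"
  define r where "r = \<alpha> + \<epsilon>"
  have r: "\<alpha> < r" "0 < r" using \<open>0 < \<epsilon>\<close> \<alpha> by (auto simp: r_def)
  obtain M where M: "\<forall>f\<in>X. tail_op P M f \<in> X \<and> nrm (tail_op P M f) \<le> r * nrm f"
    using tail_contraction[OF r(1)] by blast
  interpret finite_rank_perturbation X nrm "tail_op P M" r "kernel_op P" M
    "\<lambda>l f. kernel_op P f l" "\<lambda>l i. of_bool (i = l)"
    by (rule kernel_perturbation[OF r(2) M])
  have "ess_spectral_radius X nrm (kernel_op P) \<le> ereal r"
    unfolding ess_spectral_radius_def
    using r discrete_spectrum_outside by (intro Inf_lower) (auto intro!: exI[of _ r])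
  then show "ess_spectral_radius X nrm (kernel_op P) \<le> ereal \<alpha> + ereal \<epsilon>" by (simp add: r_def)
qed

lemma centred_pow:
  assumes f: "f \<in> X"
  shows "(centred_op ^^ Suc n) f = (\<lambda>i. (kernel_op P ^^ Suc n) f i - mean_op \<pi> f i)"
proof (induction n)
  case 0
  then show ?case by (simp add: centred_op_def)
next
  case (Suc n)
  define g where "g = (kernel_op P ^^ Suc n) f"
  have g: "g \<in> X" "mean_op \<pi> g = mean_op \<pi> f"
    unfolding g_def using f by (rule kernel_pow_mem, intro mean_kernel_pow f)
  define c where "c = mean_op \<pi> f 0"
  have mean: "mean_op \<pi> f = (\<lambda>_. c)" by (simp add: c_def mean_op_def)
  have "(centred_op ^^ Suc (Suc n)) f = centred_op (\<lambda>i. g i + (-1) * c)"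
    using Suc by (simp add: g_def mean)
  also have "\<dots> = (\<lambda>i. kernel_op P g i - c)"
  proof
    fix i
    have "kernel_op P (\<lambda>i. g i + (-1) * c) i = kernel_op P g i - c"
      using kernel_add[OF g(1) const_mem, of "(-1) * c" i] by (simp add: kernel_op_const)
    moreover have "mean_op \<pi> (\<lambda>i. g i + (-1) * c) i = 0"
      using mean_add[OF g(1) const_mem, of "(-1) * c" i] by (simp add: mean_op_const g(2) mean)
    ultimately show "centred_op (\<lambda>i. g i + (-1) * c) i = kernel_op P g i - c" by (simp add: centred_op_def)
  qed
  finally show ?case by (simp add: g_def mean)
qed

lemma eigenfunction_mean_zero:
  assumes "f \<in> X" "kernel_op P f = (\<lambda>i. z * f i)" "z \<noteq> 1"
  shows "mean_op \<pi> f = (\<lambda>_. 0)"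
proof
  fix i
  have "z * mean_op \<pi> f i = mean_op \<pi> f i"
    using mean_scale[OF assms(1), of z i] mean_kernel[OF assms(1)] assms(2) by simp
  with \<open>z \<noteq> 1\<close> show "mean_op \<pi> f i = 0" by simp
qed

text \<open>
  An eigenfunction of the centred operator for \<open>z \<noteq> 0\<close> has mean zero, because the centred operator
  takes values of mean zero. So it is an eigenfunction of \<open>P\<close>, and if it is constant it vanishes.
\<close>
lemma centred_no_eigenvalue:
  assumes z0: "z \<noteq> 0"
    and const: "\<And>f. f \<in> X \<Longrightarrow> kernel_op P f = (\<lambda>i. z * f i) \<Longrightarrow> \<exists>c. f = (\<lambda>_. c)"
  shows "\<not> op_eigenvalue X centred_op z"
proof
  assume "op_eigenvalue X centred_op z"
  then obtain f where f: "f \<in> X" "f \<noteq> (\<lambda>_. 0)" "centred_op f = (\<lambda>i. z * f i)"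
    unfolding op_eigenvalue_def by blast
  have mean: "mean_op \<pi> f = (\<lambda>_. 0)"
  proof
    fix i
    define c where "c = mean_op \<pi> f 0"
    have m: "mean_op \<pi> f = (\<lambda>_. c)" by (simp add: c_def mean_op_def)
    have "z * mean_op \<pi> f i = mean_op \<pi> (centred_op f) i"
      using f(3) mean_scale[OF f(1), of z i] by simp
    also have "centred_op f = (\<lambda>i. kernel_op P f i + (-1) * c)" by (simp add: centred_op_def m)
    also have "mean_op \<pi> \<dots> i = 0"
      using mean_add[OF kernel_mem[OF f(1)] const_mem, of "(-1) * c" i]
      by (simp add: mean_op_const mean_kernel[OF f(1)] m)
    finally show "mean_op \<pi> f i = 0" using z0 by simp
  qed
  have "kernel_op P f = (\<lambda>i. z * f i)" using f(3) mean by (simp add: centred_op_def)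
  then obtain c where "f = (\<lambda>_. c)"
    using const f(1) by blast
  then show False using mean f(2) by (simp add: mean_op_const)
qed

lemma gap_rateI:
  assumes "\<alpha> \<le> \<rho>0" "\<rho>0 < \<rho>" "\<rho> < 1" "constant_eigenfunctions P X \<rho>0"
  shows "\<rho> \<in> gap_rates X nrm P \<pi>"
proof -
  define r where "r = (\<rho>0 + \<rho>) / 2"
  have r: "\<alpha> < r" "0 < r" "\<rho>0 < r" "r < \<rho>" using assms \<alpha> by (auto simp: r_def)
  obtain M where M: "\<forall>f\<in>X. tail_op P M f \<in> X \<and> nrm (tail_op P M f) \<le> r * nrm f"
    using tail_contraction[OF r(1)] by blast
  interpret Q: finite_rank_perturbation X nrm "tail_op P M" r centred_op "Suc M"
    "\<lambda>l f. if l < M then kernel_op P f l else - mean_op \<pi> f 0" "\<lambda>l i. if l < M then of_bool (i = l) else 1"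
    by (rule centred_perturbation[OF r(2) M])
  have "\<not> op_eigenvalue X centred_op z" if "r < cmod z" for z
  proof (rule centred_no_eigenvalue)
    show "\<exists>c. f = (\<lambda>_. c)" if "f \<in> X" "kernel_op P f = (\<lambda>i. z * f i)" for f
    proof -
      have "\<rho>0 < cmod z" using \<open>r < cmod z\<close> r by simp
      then show ?thesis using assms(4) that unfolding constant_eigenfunctions_def by blast
    qed
  qed (use that r in auto)
  then obtain C where C: "C > 0" "\<And>f n. f \<in> X \<Longrightarrow> nrm ((centred_op ^^ n) f) \<le> C * \<rho> ^ n * nrm f"
    using Q.power_growth[of r \<rho>] r by blast
  have "(\<lambda>i. (kernel_op P ^^ n) f i - mean_op \<pi> f i) \<in> X \<and>
      nrm (\<lambda>i. (kernel_op P ^^ n) f i - mean_op \<pi> f i) \<le> C * \<rho> ^ n * nrm f" if "n \<ge> 1" "f \<in> X" for n f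
  proof -
    obtain k where "n = Suc k" using \<open>n \<ge> 1\<close> by (cases n) auto
    then show ?thesis
      using C(2)[OF \<open>f \<in> X\<close>, of n] centred_pow[OF \<open>f \<in> X\<close>, of k]
        diff_mem[OF kernel_pow_mem[OF \<open>f \<in> X\<close>, of n] mean_mem[of f]]
      by simp
  qed
  then show ?thesis
    unfolding gap_rates_def using C(1) r assms by auto
qed

text \<open>
  On an eigenfunction the distance to equilibrium after \<open>n\<close> steps is exactly \<open>|z|\<^sup>n\<close> times that of \<open>f\<close> itself; a
  rate below \<open>|z|\<close> leaves only the equilibrium.
\<close>
lemma gap_rateD:
  assumes \<rho>: "\<rho> \<in> gap_rates X nrm P \<pi>"
  shows "constant_eigenfunctions P X \<rho>"
  unfolding constant_eigenfunctions_def
proof (intro ballI allI impI)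
  fix f z assume f: "f \<in> X" and z: "\<rho> < cmod z" and ev: "kernel_op P f = (\<lambda>i. z * f i)"
  have pow: "(kernel_op P ^^ n) f = (\<lambda>i. z ^ n * f i)" for n
  proof (induction n)
    case (Suc n)
    have "(kernel_op P ^^ Suc n) f = kernel_op P (\<lambda>i. z ^ n * f i)" by (simp add: Suc)
    also have "\<dots> = (\<lambda>i. z ^ n * kernel_op P f i)" by (rule ext) (rule kernel_scale[OF f])
    finally show ?case by (simp add: ev mult_ac)
  qed simp
  obtain C where C: "0 < \<rho>" "C > 0"
    "\<And>n. n \<ge> 1 \<Longrightarrow> nrm (\<lambda>i. (kernel_op P ^^ n) f i - mean_op \<pi> f i) \<le> C * \<rho> ^ n * nrm f"
    using \<rho> f unfolding gap_rates_def by auto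
  define g where "g = (\<lambda>i. f i - mean_op \<pi> f i)"
  have g: "g \<in> X" unfolding g_def using f mean_mem by (rule diff_mem)
  have "(\<lambda>i. (kernel_op P ^^ n) f i - mean_op \<pi> f i) = (\<lambda>i. z ^ n * g i)" for n
  proof (cases "z = 1")
    case False
    then show ?thesis using eigenfunction_mean_zero[OF f ev] by (simp add: g_def pow)
  qed (simp add: g_def pow)
  then have bound: "cmod z ^ n * nrm g \<le> C * \<rho> ^ n * nrm f" if "n \<ge> 1" for n
    using C(3)[OF that] nrm_scale[OF g, of "z ^ n"] by (simp add: norm_power)
  have "0 < cmod z" using z C(1) by linarith
  then have q: "0 \<le> \<rho> / cmod z" "\<rho> / cmod z < 1" using z C(1) by auto
  have "(\<lambda>n. C * nrm f * (\<rho> / cmod z) ^ n) \<longlonglongrightarrow> C * nrm f * 0"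
    using q by (intro tendsto_intros LIMSEQ_realpow_zero)
  moreover have "nrm g \<le> C * nrm f * (\<rho> / cmod z) ^ n" if "n \<ge> 1" for n
    using bound[OF that] \<open>0 < cmod z\<close> by (simp add: power_divide pos_le_divide_eq mult_ac)
  ultimately have "nrm g \<le> 0"
    by (intro LIMSEQ_le_const[of _ _ "nrm g"]) auto
  then have "g = (\<lambda>_. 0)" using nrm_eq_0D[OF g] by simp
  then have "f i - mean_op \<pi> f 0 = 0" for i
    using mean_op_indep[of f i] unfolding g_def by metis
  then have "f i = mean_op \<pi> f 0" for i
    unfolding eq_iff_diff_eq_0[of "f i"] .
  then show "\<exists>c. f = (\<lambda>_. c)" by blast
qed

lemma spectral_gapI:
  assumes per: "\<And>f z. f \<in> X \<Longrightarrow> 1 \<le> cmod z \<Longrightarrow> kernel_op P f = (\<lambda>i. z * f i) \<Longrightarrow> \<exists>c. f = (\<lambda>_. c)"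
  shows "spectral_gap X nrm P \<pi>"
proof -
  define r where "r = (\<alpha> + 1) / 2"
  have r: "\<alpha> < r" "0 < r" "r < 1" using \<alpha> by (auto simp: r_def)
  obtain M where M: "\<forall>f\<in>X. tail_op P M f \<in> X \<and> nrm (tail_op P M f) \<le> r * nrm f"
    using tail_contraction[OF r(1)] by blast
  interpret Q: finite_rank_perturbation X nrm "tail_op P M" r centred_op "Suc M"
    "\<lambda>l f. if l < M then kernel_op P f l else - mean_op \<pi> f 0" "\<lambda>l i. if l < M then of_bool (i = l) else 1"
    by (rule centred_perturbation[OF r(2) M])
  have "\<not> op_eigenvalue X centred_op z" if "1 \<le> cmod z" for z
    by (rule centred_no_eigenvalue) (use that per in auto)
  then obtain \<rho>0 where \<rho>0: "r < \<rho>0" "\<rho>0 < 1" "\<And>z. \<rho>0 < cmod z \<Longrightarrow> \<not> op_eigenvalue X centred_op z"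
    using Q.eigenvalue_gap[OF r(3)] by metis
  have "constant_eigenfunctions P X \<rho>0"
    unfolding constant_eigenfunctions_def
  proof (intro ballI allI impI)
    fix f z assume f: "f \<in> X" and z: "\<rho>0 < cmod z" and ev: "kernel_op P f = (\<lambda>i. z * f i)"
    show "\<exists>c. f = (\<lambda>_. c)"
    proof (cases "z = 1")
      case True
      then show ?thesis using per[OF f _ ev] by simp
    next
      case False
      then have "centred_op f = (\<lambda>i. z * f i)"
        using ev eigenfunction_mean_zero[OF f ev] by (simp add: centred_op_def)
      then have "f = (\<lambda>_. 0)" using \<rho>0(3)[OF z] f unfolding op_eigenvalue_def by blast
      then show ?thesis by blast
    qed
  qed
  then have "(\<rho>0 + 1) / 2 \<in> gap_rates X nrm P \<pi>"
    using \<rho>0 r by (intro gap_rateI[of \<rho>0]) auto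
  then show ?thesis unfolding spectral_gap_def by blast
qed

text \<open>
  Outside the disc of radius \<open>\<alpha>\<close> the spectrum consists of eigenvalues, so that the
  eigenfunctions alone decide how fast the powers converge.
\<close>
lemma gap_rate_le_iff:
  assumes "spectral_gap X nrm P \<pi>" "\<alpha> \<le> \<rho>" "\<rho> < 1"
  shows "gap_rate X nrm P \<pi> \<le> \<rho> \<longleftrightarrow> constant_eigenfunctions P X \<rho>"
proof
  have bdd: "bdd_below (gap_rates X nrm P \<pi>)" unfolding gap_rates_def by (rule bdd_belowI[of _ 0]) auto
  {
    assume H: "constant_eigenfunctions P X \<rho>"
    show "gap_rate X nrm P \<pi> \<le> \<rho>"
    proof (rule field_le_epsilon)
      fix \<epsilon> :: real assume "\<epsilon> > 0"
      define s where "s = min (\<rho> + \<epsilon>) ((\<rho> + 1) / 2)"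
      have s: "\<rho> < s" "s < 1" "s \<le> \<rho> + \<epsilon>" using \<open>\<epsilon> > 0\<close> assms by (auto simp: s_def min_def)
      have "gap_rate X nrm P \<pi> \<le> s"
        unfolding gap_rate_def using gap_rateI[OF assms(2) s(1,2) H] bdd by (rule cInf_lower)
      with s(3) show "gap_rate X nrm P \<pi> \<le> \<rho> + \<epsilon>" by simp
    qed
  next
    assume le: "gap_rate X nrm P \<pi> \<le> \<rho>"
    show "constant_eigenfunctions P X \<rho>"
      unfolding constant_eigenfunctions_def
    proof (intro ballI allI impI)
      fix f z assume f: "f \<in> X" "\<rho> < cmod z" "kernel_op P f = (\<lambda>i. z * f i)"
      have "\<exists>s\<in>gap_rates X nrm P \<pi>. s < cmod z"
        using cInf_less_iff[of "gap_rates X nrm P \<pi>" "cmod z"] le f(2) assms(1) bdd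
        unfolding gap_rate_def spectral_gap_def by auto
      then show "\<exists>c. f = (\<lambda>_. c)"
        using gap_rateD f unfolding constant_eigenfunctions_def by blast
    qed
  }
qed

end

text \<open>
  An eigenfunction satisfies \<open>z f - A f = K f\<close>, where \<open>A\<close> is a tail of \<open>P\<close> and \<open>K f\<close> has finite
  support. The Neumann series of the finitely supported \<open>K f\<close> is the same sequence in both
  spaces, and it belongs to the smaller one.
\<close>
lemma eigenfunction_transfer:
  assumes "chain_space P \<pi> X nrmX \<alpha>" "chain_space P \<pi> Y nrmY \<alpha>" "X \<subseteq> Y"
    and f: "f \<in> Y" and z: "\<alpha> < cmod z" and ev: "kernel_op P f = (\<lambda>i. z * f i)"
  shows "f \<in> X"
proof -
  interpret X: chain_space P \<pi> X nrmX \<alpha> by (rule assms(1))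
  interpret Y: chain_space P \<pi> Y nrmY \<alpha> by (rule assms(2))
  define r where "r = (\<alpha> + cmod z) / 2"
  have r: "\<alpha> < r" "0 < r" "r < cmod z" using z X.\<alpha>(1) by (simp_all add: r_def)
  obtain M1 where M1: "\<forall>M\<ge>M1. \<forall>f\<in>X. tail_op P M f \<in> X \<and> nrmX (tail_op P M f) \<le> r * nrmX f"
    using X.tail_contraction[OF r(1)] ..
  obtain M2 where M2: "\<forall>M\<ge>M2. \<forall>f\<in>Y. tail_op P M f \<in> Y \<and> nrmY (tail_op P M f) \<le> r * nrmY f"
    using Y.tail_contraction[OF r(1)] ..
  define M where "M = max M1 M2"
  interpret XA: norm_bounded_op X nrmX "tail_op P M" r
    by (rule X.tail_norm_bounded_op[OF r(2)]) (use M1 in \<open>simp add: M_def\<close>)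
  interpret YA: norm_bounded_op Y nrmY "tail_op P M" r
    by (rule Y.tail_norm_bounded_op[OF r(2)]) (use M2 in \<open>simp add: M_def\<close>)
  define h :: "nat \<Rightarrow> complex" where "h = (\<lambda>i. \<Sum>l<M. kernel_op P f l * of_bool (i = l))"
  have hX: "h \<in> X" unfolding h_def by (rule X.lincomb_mem) (auto simp: X.unit_mem)
  have "f = neumann (tail_op P M) z h"
  proof (rule YA.neumann_unique[OF r(3) f])
    fix i
    have "h i = (\<Sum>l<M. if i = l then kernel_op P f l else 0)"
      unfolding h_def by (intro sum.cong) auto
    then show "z * f i - tail_op P M f i = h i" by (simp add: tail_op_def ev)
  qed (use hX assms(3) in auto)
  also have "\<dots> \<in> X" by (rule XA.neumann_mem[OF r(3) hX])
  finally show ?thesis .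
qed

section \<open>Banded chains with asymptotically homogeneous rows\<close>

locale banded_chain = markov_chain +
  fixes N i0 :: nat and a :: "int \<Rightarrow> real" and \<tau> :: real
  assumes band: "i0 \<le> i \<Longrightarrow> int N < \<bar>int i - int j\<bar> \<Longrightarrow> P i j = 0"
    and a_range: "m \<in> {- int N..int N} \<Longrightarrow> a m \<in> {0..1}"
    and a_lim: "m \<in> {- int N..int N} \<Longrightarrow> (\<lambda>i. P i (nat (int i + m))) \<longlonglongrightarrow> a m"
    and \<tau>: "\<tau> \<in> {0..<1}" and \<tau>_lim: "(\<lambda>i. \<pi> (Suc i) / \<pi> i) \<longlonglongrightarrow> \<tau>"
    and drift: "(\<Sum>k = - int N..int N. of_int k * a k) < 0"
begin

lemma ratio_power_lim: "(\<lambda>i. \<pi> (i + k) / \<pi> i) \<longlonglongrightarrow> \<tau> ^ k"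
proof (induction k)
  case 0
  have "\<pi> i \<noteq> 0" for i using \<pi>_pos[of i] by simp
  then show ?case by simp
next
  case (Suc k)
  have "(\<lambda>i. \<pi> (Suc (i + k)) / \<pi> (i + k) * (\<pi> (i + k) / \<pi> i)) \<longlonglongrightarrow> \<tau> * \<tau> ^ k"
    by (intro tendsto_mult Suc LIMSEQ_ignore_initial_segment[OF \<tau>_lim])
  moreover have "\<pi> (Suc (i + k)) / \<pi> (i + k) * (\<pi> (i + k) / \<pi> i) = \<pi> (i + Suc k) / \<pi> i" for i
    using \<pi>_pos[of "i + k"] by simp
  ultimately show ?case by (simp only: power_Suc)
qed

lemma ratio_lim:
  assumes "0 < \<tau>"
  shows "(\<lambda>i. \<pi> (nat (int i + m)) / \<pi> i) \<longlonglongrightarrow> \<tau> powr of_int m"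
proof (cases "m \<ge> 0")
  case True
  then have "nat (int i + m) = i + nat m" for i by simp
  moreover have "\<tau> powr of_int m = \<tau> ^ nat m"
    using True assms by (simp add: powr_realpow[symmetric])
  ultimately show ?thesis using ratio_power_lim[of "nat m"] by simp
next
  case False
  define k where "k = nat (- m)"
  have m: "m = - int k" using False by (simp add: k_def)
  have "(\<lambda>j. inverse (\<pi> (j + k) / \<pi> j)) \<longlonglongrightarrow> inverse (\<tau> ^ k)"
    using assms by (intro tendsto_inverse ratio_power_lim) simp
  moreover have "inverse (\<tau> ^ k) = \<tau> powr of_int m"
    using assms by (simp add: m powr_minus powr_realpow)
  ultimately have "(\<lambda>j. \<pi> (nat (int (j + k) + m)) / \<pi> (j + k)) \<longlonglongrightarrow> \<tau> powr of_int m"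
    by (simp add: m)
  then show ?thesis by (rule LIMSEQ_offset)
qed

text \<open>
  The entry at \<open>(i, i + m)\<close> of \<open>P\<close> after conjugation with the square root of \<open>\<pi>\<close>
  (\<open>edge_weight_eq\<close>). This conjugation turns both weighted spaces into unweighted ones.
\<close>
definition edge_weight :: "int \<Rightarrow> nat \<Rightarrow> real" where
  "edge_weight m i = sqrt (P i (nat (int i + m)) * adjoint_kernel \<pi> P (nat (int i + m)) i)"

lemma edge_weight_eq:
  "edge_weight m i = P i (nat (int i + m)) * sqrt (\<pi> i / \<pi> (nat (int i + m)))"
proof -
  have "P i j * adjoint_kernel \<pi> P j i = (P i j)\<^sup>2 * (\<pi> i / \<pi> j)" for j
    by (simp add: adjoint_kernel_def power2_eq_square)
  then show ?thesis using P_nonneg unfolding edge_weight_def by (simp only: real_sqrt_mult real_sqrt_abs abs_of_nonneg)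
qed

definition edge_limit :: "int \<Rightarrow> real" where
  "edge_limit m = (if \<tau> = 0 then (if m = 0 then a 0 else 0) else a m * \<tau> powr (- of_int m / 2))"

text \<open>
  If \<open>\<tau> = 0\<close> and \<open>m > 0\<close>, the ratio of the stationary weights diverges. The stationarity bound
  \<open>P i (i + m) \<le> \<pi> (i + m) / \<pi> i\<close> compensates: the product is at most the square root of a
  quantity that tends to zero.
\<close>
lemma edge_weight_lim:
  assumes m: "m \<in> {- int N..int N}"
  shows "edge_weight m \<longlonglongrightarrow> edge_limit m"
proof -
  consider (pos) "0 < \<tau>" | (diag) "\<tau> = 0" "m = 0" | (down) "\<tau> = 0" "m < 0" | (up) "\<tau> = 0" "m > 0"
    using \<tau> by force
  then show ?thesis
  proof cases
    case pos
    have "(\<lambda>i. inverse (\<pi> (nat (int i + m)) / \<pi> i)) \<longlonglongrightarrow> inverse (\<tau> powr of_int m)"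
      using pos by (intro tendsto_inverse ratio_lim) auto
    then have "(\<lambda>i. \<pi> i / \<pi> (nat (int i + m))) \<longlonglongrightarrow> \<tau> powr - of_int m"
      by (simp add: powr_minus)
    then have "edge_weight m \<longlonglongrightarrow> a m * sqrt (\<tau> powr - of_int m)"
      unfolding edge_weight_eq[abs_def] by (intro tendsto_mult a_lim m tendsto_real_sqrt)
    also have "sqrt (\<tau> powr - of_int m) = \<tau> powr (- of_int m / 2)"
      using pos by (simp add: powr_half_sqrt[symmetric] powr_powr)
    finally show ?thesis using pos by (simp add: edge_limit_def)
  next
    case diag
    have "edge_weight m = (\<lambda>i. P i (nat (int i + m)))"
      using \<pi>_pos by (auto simp: edge_weight_eq diag fun_eq_iff less_imp_neq[symmetric])
    then show ?thesis unfolding edge_limit_def using a_lim[OF m] diag by simp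
  next
    case down
    define k where "k = nat (- m)"
    have k: "m = - int k" "0 < k" using down by (auto simp: k_def)
    have "(\<lambda>j. P (j + k) (nat (int (j + k) + m)) * sqrt (\<pi> (j + k) / \<pi> j)) \<longlonglongrightarrow> a m * sqrt (\<tau> ^ k)"
      by (intro tendsto_mult tendsto_real_sqrt ratio_power_lim LIMSEQ_ignore_initial_segment[OF a_lim[OF m]])
    then have "(\<lambda>j. edge_weight m (j + k)) \<longlonglongrightarrow> 0"
      using down k by (simp add: edge_weight_eq zero_power)
    then have "edge_weight m \<longlonglongrightarrow> 0" by (rule LIMSEQ_offset)
    then show ?thesis unfolding edge_limit_def using down by simp
  next
    case up
    define k where "k = nat m"
    have k: "nat (int i + m) = i + k" "0 < k" for i using up by (auto simp: k_def)
    have "(\<lambda>i. sqrt (\<pi> (i + k) / \<pi> i)) \<longlonglongrightarrow> sqrt (\<tau> ^ k)"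
      by (intro tendsto_real_sqrt ratio_power_lim)
    then have lim: "(\<lambda>i. sqrt (\<pi> (i + k) / \<pi> i)) \<longlonglongrightarrow> 0" using up k by (simp add: zero_power)
    have "edge_weight m \<longlonglongrightarrow> 0"
    proof (rule tendsto_sandwich[OF _ _ tendsto_const lim])
      show "\<forall>\<^sub>F i in sequentially. 0 \<le> edge_weight m i"
        using P_nonneg \<pi>_nonneg by (simp add: edge_weight_eq)
      have "edge_weight m i \<le> sqrt (\<pi> (i + k) / \<pi> i)" for i
      proof -
        define x where "x = \<pi> (i + k) / \<pi> i"
        have x: "0 < x" using \<pi>_pos by (simp add: x_def)
        have "edge_weight m i \<le> x * sqrt (inverse x)"
          unfolding edge_weight_eq k(1) x_def inverse_divide
          using P_le_ratio \<pi>_nonneg by (intro mult_right_mono) auto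
        also have "x * sqrt (inverse x) = x / sqrt x" by (simp only: real_sqrt_inverse divide_inverse)
        also have "\<dots> = sqrt x" using x by (intro real_div_sqrt) simp
        finally show ?thesis by (simp add: x_def)
      qed
      then show "\<forall>\<^sub>F i in sequentially. edge_weight m i \<le> sqrt (\<pi> (i + k) / \<pi> i)" by simp
    qed
    then show ?thesis unfolding edge_limit_def using up by simp
  qed
qed

definition \<alpha> :: real where "\<alpha> = (\<Sum>m = - int N..int N. edge_limit m)"

lemma \<alpha>_eq: "\<alpha> = (if \<tau> = 0 then a 0 else (\<Sum>m = - int N..int N. a m * \<tau> powr (- of_int m / 2)))"
  by (simp add: \<alpha>_def edge_limit_def sum.delta)

lemma alpha0_eq: "alpha0 P \<pi> N = ereal \<alpha>"
proof -
  have "limsup (\<lambda>i. ereal (edge_weight m i)) = ereal (edge_limit m)" if "m \<in> {- int N..int N}" for m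
    by (intro lim_imp_Limsup) (use edge_weight_lim[OF that] in auto)
  then have "alpha0 P \<pi> N = (\<Sum>m = - int N..int N. ereal (edge_limit m))"
    unfolding alpha0_def edge_weight_def by (intro sum.cong) auto
  then show ?thesis by (simp add: \<alpha>_def)
qed

lemma edge_limit_nonneg: "m \<in> {- int N..int N} \<Longrightarrow> 0 \<le> edge_limit m"
  using a_range[of m] a_range[of 0] by (auto simp: edge_limit_def)

lemma \<alpha>_nonneg: "0 \<le> \<alpha>"
  unfolding \<alpha>_def by (intro sum_nonneg edge_limit_nonneg)

lemma band_sums:
  assumes "i0 \<le> i" "N \<le> i"
  shows "(\<lambda>j. of_real (P i j) * f j) sums
    (\<Sum>m = - int N..int N. of_real (P i (nat (int i + m))) * (f (nat (int i + m)) :: complex))"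
proof -
  define g where "g m = nat (int i + m)" for m
  have inj: "inj_on g {- int N..int N}" using assms by (auto simp: inj_on_def g_def)
  have "(\<lambda>j. of_real (P i j) * f j) sums (\<Sum>j\<in>g ` {- int N..int N}. of_real (P i j) * f j)"
  proof (rule sums_finite)
    fix j assume j: "j \<notin> g ` {- int N..int N}"
    have "int N < \<bar>int i - int j\<bar>"
    proof (rule ccontr)
      assume "\<not> int N < \<bar>int i - int j\<bar>"
      then have "int j - int i \<in> {- int N..int N}" "j = g (int j - int i)" by (auto simp: g_def)
      with j show False by blast
    qed
    then show "of_real (P i j) * f j = 0" using band assms by simp
  qed simp
  then show ?thesis unfolding sum.reindex[OF inj] o_def g_def .
qed

lemma sum_a: "(\<Sum>m = - int N..int N. a m) = 1"
proof (rule LIMSEQ_unique)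
  show "(\<lambda>i. \<Sum>m = - int N..int N. P i (nat (int i + m))) \<longlonglongrightarrow> (\<Sum>m = - int N..int N. a m)"
    by (intro tendsto_sum a_lim)
  have "(\<Sum>m = - int N..int N. P i (nat (int i + m))) = 1" if "max i0 N \<le> i" for i
  proof -
    have "(\<lambda>j. complex_of_real (P i j) * 1) sums of_real (\<Sum>m = - int N..int N. P i (nat (int i + m)))"
      using band_sums[of i "\<lambda>_. 1"] that by simp
    then have "(\<lambda>j. complex_of_real (P i j)) sums of_real (\<Sum>m = - int N..int N. P i (nat (int i + m)))" by simp
    then have "P i sums (\<Sum>m = - int N..int N. P i (nat (int i + m)))" by (simp only: sums_of_real_iff)
    with P_sums[of i] show ?thesis by (rule sums_unique2[symmetric])
  qed
  then have "\<forall>\<^sub>F i in sequentially. (\<Sum>m = - int N..int N. P i (nat (int i + m))) = 1"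
    unfolding eventually_sequentially by blast
  then show "(\<lambda>i. \<Sum>m = - int N..int N. P i (nat (int i + m))) \<longlonglongrightarrow> 1"
    by (rule tendsto_eventually)
qed

text \<open>
  The limit of the invariance equation at \<open>j\<close>, divided by \<open>\<pi> j\<close>. Only an inequality survives,
  since the exceptional rows below \<open>i0\<close> may contribute to every column.
\<close>
lemma sum_a_tilted:
  assumes "0 < \<tau>"
  shows "(\<Sum>m = - int N..int N. a m * \<tau> powr - of_int m) \<le> 1"
proof (rule LIMSEQ_le_const2)
  have shift: "filterlim (\<lambda>j. nat (int j + m)) sequentially sequentially" for m
    unfolding filterlim_sequentially_iff_filterlim_real
  proof (rule filterlim_at_top_mono)
    show "filterlim (\<lambda>j. real j + real_of_int m) at_top sequentially" by real_asymp
    show "\<forall>\<^sub>F j in sequentially. real j + real_of_int m \<le> real (nat (int j + m))"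
      by (rule always_eventually) auto
  qed
  show "(\<lambda>j. \<Sum>m = - int N..int N. P (nat (int j + - m)) (nat (int (nat (int j + - m)) + m)) * (\<pi> (nat (int j + - m)) / \<pi> j))
    \<longlonglongrightarrow> (\<Sum>m = - int N..int N. a m * \<tau> powr - of_int m)"
    using ratio_lim[OF assms, of "- _"]
    by (intro tendsto_sum tendsto_mult filterlim_compose[OF a_lim shift]) auto
  have "(\<Sum>m = - int N..int N. P (nat (int j + - m)) (nat (int (nat (int j + - m)) + m)) * (\<pi> (nat (int j + - m)) / \<pi> j)) \<le> 1"
    if j: "N \<le> j" for j
  proof -
    define g where "g m = nat (int j - m)" for m
    have inj: "inj_on g {- int N..int N}" using j by (auto simp: inj_on_def g_def)
    have "(\<Sum>m = - int N..int N. \<pi> (g m) * P (g m) j) = (\<Sum>i\<in>g ` {- int N..int N}. \<pi> i * P i j)"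
      unfolding sum.reindex[OF inj] by simp
    also have "\<dots> \<le> \<pi> j"
      using sum_le_suminf[of "\<lambda>i. \<pi> i * P i j" "g ` {- int N..int N}"] \<pi>_inv[of j] P_nonneg \<pi>_nonneg
      by (auto simp: sums_iff)
    finally have "(\<Sum>m = - int N..int N. \<pi> (g m) * P (g m) j) / \<pi> j \<le> 1"
      using \<pi>_pos[of j] by simp
    moreover have "(\<Sum>m = - int N..int N. P (nat (int j + - m)) (nat (int (nat (int j + - m)) + m)) * (\<pi> (nat (int j + - m)) / \<pi> j))
      = (\<Sum>m = - int N..int N. \<pi> (g m) * P (g m) j) / \<pi> j"
      unfolding sum_divide_distrib using j by (intro sum.cong) (auto simp: g_def)
    ultimately show ?thesis by simp
  qed
  then show "\<exists>n. \<forall>j\<ge>n. (\<Sum>m = - int N..int N. P (nat (int j + - m)) (nat (int (nat (int j + - m)) + m)) * (\<pi> (nat (int j + - m)) / \<pi> j)) \<le> 1"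
    by blast
qed

text \<open>
  For \<open>\<tau> > 0\<close> the weights \<open>a m\<close> and \<open>a m * \<tau> powr - m\<close> have total mass equal to, and at most,
  one. Their termwise geometric mean has mass \<open>\<alpha>\<close>, and the inequality between the means is strict
  unless \<open>a\<close> is concentrated at zero. For \<open>\<tau> = 0\<close> the claim is that \<open>a 0 < 1\<close>. In both cases
  the negative drift provides an \<open>m \<noteq> 0\<close> with \<open>a m > 0\<close>.
\<close>
lemma \<alpha>_less_1: "\<alpha> < 1"
proof -
  have "\<exists>m\<in>{- int N..int N}. m \<noteq> 0 \<and> a m \<noteq> 0"
  proof (rule ccontr)
    assume "\<not> ?thesis"
    then have "(\<Sum>k = - int N..int N. of_int k * a k) = 0" by (intro sum.neutral) auto
    with drift show False by simp
  qed
  then obtain m where m: "m \<in> {- int N..int N}" "m \<noteq> 0" "0 < a m" using a_range by force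
  show ?thesis
  proof (cases "\<tau> = 0")
    case True
    have "a 0 + a m = (\<Sum>k\<in>{0, m}. a k)" using m by simp
    also have "\<dots> \<le> (\<Sum>k = - int N..int N. a k)"
      using m a_range by (intro sum_mono2) auto
    finally show ?thesis unfolding \<alpha>_eq using m(3) True by (simp add: sum_a)
  next
    case False
    then have \<tau>': "0 < \<tau>" "\<tau> < 1" using \<tau> by auto
    define t where "t k = \<tau> powr (- real_of_int k / 2)" for k
    have t2: "(t k)\<^sup>2 = \<tau> powr - real_of_int k" for k
      using \<tau>' by (simp add: t_def power2_eq_square powr_add[symmetric])
    have \<alpha>_t: "\<alpha> = (\<Sum>k = - int N..int N. a k * t k)" using False by (simp add: \<alpha>_eq t_def)
    \<comment> \<open>the gap between arithmetic and geometric mean of 1 and \<open>(t k)\<^sup>2\<close> is half of \<open>(1 - t k)\<^sup>2\<close>\<close>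
    have "t m \<noteq> 1" using \<tau>' m(2) by (simp add: t_def powr_eq_one_iff_gen)
    then have "0 < a m * (1 - t m)\<^sup>2" using m(3) by simp
    also have "\<dots> \<le> (\<Sum>k = - int N..int N. a k * (1 - t k)\<^sup>2)"
      using m(1) a_range by (intro member_le_sum) auto
    also have "\<dots> = (\<Sum>k = - int N..int N. a k) - 2 * \<alpha> + (\<Sum>k = - int N..int N. a k * \<tau> powr - of_int k)"
      by (simp add: power2_diff t2[symmetric] \<alpha>_t sum_distrib_left sum.distrib[symmetric] sum_subtractf[symmetric] algebra_simps)
    also have "\<dots> \<le> 2 - 2 * \<alpha>" using sum_a_tilted[OF \<tau>'(1)] sum_a by simp
    finally show ?thesis by simp
  qed
qed

lemma sqrt_\<pi>_summable: "summable (\<lambda>i. sqrt (\<pi> i))"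
proof -
  obtain c where c: "sqrt \<tau> < c" "c < 1"
    using dense[of "sqrt \<tau>" 1] \<tau> by auto
  have "(\<lambda>i. sqrt (\<pi> (Suc i) / \<pi> i)) \<longlonglongrightarrow> sqrt \<tau>" by (intro tendsto_real_sqrt \<tau>_lim)
  then have "\<forall>\<^sub>F i in sequentially. sqrt (\<pi> (Suc i) / \<pi> i) < c"
    using c(1) by (rule order_tendstoD)
  then obtain n where n: "\<And>i. n \<le> i \<Longrightarrow> sqrt (\<pi> (Suc i) / \<pi> i) < c"
    unfolding eventually_sequentially by blast
  show ?thesis
  proof (rule summable_ratio_test[OF c(2)])
    fix i assume "n \<le> i"
    from n[OF this] show "norm (sqrt (\<pi> (Suc i))) \<le> c * norm (sqrt (\<pi> i))"
      using \<pi>_pos[of i] \<pi>_nonneg[of "Suc i"] by (simp add: real_sqrt_divide field_simps)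
  qed
qed

text \<open>
  Far out, each of the \<open>2 N + 1\<close> diagonals of the conjugated kernel is close to its limit. The
  excess \<open>r - \<alpha>\<close> is distributed evenly among them. The condition \<open>N \<le> M0\<close> keeps the indices
  \<open>i + m\<close> nonnegative.
\<close>
lemma tail_pointwise:
  assumes "\<alpha> < r"
  shows "\<exists>s M0. (\<forall>m\<in>{- int N..int N}. 0 \<le> s m) \<and> (\<Sum>m = - int N..int N. s m) = r \<and> N \<le> M0 \<and>
    (\<forall>f. \<forall>i\<ge>M0. sqrt (\<pi> i) * cmod (kernel_op P f i) \<le>
       (\<Sum>m = - int N..int N. s m * (sqrt (\<pi> (nat (int i + m))) * cmod (f (nat (int i + m))))))"
proof -
  define \<delta> where "\<delta> = (r - \<alpha>) / (2 * N + 1)"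
  define s where "s m = edge_limit m + \<delta>" for m
  have \<delta>: "0 < \<delta>" using assms by (simp add: \<delta>_def)
  have "(\<Sum>m = - int N..int N. s m) = \<alpha> + (2 * N + 1) * \<delta>"
    by (simp add: s_def sum.distrib \<alpha>_def)
  also have "(2 * N + 1) * \<delta> = r - \<alpha>" by (simp add: \<delta>_def)
  finally have sum_s: "(\<Sum>m = - int N..int N. s m) = r" by simp
  have "\<forall>\<^sub>F i in sequentially. \<forall>m\<in>{- int N..int N}. edge_weight m i < s m"
    using \<delta> by (intro eventually_ball_finite ballI order_tendstoD(2)[OF edge_weight_lim]) (auto simp: s_def)
  then obtain n where n: "\<And>i m. n \<le> i \<Longrightarrow> m \<in> {- int N..int N} \<Longrightarrow> edge_weight m i < s m"
    unfolding eventually_sequentially by blast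
  show ?thesis
  proof (intro exI[of _ s] exI[of _ "max n (max i0 N)"] conjI ballI allI impI)
    show "0 \<le> s m" if "m \<in> {- int N..int N}" for m
      using edge_limit_nonneg[OF that] \<delta> by (simp add: s_def)
    fix f i assume i: "max n (max i0 N) \<le> i"
    have "kernel_op P f i = (\<Sum>m = - int N..int N. of_real (P i (nat (int i + m))) * f (nat (int i + m)))"
      unfolding kernel_op_def using band_sums[of i f] i by (simp add: sums_iff)
    then have "sqrt (\<pi> i) * cmod (kernel_op P f i) \<le>
      sqrt (\<pi> i) * (\<Sum>m = - int N..int N. cmod (of_real (P i (nat (int i + m))) * f (nat (int i + m))))"
      using \<pi>_nonneg by (auto intro!: mult_left_mono norm_sum)
    also have "\<dots> = (\<Sum>m = - int N..int N. edge_weight m i * (sqrt (\<pi> (nat (int i + m))) * cmod (f (nat (int i + m)))))"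
      unfolding sum_distrib_left
      using \<pi>_pos P_nonneg by (intro sum.cong) (auto simp: edge_weight_eq norm_mult real_sqrt_divide less_imp_neq[symmetric])
    also have "\<dots> \<le> (\<Sum>m = - int N..int N. s m * (sqrt (\<pi> (nat (int i + m))) * cmod (f (nat (int i + m)))))"
      using n i \<pi>_nonneg by (intro sum_mono mult_right_mono less_imp_le[OF n]) auto
    finally show "sqrt (\<pi> i) * cmod (kernel_op P f i) \<le>
       (\<Sum>m = - int N..int N. s m * (sqrt (\<pi> (nat (int i + m))) * cmod (f (nat (int i + m)))))" .
  qed (use sum_s in auto)
qed

end

section \<open>The two spaces and their eigenfunctions\<close>

text \<open>
  A norm that is a supremum of seminorms, each continuous under pointwise convergence, is
  complete: the bound for the partial sums of an absolutely convergent series passes to the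
  pointwise limit seminorm by seminorm. Both norms below are of this kind.
\<close>
lemma seq_banach_SupI:
  fixes p :: "nat \<Rightarrow> (nat \<Rightarrow> complex) \<Rightarrow> real"
  assumes X: "\<And>f. f \<in> X \<longleftrightarrow> bdd_above (range (\<lambda>m. p m f))"
    and nrm: "\<And>f. f \<in> X \<Longrightarrow> nrm f = (SUP m. p m f)"
    and nonneg: "\<And>m f. 0 \<le> p m f"
    and add: "\<And>m f g. p m (\<lambda>i. f i + g i) \<le> p m f + p m g"
    and scale: "\<And>m c f. p m (\<lambda>i. c * f i) = cmod c * p m f"
    and cont: "\<And>m F f. (\<And>i. (\<lambda>k. F k i) \<longlonglongrightarrow> f i) \<Longrightarrow> (\<lambda>k. p m (F k)) \<longlonglongrightarrow> p m f"
    and coord: "\<And>i. \<exists>m C. 0 \<le> C \<and> (\<forall>f. cmod (f i) \<le> C * p m f)"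
  shows "seq_banach X nrm"
proof -
  have le: "p m f \<le> nrm f" if "f \<in> X" for m f
    unfolding nrm[OF that] using that X by (intro cSUP_upper) auto
  have bound: "f \<in> X" "nrm f \<le> B" if "\<And>m. p m f \<le> B" for f B
  proof -
    show "f \<in> X" unfolding X by (rule bdd_aboveI2) (rule that)
    then show "nrm f \<le> B" unfolding nrm[OF \<open>f \<in> X\<close>] by (intro cSUP_least that) simp
  qed
  have coord': "\<exists>C\<ge>0. \<forall>f\<in>X. cmod (f i) \<le> C * nrm f" for i
  proof -
    obtain m C where C: "0 \<le> C" "\<And>f. cmod (f i) \<le> C * p m f" using coord[of i] by blast
    have "cmod (f i) \<le> C * nrm f" if "f \<in> X" for f
      using C(2)[of f] mult_left_mono[OF le[OF that, of m] C(1)] by linarith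
    with C(1) show ?thesis by blast
  qed
  have scale_eq: "nrm (\<lambda>i. c * f i) \<le> cmod c * nrm f" "(\<lambda>i. c * f i) \<in> X" if "f \<in> X" for c f
    using bound[of "\<lambda>i. c * f i" "cmod c * nrm f"] le[OF that] by (auto simp: scale mult_left_mono)
  have series: "(\<lambda>i. \<Sum>n. F n i) \<in> X \<and> nrm (\<lambda>i. \<Sum>n. F n i) \<le> (\<Sum>n. nrm (F n))"
    if F: "\<And>n. F n \<in> X" and sm: "summable (\<lambda>n. nrm (F n))" for F
  proof -
    have pos: "0 \<le> nrm (F n)" for n using nonneg[of 0 "F n"] le[OF F, of 0 n] by linarith
    have lim: "(\<lambda>k. \<Sum>n<k. F n i) \<longlonglongrightarrow> (\<Sum>n. F n i)" for i
    proof (rule summable_LIMSEQ)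
      obtain C where C: "0 \<le> C" "\<And>f. f \<in> X \<Longrightarrow> cmod (f i) \<le> C * nrm f" using coord' by blast
      show "summable (\<lambda>n. F n i)"
        by (rule summable_comparison_test'[OF summable_mult[OF sm, of C], of 0]) (use C(2)[OF F] in auto)
    qed
    have part: "p m (\<lambda>i. \<Sum>n<k. F n i) \<le> (\<Sum>n<k. nrm (F n))" for m k
    proof (induction k)
      case 0
      show ?case using scale[of m 0 "\<lambda>_. 0"] by simp
    next
      case (Suc k)
      then show ?case
        using add[of m "\<lambda>i. \<Sum>n<k. F n i" "F k"] le[OF F, of m k] by simp
    qed
    have "p m (\<lambda>i. \<Sum>n. F n i) \<le> (\<Sum>n. nrm (F n))" for m
    proof (rule LIMSEQ_le_const2[OF cont[OF lim]], intro exI allI impI)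
      fix k
      have "(\<Sum>n<k. nrm (F n)) \<le> (\<Sum>n. nrm (F n))" using sm pos by (intro sum_le_suminf) auto
      with part[of m k] show "p m (\<lambda>i. \<Sum>n<k. F n i) \<le> (\<Sum>n. nrm (F n))" by linarith
    qed
    from bound[OF this] show ?thesis by blast
  qed
  show ?thesis
  proof
    show "(\<lambda>_. 0) \<in> X" using bound(1)[of "\<lambda>_. 0" 0] scale[of _ 0 "\<lambda>_. 0"] by simp
    fix f g :: "nat \<Rightarrow> complex" and c i
    assume f: "f \<in> X"
    show "(\<lambda>i. c * f i) \<in> X" by (rule scale_eq(2)[OF f])
    show "0 \<le> nrm f" using nonneg[of 0 f] le[OF f, of 0] by linarith
    show "nrm (\<lambda>i. c * f i) = cmod c * nrm f"
    proof (cases "c = 0")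
      case True
      have "0 \<le> nrm (\<lambda>i. c * f i)"
        using nonneg[of 0 "\<lambda>i. c * f i"] le[OF scale_eq(2)[OF f], of 0 c] by linarith
      then show ?thesis using scale_eq(1)[OF f, of c] True by simp
    next
      case False
      have "nrm (\<lambda>i. inverse c * (c * f i)) \<le> cmod (inverse c) * nrm (\<lambda>i. c * f i)"
        by (rule scale_eq(1)[OF scale_eq(2)[OF f]])
      then have "nrm f \<le> inverse (cmod c) * nrm (\<lambda>i. c * f i)"
        using False by (simp add: norm_inverse mult.assoc[symmetric])
      then have "cmod c * nrm f \<le> nrm (\<lambda>i. c * f i)" using False by (simp add: field_simps)
      then show ?thesis using scale_eq(1)[OF f, of c] by simp
    qed
    assume g: "g \<in> X"
    have "p m (\<lambda>i. f i + g i) \<le> nrm f + nrm g" for m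
      using add[of m f g] le[OF f, of m] le[OF g, of m] by linarith
    from bound[OF this] show "(\<lambda>i. f i + g i) \<in> X" "nrm (\<lambda>i. f i + g i) \<le> nrm f + nrm g" by auto
  next
    show "\<exists>C. \<forall>f\<in>X. cmod (f i) \<le> C * nrm f" for i using coord'[of i] by blast
  qed (use series in blast)+
qed

lemma L2_set_sum_le:
  assumes "finite S"
  shows "L2_set (\<lambda>i. \<Sum>m\<in>S. g m i) A \<le> (\<Sum>m\<in>S. L2_set (g m) A)"
  using assms
proof (induction S)
  case (insert x S)
  then show ?case
    using L2_set_triangle_ineq[of "g x" "\<lambda>i. \<Sum>m\<in>S. g m i" A] by simp
qed (simp add: L2_set_def)

context markov_chain
begin

definition l2_partial :: "nat \<Rightarrow> (nat \<Rightarrow> complex) \<Rightarrow> real" where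
  "l2_partial m f = L2_set (\<lambda>i. sqrt (\<pi> i) * cmod (f i)) {..<m}"

lemma l2_partial_eq: "l2_partial m f = sqrt (\<Sum>i<m. (cmod (f i))\<^sup>2 * \<pi> i)"
  using \<pi>_nonneg by (simp add: l2_partial_def L2_set_def power_mult_distrib mult.commute)

lemma l2_space_iff: "f \<in> l2_space \<pi> \<longleftrightarrow> bdd_above (range (\<lambda>m. l2_partial m f))"
proof
  assume "f \<in> l2_space \<pi>"
  then have "(\<Sum>i<m. (cmod (f i))\<^sup>2 * \<pi> i) \<le> (\<Sum>i. (cmod (f i))\<^sup>2 * \<pi> i)" for m
    using \<pi>_nonneg unfolding l2_space_def by (intro sum_le_suminf) auto
  then show "bdd_above (range (\<lambda>m. l2_partial m f))"
    unfolding l2_partial_eq by (intro bdd_aboveI2[where M = "sqrt (\<Sum>i. (cmod (f i))\<^sup>2 * \<pi> i)"]) simp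
next
  assume "bdd_above (range (\<lambda>m. l2_partial m f))"
  then obtain B where B: "\<And>m. l2_partial m f \<le> B" by (auto simp: bdd_above_def)
  have "summable (\<lambda>i. (cmod (f i))\<^sup>2 * \<pi> i)"
  proof (rule summableI_nonneg_bounded)
    show "(\<Sum>i<m. (cmod (f i))\<^sup>2 * \<pi> i) \<le> B\<^sup>2" for m
      using B[of m] \<pi>_nonneg unfolding l2_partial_eq by (intro sqrt_le_D) auto
  qed (use \<pi>_nonneg in auto)
  then show "f \<in> l2_space \<pi>" by (simp add: l2_space_def)
qed

lemma l2_norm_eq:
  assumes "f \<in> l2_space \<pi>"
  shows "l2_norm \<pi> f = (SUP m. l2_partial m f)"
proof (rule antisym)
  have sm: "summable (\<lambda>i. (cmod (f i))\<^sup>2 * \<pi> i)" using assms by (simp add: l2_space_def)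
  have "(\<lambda>m. l2_partial m f) \<longlonglongrightarrow> l2_norm \<pi> f"
    unfolding l2_partial_eq l2_norm_def by (intro tendsto_real_sqrt summable_LIMSEQ sm)
  then show "l2_norm \<pi> f \<le> (SUP m. l2_partial m f)"
    using assms l2_space_iff by (intro LIMSEQ_le_const2) (auto intro!: cSUP_upper)
  have "l2_partial m f \<le> l2_norm \<pi> f" for m
    unfolding l2_partial_eq l2_norm_def using sm \<pi>_nonneg by (auto intro!: sum_le_suminf)
  then show "(SUP m. l2_partial m f) \<le> l2_norm \<pi> f" by (intro cSUP_least) auto
qed

lemma coord_le_l2_partial: "i < m \<Longrightarrow> sqrt (\<pi> i) * cmod (f i) \<le> l2_partial m f"
  unfolding l2_partial_def
  using member_le_L2_set[of "{..<m}" i "\<lambda>i. sqrt (\<pi> i) * cmod (f i)"] by simp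

lemma coord_le_partial_imp:
  "sqrt (\<pi> i) * cmod (f i) \<le> B \<Longrightarrow> cmod (f i) \<le> inverse (sqrt (\<pi> i)) * B"
  using \<pi>_pos[of i] by (simp add: field_simps)

lemma l2_seq_banach: "seq_banach (l2_space \<pi>) (l2_norm \<pi>)"
proof (rule seq_banach_SupI[OF l2_space_iff l2_norm_eq])
  show "0 \<le> l2_partial m f" for m f by (simp add: l2_partial_def)
  show "l2_partial m (\<lambda>i. f i + g i) \<le> l2_partial m f + l2_partial m g" for m f g
  proof -
    have "l2_partial m (\<lambda>i. f i + g i) \<le> L2_set (\<lambda>i. sqrt (\<pi> i) * cmod (f i) + sqrt (\<pi> i) * cmod (g i)) {..<m}"
      unfolding l2_partial_def using \<pi>_nonneg
      by (intro L2_set_mono) (auto simp: distrib_left[symmetric] intro!: mult_left_mono norm_triangle_ineq)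
    also have "\<dots> \<le> l2_partial m f + l2_partial m g"
      unfolding l2_partial_def by (rule L2_set_triangle_ineq)
    finally show ?thesis .
  qed
  show "l2_partial m (\<lambda>i. c * f i) = cmod c * l2_partial m f" for m c f
    unfolding l2_partial_def by (simp add: L2_set_right_distrib norm_mult mult_ac)
  show "(\<lambda>k. l2_partial m (F k)) \<longlonglongrightarrow> l2_partial m f" if "\<And>i. (\<lambda>k. F k i) \<longlonglongrightarrow> f i" for m F f
    unfolding l2_partial_eq using that by (intro tendsto_intros)
  show "\<exists>m C. 0 \<le> C \<and> (\<forall>f. cmod (f i) \<le> C * l2_partial m f)" for i
    using \<pi>_nonneg
    by (intro exI[of _ "Suc i"] exI[of _ "inverse (sqrt (\<pi> i))"] conjI allI coord_le_partial_imp coord_le_l2_partial) auto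
qed auto

lemma l2_coord_le: "f \<in> l2_space \<pi> \<Longrightarrow> sqrt (\<pi> i) * cmod (f i) \<le> l2_norm \<pi> f"
  and l2_partial_le: "f \<in> l2_space \<pi> \<Longrightarrow> l2_partial m f \<le> l2_norm \<pi> f"
proof -
  assume f: "f \<in> l2_space \<pi>"
  show le: "l2_partial m f \<le> l2_norm \<pi> f" for m
    unfolding l2_norm_eq[OF f] using f l2_space_iff by (intro cSUP_upper) auto
  show "sqrt (\<pi> i) * cmod (f i) \<le> l2_norm \<pi> f"
    using coord_le_l2_partial[of i "Suc i" f] le[of "Suc i"] by simp
qed

abbreviation weight :: "nat \<Rightarrow> real" where "weight n \<equiv> \<pi> n powr (- 1 / 2)"

lemma inverse_weight: "inverse (weight n) = sqrt (\<pi> n)"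
  using \<pi>_pos[of n] by (simp add: powr_minus powr_half_sqrt)

lemma weighted_space_iff: "f \<in> weighted_space weight \<longleftrightarrow> bdd_above (range (\<lambda>m. sqrt (\<pi> m) * cmod (f m)))"
  unfolding weighted_space_def inverse_weight by simp

lemma weighted_norm_eq: "weighted_norm weight f = (SUP m. sqrt (\<pi> m) * cmod (f m))"
  unfolding weighted_norm_def inverse_weight ..

lemma weighted_seq_banach: "seq_banach (weighted_space weight) (weighted_norm weight)"
proof (rule seq_banach_SupI[OF weighted_space_iff weighted_norm_eq])
  show "0 \<le> sqrt (\<pi> m) * cmod (f m)" for m and f :: "nat \<Rightarrow> complex" using \<pi>_nonneg by simp
  show "sqrt (\<pi> m) * cmod (f m + g m) \<le> sqrt (\<pi> m) * cmod (f m) + sqrt (\<pi> m) * cmod (g m)"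
    for m and f g :: "nat \<Rightarrow> complex"
    unfolding distrib_left[symmetric] using \<pi>_nonneg by (intro mult_left_mono norm_triangle_ineq) auto
  show "sqrt (\<pi> m) * cmod (c * f m) = cmod c * (sqrt (\<pi> m) * cmod (f m))" for m c and f :: "nat \<Rightarrow> complex"
    by (simp add: norm_mult)
  show "(\<lambda>k. sqrt (\<pi> m) * cmod (F k m)) \<longlonglongrightarrow> sqrt (\<pi> m) * cmod (f m)"
    if "\<And>i. (\<lambda>k. F k i) \<longlonglongrightarrow> f i" for m F and f :: "nat \<Rightarrow> complex"
    using that by (intro tendsto_intros)
  show "\<exists>m C. 0 \<le> C \<and> (\<forall>f :: nat \<Rightarrow> complex. cmod (f i) \<le> C * (sqrt (\<pi> m) * cmod (f m)))" for i
    using \<pi>_nonneg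
    by (intro exI[of _ i] exI[of _ "inverse (sqrt (\<pi> i))"] conjI allI coord_le_partial_imp) auto
qed

lemma weighted_coord_le: "f \<in> weighted_space weight \<Longrightarrow> sqrt (\<pi> i) * cmod (f i) \<le> weighted_norm weight f"
  unfolding weighted_norm_eq weighted_space_iff by (rule cSUP_upper) auto

lemma weighted_memI:
  assumes "\<And>i. sqrt (\<pi> i) * cmod (f i) \<le> B"
  shows "f \<in> weighted_space weight" "weighted_norm weight f \<le> B"
  unfolding weighted_norm_eq weighted_space_iff using assms
  by (auto intro!: bdd_aboveI2[where M = B] cSUP_least)

lemma l2_subset_weighted: "l2_space \<pi> \<subseteq> weighted_space weight"
  using weighted_memI(1) l2_coord_le by blast

lemma l2_memI:
  assumes "\<And>m. l2_partial m f \<le> B"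
  shows "f \<in> l2_space \<pi>" "l2_norm \<pi> f \<le> B"
proof -
  show f: "f \<in> l2_space \<pi>"
    unfolding l2_space_iff using assms by (auto intro!: bdd_aboveI2[where M = B])
  show "l2_norm \<pi> f \<le> B"
    unfolding l2_norm_eq[OF f] using assms by (intro cSUP_least) auto
qed

lemma bounded_in_l2:
  assumes "\<And>i. cmod (f i) \<le> B"
  shows "f \<in> l2_space \<pi>"
proof -
  have "summable (\<lambda>i. (cmod (f i))\<^sup>2 * \<pi> i)"
  proof (rule summable_comparison_test'[of "\<lambda>i. B\<^sup>2 * \<pi> i" 0])
    show "summable (\<lambda>i. B\<^sup>2 * \<pi> i)" using \<pi>_sums by (intro summable_mult) (auto simp: sums_iff)
    show "norm ((cmod (f i))\<^sup>2 * \<pi> i) \<le> B\<^sup>2 * \<pi> i" for i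
      using assms[of i] \<pi>_nonneg[of i] by (auto intro!: mult_right_mono power_mono)
  qed
  then show ?thesis by (simp add: l2_space_def)
qed

end

context banded_chain
begin

text \<open>
  After conjugation the tail is dominated by a sum of shifts with weights \<open>s m\<close>, and a shift,
  being injective on indices, does not increase the norm.
\<close>
lemma chain_space_l2: "chain_space P \<pi> (l2_space \<pi>) (l2_norm \<pi>) \<alpha>"
proof -
  interpret seq_banach "l2_space \<pi>" "l2_norm \<pi>" by (rule l2_seq_banach)
  show ?thesis
  proof
    show "summable (\<lambda>i. sqrt (\<pi> i))" by (rule sqrt_\<pi>_summable)
    show "sqrt (\<pi> i) * cmod (f i) \<le> l2_norm \<pi> f" if "f \<in> l2_space \<pi>" for f i
      using l2_coord_le[OF that] .
    show "(\<lambda>i. of_bool (i = l)) \<in> l2_space \<pi>" for l by (rule bounded_in_l2[of _ 1]) simp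
    show "(\<lambda>_. c) \<in> l2_space \<pi>" for c by (rule bounded_in_l2[of _ "cmod c"]) simp
    show "0 \<le> \<alpha>" "\<alpha> < 1" by (rule \<alpha>_nonneg, rule \<alpha>_less_1)
    fix r assume "\<alpha> < r"
    obtain s M0 where "\<forall>m\<in>{- int N..int N}. 0 \<le> s m" "(\<Sum>m = - int N..int N. s m) = r" "N \<le> M0"
      "\<forall>f. \<forall>i\<ge>M0. sqrt (\<pi> i) * cmod (kernel_op P f i) \<le>
       (\<Sum>m = - int N..int N. s m * (sqrt (\<pi> (nat (int i + m))) * cmod (f (nat (int i + m)))))"
      using tail_pointwise[OF \<open>\<alpha> < r\<close>] by blast
    note s = this(1)[rule_format] this(2,3) this(4)[rule_format]
    have "tail_op P M f \<in> l2_space \<pi> \<and> l2_norm \<pi> (tail_op P M f) \<le> r * l2_norm \<pi> f"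
      if M: "M0 \<le> M" and f: "f \<in> l2_space \<pi>" for M f
    proof -
      define w where "w i = sqrt (\<pi> i) * cmod (f i)" for i
      have w: "0 \<le> w i" for i using \<pi>_nonneg by (simp add: w_def)
      define u where "u m i = (if i < M then 0 else w (nat (int i + m)))" for m i
      have shift: "L2_set (u m) {..<k} \<le> l2_norm \<pi> f" if m: "m \<in> {- int N..int N}" for m k
      proof -
        have "(\<Sum>i<k. (u m i)\<^sup>2) = (\<Sum>i\<in>{M..<k}. (w (nat (int i + m)))\<^sup>2)"
          by (rule sum.mono_neutral_cong_right) (auto simp: u_def)
        also have "\<dots> = (\<Sum>j\<in>(\<lambda>i. nat (int i + m)) ` {M..<k}. (w j)\<^sup>2)"
          using m M s(3) by (subst sum.reindex) (auto simp: inj_on_def)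
        also have "\<dots> \<le> (\<Sum>j<k + N. (w j)\<^sup>2)"
          using m by (intro sum_mono2) auto
        finally have "L2_set (u m) {..<k} \<le> l2_partial (k + N) f"
          by (simp add: L2_set_def l2_partial_def w_def)
        also have "\<dots> \<le> l2_norm \<pi> f" by (rule l2_partial_le[OF f])
        finally show ?thesis .
      qed
      have "l2_partial k (tail_op P M f) \<le> r * l2_norm \<pi> f" for k
      proof -
        have "l2_partial k (tail_op P M f) \<le> L2_set (\<lambda>i. \<Sum>m = - int N..int N. s m * u m i) {..<k}"
          unfolding l2_partial_def
        proof (rule L2_set_mono)
          fix i
          show "sqrt (\<pi> i) * cmod (tail_op P M f i) \<le> (\<Sum>m = - int N..int N. s m * u m i)"
            using s(4)[of i f] M by (auto simp: tail_op_def u_def w_def)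
        qed (use \<pi>_nonneg in auto)
        also have "\<dots> \<le> (\<Sum>m = - int N..int N. L2_set (\<lambda>i. s m * u m i) {..<k})"
          by (rule L2_set_sum_le) simp
        also have "\<dots> \<le> (\<Sum>m = - int N..int N. s m * l2_norm \<pi> f)"
          using s(1) shift by (intro sum_mono) (auto simp: L2_set_right_distrib[symmetric] intro!: mult_left_mono)
        also have "\<dots> = r * l2_norm \<pi> f" by (simp add: sum_distrib_right[symmetric] s(2))
        finally show ?thesis .
      qed
      from l2_memI[OF this] show ?thesis by blast
    qed
    then show "\<exists>M0. \<forall>M\<ge>M0. \<forall>f\<in>l2_space \<pi>. tail_op P M f \<in> l2_space \<pi> \<and>
        l2_norm \<pi> (tail_op P M f) \<le> r * l2_norm \<pi> f" by blast
  qed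
qed

lemma chain_space_weighted: "chain_space P \<pi> (weighted_space weight) (weighted_norm weight) \<alpha>"
proof -
  interpret seq_banach "weighted_space weight" "weighted_norm weight" by (rule weighted_seq_banach)
  show ?thesis
  proof
    show "summable (\<lambda>i. sqrt (\<pi> i))" by (rule sqrt_\<pi>_summable)
    show "sqrt (\<pi> i) * cmod (f i) \<le> weighted_norm weight f" if "f \<in> weighted_space weight" for f i
      using weighted_coord_le[OF that] .
    show "(\<lambda>i. of_bool (i = l)) \<in> weighted_space weight" for l
      using l2_subset_weighted bounded_in_l2[of "\<lambda>i. of_bool (i = l)" 1] by auto
    show "(\<lambda>_. c) \<in> weighted_space weight" for c
      using l2_subset_weighted bounded_in_l2[of "\<lambda>_. c" "cmod c"] by auto
    show "0 \<le> \<alpha>" "\<alpha> < 1" by (rule \<alpha>_nonneg, rule \<alpha>_less_1)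
    fix r assume "\<alpha> < r"
    obtain s M0 where "\<forall>m\<in>{- int N..int N}. 0 \<le> s m" "(\<Sum>m = - int N..int N. s m) = r" "N \<le> M0"
      "\<forall>f. \<forall>i\<ge>M0. sqrt (\<pi> i) * cmod (kernel_op P f i) \<le>
       (\<Sum>m = - int N..int N. s m * (sqrt (\<pi> (nat (int i + m))) * cmod (f (nat (int i + m)))))"
      using tail_pointwise[OF \<open>\<alpha> < r\<close>] by blast
    note s = this(1)[rule_format] this(2,3) this(4)[rule_format]
    have r: "0 \<le> r" using \<open>\<alpha> < r\<close> \<alpha>_nonneg by simp
    have "tail_op P M f \<in> weighted_space weight \<and> weighted_norm weight (tail_op P M f) \<le> r * weighted_norm weight f"
      if M: "M0 \<le> M" and f: "f \<in> weighted_space weight" for M f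
    proof -
      have "sqrt (\<pi> i) * cmod (tail_op P M f i) \<le> r * weighted_norm weight f" for i
      proof (cases "i < M")
        case True
        then show ?thesis using r nrm_nonneg[OF f] by (simp add: tail_op_def)
      next
        case False
        then have "sqrt (\<pi> i) * cmod (tail_op P M f i) \<le>
          (\<Sum>m = - int N..int N. s m * (sqrt (\<pi> (nat (int i + m))) * cmod (f (nat (int i + m)))))"
          using s(4)[of i f] M by (simp add: tail_op_def)
        also have "\<dots> \<le> (\<Sum>m = - int N..int N. s m * weighted_norm weight f)"
          by (intro sum_mono mult_left_mono weighted_coord_le[OF f] s(1))
        also have "\<dots> = r * weighted_norm weight f" by (simp add: sum_distrib_right[symmetric] s(2))
        finally show ?thesis .
      qed
      from weighted_memI[OF this] show ?thesis by blast
    qed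
    then show "\<exists>M0. \<forall>M\<ge>M0. \<forall>f\<in>weighted_space weight. tail_op P M f \<in> weighted_space weight \<and>
        weighted_norm weight (tail_op P M f) \<le> r * weighted_norm weight f" by blast
  qed
qed

sublocale l2: chain_space P \<pi> "l2_space \<pi>" "l2_norm \<pi>" \<alpha>
  by (rule chain_space_l2)

sublocale weighted: chain_space P \<pi> "weighted_space weight" "weighted_norm weight" \<alpha>
  by (rule chain_space_weighted)

lemma weighted_eigenfunction_in_l2:
  "f \<in> weighted_space weight \<Longrightarrow> \<alpha> < cmod z \<Longrightarrow> kernel_op P f = (\<lambda>i. z * f i) \<Longrightarrow> f \<in> l2_space \<pi>"
  by (rule eigenfunction_transfer[OF chain_space_l2 chain_space_weighted l2_subset_weighted])

text \<open>
  One direction holds as the spaces are nested, the other as eigenfunctions for \<open>|z| > \<alpha>\<close> in the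
  larger space already lie in the smaller one.
\<close>
lemma constant_eigenfunctions_iff:
  assumes "\<alpha> \<le> \<rho>"
  shows "constant_eigenfunctions P (weighted_space weight) \<rho> \<longleftrightarrow> constant_eigenfunctions P (l2_space \<pi>) \<rho>"
proof
  show "constant_eigenfunctions P (l2_space \<pi>) \<rho>" if "constant_eigenfunctions P (weighted_space weight) \<rho>"
    using that l2_subset_weighted unfolding constant_eigenfunctions_def by blast
  assume H: "constant_eigenfunctions P (l2_space \<pi>) \<rho>"
  show "constant_eigenfunctions P (weighted_space weight) \<rho>"
    unfolding constant_eigenfunctions_def
  proof (intro ballI allI impI)
    fix f z assume f: "f \<in> weighted_space weight" "\<rho> < cmod z" "kernel_op P f = (\<lambda>i. z * f i)"
    then have "f \<in> l2_space \<pi>" using assms by (intro weighted_eigenfunction_in_l2) auto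
    with H f show "\<exists>c. f = (\<lambda>_. c)" unfolding constant_eigenfunctions_def by blast
  qed
qed

lemma spectral_gap_l2: "spectral_gap (l2_space \<pi>) (l2_norm \<pi>) P \<pi>"
  by (rule l2.spectral_gapI) (rule peripheral_eigenfunction_const)

lemma spectral_gap_weighted: "spectral_gap (weighted_space weight) (weighted_norm weight) P \<pi>"
proof (rule weighted.spectral_gapI)
  fix f z assume f: "f \<in> weighted_space weight" "1 \<le> cmod z" "kernel_op P f = (\<lambda>i. z * f i)"
  then have "f \<in> l2_space \<pi>" using \<alpha>_less_1 by (intro weighted_eigenfunction_in_l2) auto
  then show "\<exists>c. f = (\<lambda>_. c)" using f by (intro peripheral_eigenfunction_const)
qed

lemma gap_rate_le_iff:
  assumes "\<alpha> \<le> \<rho>" "\<rho> < 1"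
  shows "gap_rate (weighted_space weight) (weighted_norm weight) P \<pi> \<le> \<rho> \<longleftrightarrow>
    gap_rate (l2_space \<pi>) (l2_norm \<pi>) P \<pi> \<le> \<rho>"
  using l2.gap_rate_le_iff[OF spectral_gap_l2 assms] weighted.gap_rate_le_iff[OF spectral_gap_weighted assms]
    constant_eigenfunctions_iff[OF assms(1)] by simp

end

section \<open>The comparison theorem\<close>

lemma gap_rate_less_1:
  assumes "spectral_gap X nrm P \<pi>"
  shows "gap_rate X nrm P \<pi> < 1"
proof -
  obtain \<rho> where \<rho>: "\<rho> \<in> gap_rates X nrm P \<pi>" using assms by (auto simp: spectral_gap_def)
  have "bdd_below (gap_rates X nrm P \<pi>)" unfolding gap_rates_def by (rule bdd_belowI[of _ 0]) auto
  then have "gap_rate X nrm P \<pi> \<le> \<rho>" unfolding gap_rate_def using \<rho> by (intro cInf_lower)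
  also have "\<rho> < 1" using \<rho> by (simp add: gap_rates_def)
  finally show ?thesis .
qed

theorem proposition1:
  fixes P :: "nat \<Rightarrow> nat \<Rightarrow> real" and \<pi> :: "nat \<Rightarrow> real"
    and N i0 :: nat and a :: "int \<Rightarrow> real" and \<tau> :: real
    and V :: "nat \<Rightarrow> real"
  assumes "markov_kernel P" and "irreducible_kernel P" and "aperiodic_kernel P"
    and "invariant_prob P \<pi>" and "\<And>\<mu>. invariant_prob P \<mu> \<Longrightarrow> \<mu> = \<pi>"
    and "1 \<le> N"
    and "\<And>i j. i0 \<le> i \<Longrightarrow> int N < \<bar>int i - int j\<bar> \<Longrightarrow> P i j = 0"
    and "\<And>m. m \<in> {- int N..int N} \<Longrightarrow> a m \<in> {0..1}"
    and "\<And>m. m \<in> {- int N..int N} \<Longrightarrow> (\<lambda>i. P i (nat (int i + m))) \<longlonglongrightarrow> a m"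
    and "\<tau> \<in> {0..<1}" and "(\<lambda>i. \<pi> (Suc i) / \<pi> i) \<longlonglongrightarrow> \<tau>"
    and "(\<Sum>k = - int N..int N. of_int k * a k) < 0"
    and V_def: "V = (\<lambda>n. \<pi> n powr (- 1 / 2))"
  shows "alpha0 P \<pi> N < 1
    \<and> alpha0 P \<pi> N = ereal (if \<tau> = 0 then a 0
         else (\<Sum>m = - int N..int N. a m * \<tau> powr (- of_int m / 2)))
    \<and> bounded_op (l2_space \<pi>) (l2_norm \<pi>) (kernel_op P)
    \<and> bounded_op (weighted_space V) (weighted_norm V) (kernel_op P)
    \<and> spectral_gap (l2_space \<pi>) (l2_norm \<pi>) P \<pi>
    \<and> spectral_gap (weighted_space V) (weighted_norm V) P \<pi>
    \<and> max (ess_spectral_radius (weighted_space V) (weighted_norm V) (kernel_op P))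
           (ess_spectral_radius (l2_space \<pi>) (l2_norm \<pi>) (kernel_op P)) \<le> alpha0 P \<pi> N
    \<and> (ereal (gap_rate (weighted_space V) (weighted_norm V) P \<pi>) \<le> alpha0 P \<pi> N
         \<longrightarrow> ereal (gap_rate (l2_space \<pi>) (l2_norm \<pi>) P \<pi>) \<le> alpha0 P \<pi> N)
    \<and> (ereal (gap_rate (weighted_space V) (weighted_norm V) P \<pi>) > alpha0 P \<pi> N
         \<longrightarrow> gap_rate (l2_space \<pi>) (l2_norm \<pi>) P \<pi>
           = gap_rate (weighted_space V) (weighted_norm V) P \<pi>)"
proof -
  interpret banded_chain P \<pi> N i0 a \<tau>
  proof unfold_locales
    show "P i j = 0" if "i0 \<le> i" "int N < \<bar>int i - int j\<bar>" for i j using that by (rule assms(7))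
    show "a m \<in> {0..1}" "(\<lambda>i. P i (nat (int i + m))) \<longlonglongrightarrow> a m" if "m \<in> {- int N..int N}" for m
      using that by (rule assms(8), rule assms(9))
  qed (rule assms(1) assms(2) assms(3) assms(4) assms(10) assms(11) assms(12))+
  let ?gV = "gap_rate (weighted_space V) (weighted_norm V) P \<pi>"
  let ?g2 = "gap_rate (l2_space \<pi>) (l2_norm \<pi>) P \<pi>"
  have iff: "?gV \<le> \<rho> \<longleftrightarrow> ?g2 \<le> \<rho>" if "\<alpha> \<le> \<rho>" "\<rho> < 1" for \<rho>
    unfolding V_def by (rule gap_rate_le_iff[OF that])
  have less_1: "?gV < 1" "?g2 < 1"
    using spectral_gap_weighted spectral_gap_l2 unfolding V_def by (simp_all add: gap_rate_less_1)
  have a: "?g2 \<le> \<alpha>" if "?gV \<le> \<alpha>"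
    using iff[of \<alpha>] that \<alpha>_less_1 by simp
  have b: "?g2 = ?gV" if gV: "\<alpha> < ?gV"
  proof (rule antisym)
    show "?g2 \<le> ?gV" using iff[of ?gV] gV less_1 by simp
    have "?gV \<le> max \<alpha> ?g2" using iff[of "max \<alpha> ?g2"] less_1 \<alpha>_less_1 by simp
    with gV show "?gV \<le> ?g2" by simp
  qed
  show ?thesis
    unfolding alpha0_eq
  proof (intro conjI impI)
    show "ereal \<alpha> < 1" using \<alpha>_less_1 by simp
    show "ereal \<alpha> = ereal (if \<tau> = 0 then a 0 else (\<Sum>m = - int N..int N. a m * \<tau> powr (- of_int m / 2)))"
      by (simp only: \<alpha>_eq)
    show "bounded_op (l2_space \<pi>) (l2_norm \<pi>) (kernel_op P)" by (rule l2.kernel_bounded_op)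
    show "bounded_op (weighted_space V) (weighted_norm V) (kernel_op P)"
      unfolding V_def by (rule weighted.kernel_bounded_op)
    show "spectral_gap (l2_space \<pi>) (l2_norm \<pi>) P \<pi>" by (rule spectral_gap_l2)
    show "spectral_gap (weighted_space V) (weighted_norm V) P \<pi>"
      unfolding V_def by (rule spectral_gap_weighted)
    show "max (ess_spectral_radius (weighted_space V) (weighted_norm V) (kernel_op P))
           (ess_spectral_radius (l2_space \<pi>) (l2_norm \<pi>) (kernel_op P)) \<le> ereal \<alpha>"
      unfolding V_def
      by (intro max.boundedI weighted.ess_spectral_radius_le l2.ess_spectral_radius_le)
  qed (use a b in auto)
qed

end
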